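(* Let $\mathcal{A}$ be a (central, essential) arrangement of $n$ hyperplanes of rank $3$, and let $\lambda\in\mathbb{C}^n$ be a collection of weights for which $H^p(A(\mathcal{A}),\omega_\lambda)\neq 0$. Then the codimension of $\overline{\Sigma}_\lambda$ is at most $p$.
   Context: Let $V=\mathbb{C}^\ell$ with coordinate ring $R=\mathbb{C}[x_1,\dots,x_\ell]$. Let $\mathcal{A}=\{H_1,\dots,H_n\}$ be a central, essential arrangement: the $H_i=\ker f_i$ are distinct hyperplanes through the origin, $f_i$ is a nonzero linear form, and $\mathcal{A}$ contains $\ell$ linearly independent hyperplanes; its rank is then $\ell$ (so here $\ell=3$). Put $Q=\prod_{i=1}^n f_i$ and let $R_Q$ be the localization of $R$ at the powers of $Q$. For $\lambda\in\mathbb{C}^n$ let $\omega_\lambda=\sum_{i=1}^n\lambda_i\, df_i/f_i$. The Orlik–Solomon algebra $A(\mathcal{A})$ is identified with the $\mathbb{C}$-subalgebra of the algebra of rational differential forms on $V$ with coefficients in $R_Q$ generated by $1$ and the forms $df_i/f_i$, graded by form degree; $H^\bullet(A(\mathcal{A}),\omega_\lambda)$ is the cohomology of $A(\mathcal{A})$ with differential given by left multiplication by $\omega_\lambda$. Let $\mathrm{Der}(\mathcal{A})=\{\theta\in \mathrm{Der}_{\mathbb{C}}(R): \theta(Q)\in (Q)\}$. Let $I_\lambda$ be the ideal of $R$ generated by the polynomials $\langle\theta,\omega_\lambda\rangle=\sum_{i=1}^n\lambda_i\,\theta(f_i)/f_i$ for $\theta\in\mathrm{Der}(\mathcal{A})$,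 and $\overline{\Sigma}_\lambda=V(I_\lambda)\subseteq\mathbb{C}^\ell$; codimension is taken in $\mathbb{C}^\ell$. *)

theory Defs
  imports
    "HOL-Analysis.Analysis"
    "HOL-Library.Poly_Mapping"
    "HOL-Computational_Algebra.Polynomial_Factorial"
    "HOL-Algebra.Coset"
begin

section \<open>The coordinate ring of complex affine space\<close>

text \<open>
  The type \<open>'n\<close> indexes the coordinates. A polynomial maps exponent vectors to coefficients with
  finite support. The order on \<open>'n\<close> makes the polynomial ring an integral domain in the type class
  sense, and it fixes the signs in the exterior algebra below.
\<close>

type_synonym 'n mpoly = "('n \<Rightarrow>\<^sub>0 nat) \<Rightarrow>\<^sub>0 complex"

type_synonym 'n ratfun = "'n mpoly fract"

definition const_poly :: "complex \<Rightarrow> 'n mpoly" where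
  "const_poly c = Poly_Mapping.single 0 c"

definition var_poly :: "'n \<Rightarrow> 'n mpoly" where
  "var_poly j = Poly_Mapping.single (Poly_Mapping.single j 1) 1"

definition linear_form :: "complex ^ 'n::finite \<Rightarrow> 'n mpoly" where
  "linear_form a = (\<Sum>j\<in>UNIV. const_poly (a $ j) * var_poly j)"

definition eval_poly :: "'n mpoly \<Rightarrow> complex ^ 'n::finite \<Rightarrow> complex" where
  "eval_poly q x =
    (\<Sum>m\<in>Poly_Mapping.keys q.
      Poly_Mapping.lookup q m * (\<Prod>j\<in>UNIV. (x $ j) ^ Poly_Mapping.lookup m j))"

definition vanishing_locus :: "'n mpoly set \<Rightarrow> (complex ^ 'n::finite) set" where
  "vanishing_locus S = {x. \<forall>q\<in>S. eval_poly q x = 0}"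

text \<open>For a commutative ring, submodules of the ring over itself are its ideals.\<close>

definition ideal_generated :: "'a::comm_ring_1 set \<Rightarrow> 'a set" where
  "ideal_generated S = module.span (*) S"

definition derivation :: "('n mpoly \<Rightarrow> 'n mpoly) \<Rightarrow> bool" where
  "derivation \<theta> \<longleftrightarrow>
    (\<forall>q r. \<theta> (q + r) = \<theta> q + \<theta> r) \<and>
    (\<forall>c q. \<theta> (const_poly c * q) = const_poly c * \<theta> q) \<and>
    (\<forall>q r. \<theta> (q * r) = \<theta> q * r + q * \<theta> r)"

section \<open>Arrangements\<close>

text \<open>
  An arrangement of \<open>n\<close> hyperplanes in an ordering: \<open>f i\<close>, for \<open>i < n\<close>, is the coefficient vector of
  the linear form that defines the \<open>i\<close>-th hyperplane. Values \<open>f i\<close> with \<open>i \<ge> n\<close> are irrelevant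
  throughout, and likewise for the weights.
\<close>

definition hyperplane :: "complex ^ 'n::finite \<Rightarrow> (complex ^ 'n) set" where
  "hyperplane a = vanishing_locus {linear_form a}"

definition central_essential_arrangement :: "nat \<Rightarrow> (nat \<Rightarrow> complex ^ 'n::finite) \<Rightarrow> bool" where
  "central_essential_arrangement n f \<longleftrightarrow>
    (\<forall>i<n. f i \<noteq> 0) \<and>
    inj_on (\<lambda>i. hyperplane (f i)) {..<n} \<and>
    (\<exists>J\<subseteq>{..<n}. card J = CARD('n) \<and> vec.independent (f ` J))"

definition defining_poly :: "nat \<Rightarrow> (nat \<Rightarrow> complex ^ 'n::finite) \<Rightarrow> 'n mpoly" where
  "defining_poly n f = (\<Prod>i<n. linear_form (f i))"

definition Der_arr ::
    "nat \<Rightarrow> (nat \<Rightarrow> complex ^ 'n::finite) \<Rightarrow> ('n mpoly \<Rightarrow> 'n mpoly) set" where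
  "Der_arr n f =
    {\<theta>. derivation \<theta> \<and> \<theta> (defining_poly n f) \<in> ideal_generated {defining_poly n f}}"

section \<open>Rational differential forms and the Orlik--Solomon algebra\<close>

text \<open>
  The component at \<open>S = {s\<^sub>1 < \<dots> < s\<^sub>k}\<close> is the coefficient of \<open>dx\<^bsub>s\<^sub>1\<^esub> \<and> \<dots> \<and> dx\<^bsub>s\<^sub>k\<^esub>\<close>.
  Coefficients are taken in the whole field of rational functions, of which the localization at the
  defining polynomial is a subring.
\<close>

type_synonym 'n form = "('n ratfun, 'n set) vec"

text \<open>
  The sign is that of the permutation sorting the elements of \<open>S\<close> followed by those of \<open>U - S\<close>.
\<close>

definition wedge ::
    "'n::{finite,linorder} form \<Rightarrow> 'n form \<Rightarrow> 'n form" (infixl \<open>\<and>\<^sub>f\<close> 70) where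
  "\<alpha> \<and>\<^sub>f \<beta> =
    (\<chi> U. \<Sum>S\<in>Pow U.
      (- 1) ^ card {(s, t). s \<in> S \<and> t \<in> U - S \<and> t < s} * (\<alpha> $ S) * (\<beta> $ (U - S)))"

definition one_form :: "'n::{finite,linorder} form" where
  "one_form = axis {} 1"

definition dvar :: "'n::{finite,linorder} \<Rightarrow> 'n form" where
  "dvar j = axis {j} 1"

definition homogeneous_form :: "nat \<Rightarrow> 'n::{finite,linorder} form \<Rightarrow> bool" where
  "homogeneous_form p \<alpha> \<longleftrightarrow> (\<forall>S. \<alpha> $ S \<noteq> 0 \<longrightarrow> card S = p)"

text \<open>The differential of the linear form \<open>\<Sum>j. a $ j * x\<^sub>j\<close>.\<close>

definition d_linear :: "complex ^ 'n::{finite,linorder} \<Rightarrow> 'n form" where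
  "d_linear a = (\<Sum>j\<in>UNIV. to_fract (const_poly (a $ j)) *s dvar j)"

definition dlog_linear :: "complex ^ 'n::{finite,linorder} \<Rightarrow> 'n form" where
  "dlog_linear a = (1 / to_fract (linear_form a)) *s d_linear a"

definition omega ::
    "nat \<Rightarrow> (nat \<Rightarrow> complex ^ 'n::{finite,linorder}) \<Rightarrow> (nat \<Rightarrow> complex) \<Rightarrow> 'n form" where
  "omega n f lam = (\<Sum>i<n. to_fract (const_poly (lam i)) *s dlog_linear (f i))"

inductive_set OS_algebra :: "nat \<Rightarrow> (nat \<Rightarrow> complex ^ 'n::{finite,linorder}) \<Rightarrow> 'n form set"
  for n f where
  OS_one: "one_form \<in> OS_algebra n f"
| OS_gen: "i < n \<Longrightarrow> dlog_linear (f i) \<in> OS_algebra n f"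
| OS_add: "\<alpha> \<in> OS_algebra n f \<Longrightarrow> \<beta> \<in> OS_algebra n f \<Longrightarrow> \<alpha> + \<beta> \<in> OS_algebra n f"
| OS_scale: "\<alpha> \<in> OS_algebra n f \<Longrightarrow> to_fract (const_poly c) *s \<alpha> \<in> OS_algebra n f"
| OS_wedge: "\<alpha> \<in> OS_algebra n f \<Longrightarrow> \<beta> \<in> OS_algebra n f \<Longrightarrow> \<alpha> \<and>\<^sub>f \<beta> \<in> OS_algebra n f"

definition OS_graded ::
    "nat \<Rightarrow> (nat \<Rightarrow> complex ^ 'n::{finite,linorder}) \<Rightarrow> nat \<Rightarrow> 'n form set" where
  "OS_graded n f p = {\<alpha> \<in> OS_algebra n f. homogeneous_form p \<alpha>}"

definition OS_cocycles ::
    "nat \<Rightarrow> (nat \<Rightarrow> complex ^ 'n::{finite,linorder}) \<Rightarrow> (nat \<Rightarrow> complex) \<Rightarrow> nat \<Rightarrow> 'n form set" where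
  "OS_cocycles n f lam p = {\<alpha> \<in> OS_graded n f p. omega n f lam \<and>\<^sub>f \<alpha> = 0}"

definition OS_coboundaries ::
    "nat \<Rightarrow> (nat \<Rightarrow> complex ^ 'n::{finite,linorder}) \<Rightarrow> (nat \<Rightarrow> complex) \<Rightarrow> nat \<Rightarrow> 'n form set" where
  "OS_coboundaries n f lam p =
    (case p of 0 \<Rightarrow> {0} | Suc q \<Rightarrow> (\<lambda>\<alpha>. omega n f lam \<and>\<^sub>f \<alpha>) ` OS_graded n f q)"

definition OS_cohomology ::
    "nat \<Rightarrow> (nat \<Rightarrow> complex ^ 'n::{finite,linorder}) \<Rightarrow> (nat \<Rightarrow> complex) \<Rightarrow> nat \<Rightarrow>
      'n form set monoid" where
  "OS_cohomology n f lam p =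
    \<lparr>carrier = OS_cocycles n f lam p, monoid.mult = (+), one = 0\<rparr> Mod OS_coboundaries n f lam p"

section \<open>The critical locus\<close>

text \<open>
  The pairing of \<open>\<theta>\<close> with the logarithmic form; it is a polynomial when \<open>\<theta>\<close> lies in \<open>Der_arr n f\<close>.
\<close>

definition pairing_omega ::
    "nat \<Rightarrow> (nat \<Rightarrow> complex ^ 'n::{finite,linorder}) \<Rightarrow> (nat \<Rightarrow> complex) \<Rightarrow>
      ('n mpoly \<Rightarrow> 'n mpoly) \<Rightarrow> 'n ratfun" where
  "pairing_omega n f lam \<theta> =
    (\<Sum>i<n. to_fract (const_poly (lam i)) *
      (to_fract (\<theta> (linear_form (f i))) / to_fract (linear_form (f i))))"

definition critical_ideal ::
    "nat \<Rightarrow> (nat \<Rightarrow> complex ^ 'n::{finite,linorder}) \<Rightarrow> (nat \<Rightarrow> complex) \<Rightarrow> 'n mpoly set" where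
  "critical_ideal n f lam =
    ideal_generated {g. \<exists>\<theta>\<in>Der_arr n f. to_fract g = pairing_omega n f lam \<theta>}"

definition Sigma_bar ::
    "nat \<Rightarrow> (nat \<Rightarrow> complex ^ 'n::{finite,linorder}) \<Rightarrow> (nat \<Rightarrow> complex) \<Rightarrow>
      (complex ^ 'n::{finite,linorder}) set" where
  "Sigma_bar n f lam = vanishing_locus (critical_ideal n f lam)"

section \<open>Codimension\<close>

definition zariski_closed :: "(complex ^ 'n::finite) set \<Rightarrow> bool" where
  "zariski_closed Z \<longleftrightarrow> (\<exists>S. Z = vanishing_locus S)"

definition zariski_irreducible :: "(complex ^ 'n::finite) set \<Rightarrow> bool" where
  "zariski_irreducible Z \<longleftrightarrow> Z \<noteq> {} \<and>
    (\<forall>A B. zariski_closed A \<and> zariski_closed B \<and> Z \<subseteq> A \<union> B \<longrightarrow> Z \<subseteq> A \<or> Z \<subseteq> B)"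

text \<open>
  The Krull dimension of a nonempty Zariski closed set: the supremum of the lengths \<open>k\<close> of chains
  \<open>Z 0 \<subset> \<dots> \<subset> Z k\<close> of irreducible closed subsets.
\<close>

definition zariski_dim :: "(complex ^ 'n::finite) set \<Rightarrow> enat" where
  "zariski_dim Y =
    Sup {enat k | k. \<exists>Z. (\<forall>i\<le>k. zariski_closed (Z i) \<and> zariski_irreducible (Z i) \<and> Z i \<subseteq> Y) \<and>
                        (\<forall>i<k. Z i \<subset> Z (Suc i))}"

text \<open>
  The codimension in the ambient affine space. The dimension never exceeds \<open>CARD('n)\<close>, so the
  subtraction does not truncate. The empty set has codimension infinity, not \<open>CARD('n)\<close>.
\<close>

definition zariski_codim :: "(complex ^ 'n::finite) set \<Rightarrow> enat" where
  "zariski_codim Y = (if Y = {} then \<infinity> else enat CARD('n) - zariski_dim Y)"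

end

theory Submission
  imports Defs "HOL-Computational_Algebra.Field_as_Ring" "HOL-Computational_Algebra.Fundamental_Theorem_Algebra"
begin

text \<open>
  Let \<open>Q\<close> be the product of the linear forms, \<open>E\<close> the Euler field and \<open>W = Q \<omega>\<close>, a vector of
  polynomials. A derivation in \<open>Der_arr\<close> is a vector \<open>v\<close> of polynomials with \<open>f i \<bullet> v = c i * L i\<close>, where
  \<open>L i\<close> is the linear form of \<open>f i\<close>, and the critical ideal \<open>I\<close> consists of the polynomials
  \<open>\<Sum>i. lam i * c i\<close> (\<open>critical_ideal_eq_crit\<close>). It is invariant under dilations, so its zero set
  \<open>\<Sigma>\<close> is a cone. The theorem splits into three statements about \<open>\<Sigma>\<close>.

  \<^item> A nonzero class in degree \<open>0\<close> forces \<open>\<omega> = 0\<close>. Then \<open>I = 0\<close> and \<open>\<Sigma>\<close> is the whole space.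

  \<^item> Let \<open>\<omega> \<noteq> 0\<close>. A nonzero class in degree \<open>1\<close> is a form \<open>\<eta>\<close> with
    \<open>\<omega> \<and> \<eta> = 0\<close>, that is \<open>\<eta> = h \<omega>\<close> for a rational function \<open>h = p / r\<close> in lowest terms. Pairing with a derivation \<open>\<theta>\<close> shows that
    \<open>r * \<langle>\<theta>, \<eta>\<rangle> = p * \<langle>\<theta>, \<omega>\<rangle>\<close> with both pairings polynomials, so \<open>r\<close> divides every element
    of \<open>I\<close> (\<open>common_factor\<close>). The function \<open>h\<close> is homogeneous of degree \<open>0\<close>; if \<open>r\<close> were a unit, \<open>h\<close> would
    be constant and \<open>\<eta>\<close> a coboundary. Hence \<open>\<Sigma>\<close> contains the surface \<open>r = 0\<close>.

  \<^item> A nonzero class in any degree forces \<open>0 \<in> \<Sigma>\<close> (\<open>origin_in_Sigma_bar\<close>). Otherwise some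
    \<open>\<langle>\<theta>, \<omega>\<rangle>\<close> is nonzero at the origin, and \<open>\<theta>\<close> may be replaced by its linear part. Contraction
    with a linear logarithmic field maps each \<open>df\<^sub>i / f\<^sub>i\<close> to a constant, hence preserves the
    Orlik--Solomon algebra, and it is a contracting homotopy up to the nonzero factor \<open>\<langle>\<theta>, \<omega>\<rangle>\<close>.

  For degrees \<open>\<ge> 2\<close> it remains to see that \<open>\<Sigma>\<close> is never the origin alone (\<open>Sigma_bar_not_origin\<close>):
  it then contains a line. Suppose \<open>\<Sigma> = {0}\<close>. Pairing \<open>\<omega>\<close> with \<open>E\<close> gives \<open>\<Sum>i. lam i = 0\<close>.
  By the Nullstellensatz \<open>I\<close> contains powers of the three
  variables \<open>x\<^sub>k\<close>, so there is \<open>g \<notin> I\<close> with \<open>x\<^sub>k g \<in> I\<close> for all \<open>k\<close>. Modulo \<open>E\<close>, logarithmic fields are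
  encoded by the vectors \<open>\<Phi> = v \<times> E\<close>, and \<open>W \<times> \<Phi> = - Q * \<langle>v, \<omega>\<rangle> * E\<close>. The fields pairing to zero
  with \<open>\<omega>\<close> correspond to a free module of rank one, generated by \<open>W\<close> (\<open>proportional_if_parallel\<close>). If
  \<open>\<Phi>\<^sub>k\<close> belongs to \<open>x\<^sub>k g\<close>, then \<open>x\<^sub>l \<Phi>\<^sub>k - x\<^sub>k \<Phi>\<^sub>l\<close> is a multiple of \<open>W\<close>, and these multiples form a
  Koszul cocycle. As the Koszul complex is exact, the \<open>\<Phi>\<^sub>k\<close> can be changed by multiples of \<open>W\<close> such that
  \<open>\<Phi>\<^sub>k = x\<^sub>k \<Phi>\<close> for a common \<open>\<Phi>\<close>, which comes from a logarithmic field pairing to \<open>g\<close>. So \<open>g \<in> I\<close>, a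
  contradiction (\<open>socle_in_crit\<close>). In homological terms: the rank two module of logarithmic fields modulo
  \<open>E\<close> is reflexive and the kernel of its map onto \<open>I\<close> is free, so the quotient by \<open>I\<close> has no socle.
\<close>

section \<open>Substitution homomorphisms\<close>

lemma monomial_expansion:
  "(\<Sum>m\<in>Poly_Mapping.keys p. Poly_Mapping.single m (Poly_Mapping.lookup p m)) = p"
proof (rule poly_mapping_eqI)
  fix k
  have "Poly_Mapping.lookup (\<Sum>m\<in>Poly_Mapping.keys p. Poly_Mapping.single m (Poly_Mapping.lookup p m)) k
    = (\<Sum>m\<in>Poly_Mapping.keys p. if m = k then Poly_Mapping.lookup p k else 0)"
    unfolding lookup_sum by (rule sum.cong) (auto simp: lookup_single when_def)
  then show "Poly_Mapping.lookup (\<Sum>m\<in>Poly_Mapping.keys p. Poly_Mapping.single m (Poly_Mapping.lookup p m)) k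
    = Poly_Mapping.lookup p k"
    by (simp add: in_keys_iff)
qed

text \<open>
  Evaluation, restriction to a line, substitution, first order deformation along a vector field and the
  passage to iterated univariate polynomials are all instances of the homomorphism \<open>insertion\<close>: a
  homomorphism on the coefficients together with values for the variables.
\<close>

locale coeff_hom =
  fixes \<phi> :: "complex \<Rightarrow> 'b::comm_ring_1"
  assumes \<phi>_0: "\<phi> 0 = 0" and \<phi>_1: "\<phi> 1 = 1"
    and \<phi>_add: "\<phi> (a + b) = \<phi> a + \<phi> b"
    and \<phi>_mult: "\<phi> (a * b) = \<phi> a * \<phi> b"
begin

definition mono_val :: "('n::finite \<Rightarrow> 'b) \<Rightarrow> ('n \<Rightarrow>\<^sub>0 nat) \<Rightarrow> 'b" where
  "mono_val s m = (\<Prod>j\<in>UNIV. s j ^ Poly_Mapping.lookup m j)"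

definition insertion :: "('n::finite \<Rightarrow> 'b) \<Rightarrow> 'n mpoly \<Rightarrow> 'b" where
  "insertion s q = (\<Sum>m\<in>Poly_Mapping.keys q. \<phi> (Poly_Mapping.lookup q m) * mono_val s m)"

lemma mono_val_0 [simp]: "mono_val s 0 = 1"
  by (simp add: mono_val_def)

lemma mono_val_add: "mono_val s (m + m') = mono_val s m * mono_val s m'"
  by (simp add: mono_val_def lookup_add power_add prod.distrib)

lemma mono_val_single: "mono_val s (Poly_Mapping.single j 1) = s j"
proof -
  have "mono_val s (Poly_Mapping.single j 1) = (\<Prod>k\<in>UNIV. if k = j then s j else 1)"
    unfolding mono_val_def by (rule prod.cong) (auto simp: lookup_single when_def)
  then show ?thesis by simp
qed

lemma insertion_superset:
  assumes "finite A" "Poly_Mapping.keys q \<subseteq> A"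
  shows "insertion s q = (\<Sum>m\<in>A. \<phi> (Poly_Mapping.lookup q m) * mono_val s m)"
  unfolding insertion_def
  by (rule sum.mono_neutral_left[OF assms]) (auto simp: in_keys_iff \<phi>_0)

lemma insertion_0 [simp]: "insertion s 0 = 0"
  by (simp add: insertion_def)

lemma insertion_single: "insertion s (Poly_Mapping.single m c) = \<phi> c * mono_val s m"
  by (cases "c = 0") (simp_all add: insertion_def \<phi>_0)

lemma insertion_1 [simp]: "insertion s 1 = 1"
  using insertion_single[of s 0 1] by (simp add: \<phi>_1)

lemma insertion_add: "insertion s (q + r) = insertion s q + insertion s r"
proof -
  let ?A = "Poly_Mapping.keys q \<union> Poly_Mapping.keys r"
  have "insertion s (q + r) = (\<Sum>m\<in>?A. \<phi> (Poly_Mapping.lookup (q + r) m) * mono_val s m)"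
    by (rule insertion_superset) (auto dest: subsetD[OF keys_add])
  also have "\<dots> = (\<Sum>m\<in>?A. \<phi> (Poly_Mapping.lookup q m) * mono_val s m) + (\<Sum>m\<in>?A. \<phi> (Poly_Mapping.lookup r m) * mono_val s m)"
    by (simp add: lookup_add \<phi>_add distrib_right sum.distrib)
  also have "\<dots> = insertion s q + insertion s r"
    by (simp add: insertion_superset[of ?A])
  finally show ?thesis .
qed

lemma insertion_sum: "insertion s (sum g A) = (\<Sum>a\<in>A. insertion s (g a))"
  by (induction A rule: infinite_finite_induct) (simp_all add: insertion_add)

lemma insertion_mult: "insertion s (q * r) = insertion s q * insertion s r"
proof -
  have sums: "(\<Sum>m\<in>Poly_Mapping.keys p. Poly_Mapping.single m (Poly_Mapping.lookup p m)) = p" for p :: "'n::finite mpoly"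
    by (rule monomial_expansion)
  have "q * r = (\<Sum>m\<in>Poly_Mapping.keys q. Poly_Mapping.single m (Poly_Mapping.lookup q m)) *
      (\<Sum>k\<in>Poly_Mapping.keys r. Poly_Mapping.single k (Poly_Mapping.lookup r k))"
    by (simp only: sums)
  also have "\<dots> = (\<Sum>m\<in>Poly_Mapping.keys q. \<Sum>k\<in>Poly_Mapping.keys r.
      Poly_Mapping.single (m + k) (Poly_Mapping.lookup q m * Poly_Mapping.lookup r k))"
    by (simp add: sum_product mult_single)
  finally have "insertion s (q * r) = (\<Sum>m\<in>Poly_Mapping.keys q. \<Sum>k\<in>Poly_Mapping.keys r.
      \<phi> (Poly_Mapping.lookup q m * Poly_Mapping.lookup r k) * mono_val s (m + k))"
    by (simp add: insertion_sum insertion_single)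
  then show ?thesis
    by (simp add: sum_product mono_val_add \<phi>_mult insertion_def[of s q] insertion_def[of s r] mult_ac)
qed

lemma insertion_const [simp]: "insertion s (const_poly c) = \<phi> c"
  by (simp add: const_poly_def insertion_single)

lemma insertion_var [simp]: "insertion s (var_poly j) = s j"
  using insertion_single[of s "Poly_Mapping.single j 1" 1] mono_val_single[of s j] by (simp add: var_poly_def \<phi>_1)

lemma insertion_uminus: "insertion s (- q) = - insertion s q"
  by (metis add_eq_0_iff insertion_0 insertion_add)

lemma insertion_diff: "insertion s (q - r) = insertion s q - insertion s r"
  using insertion_add[of s q "- r"] by (simp add: insertion_uminus)

lemma insertion_power: "insertion s (q ^ k) = insertion s q ^ k"
  by (induction k) (simp_all add: insertion_mult)

lemma insertion_prod: "insertion s (prod g A) = (\<Prod>a\<in>A. insertion s (g a))"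
  by (induction A rule: infinite_finite_induct) (simp_all add: insertion_mult)

lemmas insertion_simps = insertion_add insertion_mult insertion_uminus insertion_diff insertion_power
  insertion_sum insertion_prod

end

lemma mpoly_induct [case_names const var add mult]:
  fixes q :: "'n::finite mpoly"
  assumes "\<And>c. P (const_poly c)" "\<And>j. P (var_poly j)"
    and add: "\<And>q r. P q \<Longrightarrow> P r \<Longrightarrow> P (q + r)" and mult: "\<And>q r. P q \<Longrightarrow> P r \<Longrightarrow> P (q * r)"
  shows "P q"
proof -
  have c0: "P 0" using assms(1)[of 0] by (simp add: const_poly_def)
  have c1: "P 1" using assms(1)[of 1] by (simp add: const_poly_def)
  have pow: "P (var_poly j ^ k)" for j k
    by (induction k) (simp_all add: c1 assms)
  have prod: "P (\<Prod>j\<in>A. g j)" if "\<And>j. P (g j)" for A and g :: "'n \<Rightarrow> 'n mpoly"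
    using that by (induction A rule: infinite_finite_induct) (simp_all add: c1 mult)
  have vp: "var_poly j ^ k = (Poly_Mapping.single (Poly_Mapping.single j k) 1 :: 'n mpoly)" for j k
    by (induction k) (simp_all add: var_poly_def mult_single single_add[symmetric])
  have prodsingle: "(\<Prod>j\<in>A. Poly_Mapping.single (g j) 1) = (Poly_Mapping.single (\<Sum>j\<in>A. g j) 1 :: 'n mpoly)"
    if "finite A" for A and g :: "'n \<Rightarrow> 'n \<Rightarrow>\<^sub>0 nat"
    using that by (induction A rule: finite_induct) (simp_all add: mult_single)
  have single: "P (Poly_Mapping.single m c)" for m c
  proof -
    have "m = (\<Sum>j\<in>UNIV. Poly_Mapping.single j (Poly_Mapping.lookup m j))"
      by (rule poly_mapping_eqI) (simp add: lookup_sum lookup_single when_def)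
    then have "Poly_Mapping.single m c = const_poly c * (\<Prod>j\<in>UNIV. var_poly j ^ Poly_Mapping.lookup m j)"
      by (simp add: vp prodsingle const_poly_def mult_single)
    then show ?thesis by (simp add: assms(1) mult prod pow)
  qed
  have "P (\<Sum>m\<in>A. Poly_Mapping.single m (Poly_Mapping.lookup q m))" if "finite A" for A
    using that by (induction A rule: finite_induct) (simp_all add: c0 add single)
  from this[of "Poly_Mapping.keys q"] show ?thesis
    by (simp add: monomial_expansion)
qed

lemma const_poly_add: "const_poly (a + b) = const_poly a + const_poly b"
  by (simp add: const_poly_def single_add)
lemma const_poly_mult: "const_poly (a * b) = const_poly a * const_poly b"
  by (simp add: const_poly_def mult_single)
lemma const_poly_0 [simp]: "const_poly 0 = 0"
  by (simp add: const_poly_def)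
lemma const_poly_1 [simp]: "const_poly 1 = 1"
  by (simp add: const_poly_def)
lemma const_poly_uminus: "const_poly (- a) = - const_poly a"
  by (simp add: const_poly_def single_uminus)
lemma const_poly_sum: "const_poly (sum g A) = (\<Sum>a\<in>A. const_poly (g a))"
  by (induction A rule: infinite_finite_induct) (simp_all add: const_poly_add)

section \<open>Evaluation\<close>

global_interpretation ev: coeff_hom "\<lambda>c::complex. c"
  by unfold_locales auto

lemma eval_poly_eq_insertion: "eval_poly q x = ev.insertion (\<lambda>j. x $ j) q"
  by (simp add: eval_poly_def ev.insertion_def ev.mono_val_def)

lemma eval_simps [simp]:
  "eval_poly 0 x = 0" "eval_poly 1 x = 1" "eval_poly (const_poly c) x = c" "eval_poly (var_poly j) x = x $ j"
  "eval_poly (q + r) x = eval_poly q x + eval_poly r x"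
  "eval_poly (q - r) x = eval_poly q x - eval_poly r x"
  "eval_poly (- q) x = - eval_poly q x"
  "eval_poly (q * r) x = eval_poly q x * eval_poly r x"
  "eval_poly (q ^ k) x = eval_poly q x ^ k"
  unfolding eval_poly_eq_insertion
  by (rule ev.insertion_0 ev.insertion_1 ev.insertion_const ev.insertion_var ev.insertion_add
      ev.insertion_diff ev.insertion_uminus ev.insertion_mult ev.insertion_power)+

lemma eval_sum [simp]: "eval_poly (sum g A) x = (\<Sum>a\<in>A. eval_poly (g a) x)"
  and eval_prod [simp]: "eval_poly (prod g A) x = (\<Prod>a\<in>A. eval_poly (g a) x)"
  unfolding eval_poly_eq_insertion by (rule ev.insertion_sum ev.insertion_prod)+

lemma eval_linear_form [simp]: "eval_poly (linear_form a) x = (\<Sum>j\<in>UNIV. a $ j * x $ j)"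
  by (simp add: linear_form_def)

text \<open>
  Restriction to the line through \<open>x\<close> with direction \<open>v\<close>. It lands in a domain, which is what makes
  affine subspaces irreducible below.
\<close>

global_interpretation li: coeff_hom "\<lambda>c::complex. [:c:]"
  by unfold_locales auto

definition line_poly :: "complex ^ 'n::finite \<Rightarrow> complex ^ 'n \<Rightarrow> 'n mpoly \<Rightarrow> complex poly" where
  "line_poly x v = li.insertion (\<lambda>j. [:x $ j, v $ j:])"

lemma poly_line_poly: "poly (line_poly x v q) t = eval_poly q (\<chi> j. x $ j + t * v $ j)"
  by (induction q rule: mpoly_induct) (simp_all add: line_poly_def li.insertion_simps)

global_interpretation su: coeff_hom "\<lambda>c. const_poly c :: 'n::finite mpoly"
  by unfold_locales (auto simp: const_poly_add const_poly_mult)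

definition subst_poly :: "('n::finite \<Rightarrow> 'n mpoly) \<Rightarrow> 'n mpoly \<Rightarrow> 'n mpoly" where
  "subst_poly = su.insertion"

lemma subst_simps [simp]:
  "subst_poly s 0 = 0" "subst_poly s 1 = 1" "subst_poly s (const_poly c) = const_poly c"
  "subst_poly s (var_poly j) = s j"
  "subst_poly s (q + r) = subst_poly s q + subst_poly s r"
  "subst_poly s (q - r) = subst_poly s q - subst_poly s r"
  "subst_poly s (- q) = - subst_poly s q"
  "subst_poly s (q * r) = subst_poly s q * subst_poly s r"
  "subst_poly s (q ^ k) = subst_poly s q ^ k"
  by (simp_all add: subst_poly_def su.insertion_simps)

lemma subst_sum [simp]: "subst_poly s (sum g A) = (\<Sum>a\<in>A. subst_poly s (g a))"
  and subst_prod [simp]: "subst_poly s (prod g A) = (\<Prod>a\<in>A. subst_poly s (g a))"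
  by (simp_all add: subst_poly_def su.insertion_simps)

lemma eval_subst [simp]: "eval_poly (subst_poly s q) x = eval_poly q (\<chi> j. eval_poly (s j) x)"
  by (induction q rule: mpoly_induct) simp_all

text \<open>
  Modulo \<open>d\<close>, the substitution and the identity are homomorphisms that agree on the variables.
\<close>

lemma subst_congruent: 
  assumes "\<And>j. d dvd s j - var_poly j"
  shows "d dvd subst_poly s q - q"
proof (induction q rule: mpoly_induct)
  case (add q r)
  have "subst_poly s (q + r) - (q + r) = (subst_poly s q - q) + (subst_poly s r - r)" by simp
  then show ?case using add by (metis dvd_add)
next
  case (mult q r)
  have "subst_poly s (q * r) - (q * r) = (subst_poly s q - q) * subst_poly s r + q * (subst_poly s r - r)" 
    by (simp add: algebra_simps)
  then show ?case using mult by (metis dvd_add dvd_mult dvd_mult2)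
qed (simp_all add: assms)

section \<open>Derivations from vector fields\<close>

global_interpretation de: coeff_hom "\<lambda>c. [:const_poly c:] :: 'n::finite mpoly poly"
  by unfold_locales (auto simp: const_poly_add const_poly_mult)

text \<open>
  Substituting \<open>x\<^sub>j + t v\<^sub>j\<close> for \<open>x\<^sub>j\<close> is a ring homomorphism into polynomials in \<open>t\<close> whose
  constant coefficient is the identity. The Leibniz rule for the coefficient of \<open>t\<close> is then just the
  product formula for coefficients.
\<close>

definition vector_derivation :: "('n::finite mpoly) ^ 'n \<Rightarrow> 'n mpoly \<Rightarrow> 'n mpoly" where
  "vector_derivation v q = coeff (de.insertion (\<lambda>j. [:var_poly j, v $ j:]) q) 1"

lemma coeff_0_shift: "coeff (de.insertion (\<lambda>j. [:var_poly j, v $ j:]) q) 0 = q"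
  by (induction q rule: mpoly_induct) (simp_all add: de.insertion_simps coeff_mult)

lemma derivation_vector_derivation: "derivation (vector_derivation v)"
proof -
  have "vector_derivation v (q * r) = vector_derivation v q * r + q * vector_derivation v r" for q r
    by (simp add: vector_derivation_def de.insertion_simps coeff_mult coeff_0_shift)
  then show ?thesis
    by (auto simp: derivation_def vector_derivation_def de.insertion_simps)
qed

lemma vector_derivation_var: "vector_derivation v (var_poly j) = v $ j"
  by (simp add: vector_derivation_def)

lemma derivation_0: "derivation \<theta> \<Longrightarrow> \<theta> 0 = 0"
  unfolding derivation_def by (metis add_cancel_right_right)

lemma derivation_sum: "derivation \<theta> \<Longrightarrow> \<theta> (sum g A) = (\<Sum>a\<in>A. \<theta> (g a))"
  by (induction A rule: infinite_finite_induct) (auto simp: derivation_0 derivation_def)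

lemma derivation_linear_form:
  assumes "derivation \<theta>"
  shows "\<theta> (linear_form a) = (\<Sum>j\<in>UNIV. const_poly (a $ j) * \<theta> (var_poly j))"
proof -
  have "\<theta> (const_poly c * q) = const_poly c * \<theta> q" for c q
    using assms unfolding derivation_def by blast
  then show ?thesis unfolding linear_form_def derivation_sum[OF assms] by (simp only:)
qed

section \<open>Iterated univariate polynomials\<close>

global_interpretation it: coeff_hom "\<lambda>c. [:[:[:c:]:]:] :: complex poly poly poly"
  by unfold_locales (auto simp: one_pCons)

text \<open>
  The polynomial ring in three variables is isomorphic to the ring of iterated univariate polynomials.
  There, unique factorization holds by Gauss's lemma and a polynomial is determined by its values one
  variable at a time; both facts are carried back along the isomorphism.
\<close>

definition iter_vars :: "3 \<Rightarrow> complex poly poly poly" where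
  "iter_vars j = (if j = 1 then [:0, 1:] else if j = 2 then [:[:0, 1:]:] else [:[:[:0, 1:]:]:])"

definition to_iter :: "3 mpoly \<Rightarrow> complex poly poly poly" where
  "to_iter = it.insertion iter_vars"

lemma three_neq [simp]: "(1::3) \<noteq> 2" "(2::3) \<noteq> 1" "(1::3) \<noteq> 3" "(3::3) \<noteq> 1" "(2::3) \<noteq> 3" "(3::3) \<noteq> 2"
  by auto

lemma to_iter_simps [simp]:
  "to_iter 0 = 0" "to_iter 1 = 1" "to_iter (const_poly c) = [:[:[:c:]:]:]" "to_iter (var_poly j) = iter_vars j"
  "to_iter (q + r) = to_iter q + to_iter r" "to_iter (q - r) = to_iter q - to_iter r"
  "to_iter (q * r) = to_iter q * to_iter r" "to_iter (q ^ k) = to_iter q ^ k"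
  by (simp_all add: to_iter_def it.insertion_simps)

lemma iter_monomial:
  "[:[:[:c:]:]:] * it.mono_val iter_vars m =
    monom (monom (monom c (Poly_Mapping.lookup m 3)) (Poly_Mapping.lookup m 2)) (Poly_Mapping.lookup m 1)"
proof -
  have X: "[:0, 1:] ^ k = monom (1 :: 'a::comm_ring_1) k" for k
    by (induction k) (simp_all add: monom_0 monom_Suc)
  have "it.mono_val iter_vars m = monom 1 (Poly_Mapping.lookup m 1) *
      ([:monom 1 (Poly_Mapping.lookup m 2):] * [:[:monom 1 (Poly_Mapping.lookup m 3):]:])"
    unfolding it.mono_val_def UNIV_3 by (simp add: iter_vars_def poly_const_pow X)
  then show ?thesis by (simp add: smult_monom mult.commute)
qed

lemma coeff_to_iter:
  "coeff (coeff (coeff (to_iter q) (Poly_Mapping.lookup m 1)) (Poly_Mapping.lookup m 2)) (Poly_Mapping.lookup m 3)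
    = Poly_Mapping.lookup q m"
proof -
  have eq: "k = m \<longleftrightarrow> (Poly_Mapping.lookup k 1 = Poly_Mapping.lookup m 1 \<and>
      Poly_Mapping.lookup k 2 = Poly_Mapping.lookup m 2 \<and> Poly_Mapping.lookup k 3 = Poly_Mapping.lookup m 3)"
    for k :: "3 \<Rightarrow>\<^sub>0 nat"
    by (auto simp: poly_mapping_eq_iff fun_eq_iff forall_3)
  have "coeff (coeff (coeff (to_iter q) (Poly_Mapping.lookup m 1)) (Poly_Mapping.lookup m 2)) (Poly_Mapping.lookup m 3)
    = (\<Sum>k\<in>Poly_Mapping.keys q. if k = m then Poly_Mapping.lookup q m else 0)"
    unfolding to_iter_def it.insertion_def iter_monomial coeff_sum coeff_monom
  proof (rule sum.cong)
    fix k
    show "coeff (coeff (if Poly_Mapping.lookup k 1 = Poly_Mapping.lookup m 1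
          then monom (monom (Poly_Mapping.lookup q k) (Poly_Mapping.lookup k 3)) (Poly_Mapping.lookup k 2) else 0)
        (Poly_Mapping.lookup m 2)) (Poly_Mapping.lookup m 3) = (if k = m then Poly_Mapping.lookup q m else 0)"
      using eq[of k] by (cases "k = m") auto
  qed simp
  then show ?thesis by (simp add: in_keys_iff)
qed

lemma to_iter_inject [simp]: "to_iter q = to_iter r \<longleftrightarrow> q = r"
proof
  assume eq: "to_iter q = to_iter r"
  show "q = r"
  proof (rule poly_mapping_eqI)
    show "Poly_Mapping.lookup q m = Poly_Mapping.lookup r m" for m
      using coeff_to_iter[of q m] coeff_to_iter[of r m] eq by simp
  qed
qed simp

lemma to_iter_surj: "\<exists>q. to_iter q = p"
proof -
  define S where "S = range to_iter"
  have cl: "a + b \<in> S" "a * b \<in> S" if "a \<in> S" "b \<in> S" for a b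
    using that unfolding S_def
    by (auto simp: to_iter_simps(5,7)[symmetric] simp del: to_iter_simps)
  have c1: "[:[:[:c:]:]:] \<in> S" for c
    unfolding S_def to_iter_simps(3)[symmetric] by (rule rangeI)
  have v: "iter_vars j \<in> S" for j
    unfolding S_def to_iter_simps(4)[symmetric] by (rule rangeI)
  have X: "[:0, 1:] \<in> S" "[:[:0, 1:]:] \<in> S" "[:[:[:0, 1:]:]:] \<in> S"
    using v[of 1] v[of 2] v[of 3] by (simp_all add: iter_vars_def)
  have c2: "[:[:a:]:] \<in> S" for a
  proof (induction a)
    case 0 then show ?case using c1[of 0] by simp
  next
    case (pCons c a)
    have "[:[:pCons c a:]:] = [:[:[:c:]:]:] + [:[:[:0, 1:]:]:] * [:[:a:]:]" by simp
    then show ?case by (simp only:) (intro cl c1 X pCons.IH)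
  qed
  have c3: "[:a:] \<in> S" for a
  proof (induction a)
    case 0 then show ?case using c1[of 0] by simp
  next
    case (pCons c a)
    have "[:pCons c a:] = [:[:c:]:] + [:[:0, 1:]:] * [:a:]" by simp
    then show ?case by (simp only:) (intro cl c2 X pCons.IH)
  qed
  have "p \<in> S"
  proof (induction p)
    case 0 then show ?case using c1[of 0] by simp
  next
    case (pCons c a)
    have "pCons c a = [:c:] + [:0, 1:] * a" by simp
    then show ?case by (simp only:) (intro cl c3 X pCons.IH)
  qed
  then show ?thesis unfolding S_def by auto
qed

lemma to_iter_dvd_iff [simp]: "to_iter q dvd to_iter r \<longleftrightarrow> q dvd r"
proof
  assume "to_iter q dvd to_iter r"
  then obtain k where "to_iter r = to_iter q * k" by auto
  then show "q dvd r" using to_iter_surj[of k] by (metis dvd_triv_left to_iter_inject to_iter_simps(7))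
qed auto

lemma eval_to_iter: "eval_poly q x = poly (poly (poly (to_iter q) [:[:x $ 1:]:]) [:x $ 2:]) (x $ 3)"
proof (induction q rule: mpoly_induct)
  case (var j) then show ?case using exhaust_3[of j] by (auto simp: iter_vars_def)
qed simp_all

lemma poly_eq_0_if_many_roots:
  fixes p :: "'a::idom poly"
  assumes "inj g" "\<And>c::complex. poly p (g c) = 0"
  shows "p = 0"
proof (rule ccontr)
  assume "p \<noteq> 0"
  then have "finite {x. poly p x = 0}" by (rule poly_roots_finite)
  moreover have "range g \<subseteq> {x. poly p x = 0}" using assms(2) by auto
  ultimately have "finite (range g)" by (rule finite_subset[rotated])
  then show False using assms(1) finite_imageD infinite_UNIV_char_0 by blast
qed

text \<open>
  A univariate polynomial over a domain with infinitely many roots vanishes. This is applied to one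
  variable after the other, with the complex constants as the infinite set of roots.
\<close>

lemma eval_poly_eq_0_iff:
  fixes q :: "3 mpoly"
  shows "(\<forall>x. eval_poly q x = 0) \<longleftrightarrow> q = 0"
proof
  assume *: "\<forall>x. eval_poly q x = 0"
  have 1: "poly (poly (poly (to_iter q) [:[:a:]:]) [:b:]) c = 0" for a b c
    using *[rule_format, of "vector [a, b, c]"] by (simp add: eval_to_iter)
  have "poly (poly (to_iter q) [:[:a:]:]) [:b:] = 0" for a b
    by (rule poly_eq_0_if_many_roots[of "\<lambda>c. c"]) (auto simp: 1)
  then have "poly (to_iter q) [:[:a:]:] = 0" for a
    by (intro poly_eq_0_if_many_roots[of "\<lambda>c. [:c:]"]) (auto simp: inj_def)
  then have "to_iter q = 0"
    by (intro poly_eq_0_if_many_roots[of "\<lambda>c. [:[:c:]:]"]) (auto simp: inj_def)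
  then show "q = 0" by (metis to_iter_inject to_iter_simps(1))
qed simp

lemma eval_poly_eqI:
  fixes q r :: "3 mpoly"
  assumes "\<And>x. eval_poly q x = eval_poly r x"
  shows "q = r"
  using eval_poly_eq_0_iff[of "q - r"] assms by simp

text \<open>
  A fraction in lowest terms. Coprimality of numerator and denominator is stated as the cancellation
  property in which it is used.
\<close>

lemma coprime_fraction:
  fixes a b :: "3 mpoly"
  assumes "b \<noteq> 0"
  obtains g p r where "g \<noteq> 0" "a = g * p" "b = g * r" "\<And>u. r dvd p * u \<Longrightarrow> r dvd u"
proof -
  obtain p' r' where eq: "to_iter a = p' * gcd (to_iter a) (to_iter b)" "to_iter b = r' * gcd (to_iter a) (to_iter b)"
     and cop: "coprime p' r'"
    using gcd_coprime_exists[of "to_iter a" "to_iter b"] assms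
    by (metis gcd_eq_0_iff to_iter_inject to_iter_simps(1))
  obtain g where g: "to_iter g = gcd (to_iter a) (to_iter b)" using to_iter_surj by blast
  obtain p where p: "to_iter p = p'" using to_iter_surj by blast
  obtain r where r: "to_iter r = r'" using to_iter_surj by blast
  have ab: "a = g * p" "b = g * r"
    using eq unfolding g[symmetric] p[symmetric] r[symmetric] to_iter_simps(7)[symmetric] to_iter_inject
    by (simp_all only: mult.commute)
  show ?thesis
  proof
    show "r dvd u" if "r dvd p * u" for u
    proof -
      have "r' dvd p' * to_iter u" using that p r by (metis to_iter_dvd_iff to_iter_simps(7))
      then have "r' dvd to_iter u" using cop by (simp add: coprime_commute coprime_dvd_mult_right_iff)
      then show ?thesis using r by auto
    qed
  qed (use ab assms in auto)
qed

lemma to_iter_unit_iff [simp]: "to_iter q dvd 1 \<longleftrightarrow> q dvd 1"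
  by (metis to_iter_dvd_iff to_iter_simps(2))

lemma to_iter_prime: "prime_elem (to_iter q) \<Longrightarrow> prime_elem q"
  unfolding prime_elem_def by (metis to_iter_dvd_iff to_iter_simps(1,7) to_iter_unit_iff)

text \<open>
  A prime factor is split off with its full multiplicity so that the cofactor does not vanish identically
  on the zero set of the prime.
\<close>

lemma prime_power_decomposition:
  fixes r :: "3 mpoly"
  assumes "r \<noteq> 0" "\<not> r dvd 1"
  obtains p k s where "prime_elem p" "k > 0" "r = p ^ k * s" "\<not> p dvd s"
proof -
  obtain p' where p': "p' dvd to_iter r" "prime_elem p'"
    using prime_divisor_exists[of "to_iter r"] assms
    by (metis prime_imp_prime_elem to_iter_inject to_iter_simps(1) to_iter_unit_iff)
  obtain p where p: "to_iter p = p'" using to_iter_surj by blast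
  obtain s' where s': "to_iter r = p' ^ multiplicity p' (to_iter r) * s'" "\<not> p' dvd s'"
    using multiplicity_decompose'[of "to_iter r" p'] assms p' 
    by (metis prime_elem_not_unit to_iter_inject to_iter_simps(1))
  obtain s where s: "to_iter s = s'" using to_iter_surj by blast
  show ?thesis
  proof
    show "prime_elem p" using p p' to_iter_prime by blast
    show "multiplicity p' (to_iter r) > 0"
      using p' assms by (metis gr0I mult_1 power_0 s')
    show "r = p ^ multiplicity p' (to_iter r) * s"
      using s' p s by (metis to_iter_inject to_iter_simps(7,8))
    show "\<not> p dvd s" using s' p s by (metis to_iter_dvd_iff)
  qed
qed

section \<open>The Nullstellensatz over an uncountable field\<close>

global_interpretation ideal: module "(*) :: 'a::comm_ring_1 \<Rightarrow> 'a \<Rightarrow> 'a"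
  by unfold_locales (simp_all add: algebra_simps)

declare ideal.scale_scale [simp del]

lemma ideal_generated_eq_span: "ideal_generated S = ideal.span S"
  by (simp add: ideal_generated_def)

lemma subspace_dvd: "ideal.subspace {q. d dvd q}"
  by (auto simp: ideal.subspace_def)

lemma subspace_adjoin:
  assumes "ideal.subspace I"
  shows "ideal.subspace {i + u * q | i u. i \<in> I}"
  unfolding ideal.subspace_def
proof (intro conjI ballI allI)
  show "0 \<in> {i + u * q |i u. i \<in> I}"
    using ideal.subspace_0[OF assms] by (auto intro!: exI[of _ 0])
next
  fix x y assume "x \<in> {i + u * q |i u. i \<in> I}" "y \<in> {i + u * q |i u. i \<in> I}"
  then obtain i u j w where *: "x = i + u * q" "y = j + w * q" "i \<in> I" "j \<in> I" by blast
  have "x + y = (i + j) + (u + w) * q" by (simp add: * algebra_simps)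
  then show "x + y \<in> {i + u * q |i u. i \<in> I}" using ideal.subspace_add[OF assms *(3,4)] by blast
next
  fix c x assume "x \<in> {i + u * q |i u. i \<in> I}"
  then obtain i u where *: "x = i + u * q" "i \<in> I" by blast
  have "c * x = c * i + (c * u) * q" by (simp add: * algebra_simps)
  then show "c * x \<in> {i + u * q |i u. i \<in> I}" using ideal.subspace_scale[OF assms *(2)] by blast
qed

lemma adjoin_subset:
  fixes I :: "'a::comm_ring_1 set"
  shows "I \<subseteq> {i + u * q | i u. i \<in> I}"
proof
  fix i assume "i \<in> I"
  then have "i = i + 0 * q \<and> i \<in> I" by simp
  then show "i \<in> {i + u * q | i u. i \<in> I}" by blast
qed

lemma adjoin_generator:
  assumes "ideal.subspace I"
  shows "q \<in> {i + u * q | i u. i \<in> I}"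
proof -
  have "q = 0 + 1 * q \<and> 0 \<in> I" using ideal.subspace_0[OF assms] by simp
  then show ?thesis by blast
qed

text \<open>
  Gaussian elimination: each equation is used to eliminate one unknown.
\<close>

lemma underdetermined_system:
  fixes v :: "'a \<Rightarrow> 'b \<Rightarrow> complex"
  assumes "finite B" "finite A" "card B < card A"
  shows "\<exists>c. (\<exists>a\<in>A. c a \<noteq> 0) \<and> (\<forall>b\<in>B. (\<Sum>a\<in>A. c a * v a b) = 0)"
  using assms
proof (induction B arbitrary: A v rule: finite_induct)
  case empty
  then have "A \<noteq> {}" by auto
  then show ?case by (auto intro!: exI[of _ "\<lambda>_. 1"])
next
  case (insert b B)
  show ?case
  proof (cases "\<forall>a\<in>A. v a b = 0")
    case True
    then show ?thesis using insert.IH[of A v] insert.prems insert.hyps by auto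
  next
    case False
    then obtain a0 where a0: "a0 \<in> A" "v a0 b \<noteq> 0" by blast
    define v' where "v' a x = v a x - v a b / v a0 b * v a0 x" for a x
    have "card B < card (A - {a0})" using insert a0 by simp
    then obtain c where c: "\<exists>a\<in>A - {a0}. c a \<noteq> 0" "\<forall>x\<in>B. (\<Sum>a\<in>A - {a0}. c a * v' a x) = 0"
      using insert.IH[of "A - {a0}" v'] insert.prems by auto
    define c' where "c' a = (if a = a0 then - (\<Sum>a\<in>A - {a0}. c a * v a b / v a0 b) else c a)" for a
    have "(\<Sum>a\<in>A. c' a * v a x) = (\<Sum>a\<in>A - {a0}. c a * v' a x)" for x
    proof -
      have "(\<Sum>a\<in>A. c' a * v a x) = c' a0 * v a0 x + (\<Sum>a\<in>A - {a0}. c' a * v a x)"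
        using insert.prems a0 by (simp add: sum.remove)
      also have "(\<Sum>a\<in>A - {a0}. c' a * v a x) = (\<Sum>a\<in>A - {a0}. c a * v a x)"
        by (rule sum.cong) (auto simp: c'_def)
      finally have *: "(\<Sum>a\<in>A. c' a * v a x) = c' a0 * v a0 x + (\<Sum>a\<in>A - {a0}. c a * v a x)" .
      have "c' a0 * v a0 x = - (\<Sum>a\<in>A - {a0}. c a * (v a b / v a0 b * v a0 x))"
        by (simp add: c'_def sum_distrib_left mult_ac)
      then show ?thesis
        unfolding * v'_def by (simp only: right_diff_distrib sum_subtractf) simp
    qed
    moreover have "v' a b = 0" for a using a0 by (simp add: v'_def)
    ultimately have "\<forall>x\<in>insert b B. (\<Sum>a\<in>A. c' a * v a x) = 0" using c(2) by simp
    moreover have "\<exists>a\<in>A. c' a \<noteq> 0" using c(1) by (auto simp: c'_def)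
    ultimately show ?thesis by blast
  qed
qed

definition univ_subst :: "'n::finite mpoly \<Rightarrow> complex poly \<Rightarrow> 'n mpoly" where
  "univ_subst A p = poly (map_poly const_poly p) A"

lemma univ_subst_0 [simp]: "univ_subst A 0 = 0"
  by (simp add: univ_subst_def)

lemma univ_subst_pCons [simp]: "univ_subst A (pCons a p) = const_poly a + A * univ_subst A p"
  by (simp add: univ_subst_def map_poly_pCons)

lemma univ_subst_add: "univ_subst A (p + q) = univ_subst A p + univ_subst A q"
  by (induction p q rule: poly_induct2) (simp_all add: const_poly_add algebra_simps)

lemma univ_subst_smult: "univ_subst A (smult c p) = const_poly c * univ_subst A p"
  by (induction p) (simp_all add: const_poly_mult algebra_simps)

lemma univ_subst_mult: "univ_subst A (p * q) = univ_subst A p * univ_subst A q"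
  by (induction p) (simp_all add: univ_subst_add univ_subst_smult algebra_simps)

lemma univ_subst_1 [simp]: "univ_subst A 1 = 1"
  by (simp add: one_pCons)

lemma univ_subst_sum: "univ_subst A (sum g S) = (\<Sum>x\<in>S. univ_subst A (g x))"
  by (induction S rule: infinite_finite_induct) (simp_all add: univ_subst_add)

lemma univ_subst_prod: "univ_subst A (prod g S) = (\<Prod>x\<in>S. univ_subst A (g x))"
  by (induction S rule: infinite_finite_induct) (simp_all add: univ_subst_mult)

text \<open>
  The polynomial \<open>p\<close> splits into linear factors. The factors with nonzero root are invertible modulo \<open>I\<close>
  and can be cancelled, which leaves a power of \<open>A\<close>. The factor \<open>A ^ k\<close> collects the roots at zero
  during the induction.
\<close>

lemma power_in_ideal_of_univ_subst:
  assumes I: "ideal.subspace I"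
    and unit: "\<And>b. b \<noteq> 0 \<Longrightarrow> \<exists>u. u * (A - const_poly b) - 1 \<in> I"
    and "p \<noteq> 0" "A ^ k * univ_subst A p \<in> I"
  shows "\<exists>N. A ^ N \<in> I"
  using assms(3,4)
proof (induction "degree p" arbitrary: p k rule: less_induct)
  case less
  show ?case
  proof (cases "degree p = 0")
    case True
    then obtain a where a: "p = [:a:]" by (rule degree_eq_zeroE)
    then have a0: "a \<noteq> 0" using less.prems(1) by simp
    have "const_poly (inverse a) * (A ^ k * const_poly a) \<in> I"
      using less.prems(2) by (intro ideal.subspace_scale[OF I, of "A ^ k * const_poly a"]) (simp add: a)
    also have "const_poly (inverse a) * (A ^ k * const_poly a) = A ^ k * const_poly (inverse a * a)"
      by (simp only: const_poly_mult mult_ac)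
    finally have "A ^ k \<in> I" using a0 by simp
    then show ?thesis by blast
  next
    case False
    then have "\<not> constant (poly p)" by (simp add: constant_degree)
    then obtain r where "poly p r = 0" using fundamental_theorem_of_algebra by blast
    then obtain q where q: "p = [:- r, 1:] * q" by (metis dvdE poly_eq_0_iff_dvd)
    have q0: "q \<noteq> 0" using q less.prems by auto
    then have deg: "degree q < degree p" using q by (simp add: degree_mult_eq del: mult_pCons_left)
    have val: "univ_subst A p = (A - const_poly r) * univ_subst A q"
      unfolding q univ_subst_mult by (simp add: const_poly_uminus)
    show ?thesis
    proof (cases "r = 0")
      case True
      then have "A ^ Suc k * univ_subst A q \<in> I" using less.prems val by (simp add: mult_ac)
      then show ?thesis using less.hyps[OF deg q0] by blast
    next
      case False
      then obtain u where u: "u * (A - const_poly r) - 1 \<in> I" using unit by blast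
      have "u * (A ^ k * univ_subst A p) - (A ^ k * univ_subst A q) * (u * (A - const_poly r) - 1) \<in> I"
        by (rule ideal.subspace_diff[OF I ideal.subspace_scale[OF I less.prems(2)] ideal.subspace_scale[OF I u]])
      also have "u * (A ^ k * univ_subst A p) - (A ^ k * univ_subst A q) * (u * (A - const_poly r) - 1)
        = A ^ k * univ_subst A q" 
        by (simp add: val algebra_simps)
      finally show ?thesis using less.hyps[OF deg q0] by blast
    qed
  qed
qed

lemma finite_bounded_exponents: "finite {m :: 'n::finite \<Rightarrow>\<^sub>0 nat. \<forall>j. Poly_Mapping.lookup m j \<le> d}"
proof (rule finite_imageD)
  show "finite (Poly_Mapping.lookup ` {m :: 'n \<Rightarrow>\<^sub>0 nat. \<forall>j. Poly_Mapping.lookup m j \<le> d})"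
    by (rule finite_subset[OF _ finite_PiE[of UNIV "\<lambda>_. {..d}"]]) auto
  show "inj_on Poly_Mapping.lookup {m :: 'n \<Rightarrow>\<^sub>0 nat. \<forall>j. Poly_Mapping.lookup m j \<le> d}"
    by (intro inj_onI poly_mapping_eqI) (rule fun_cong)
qed

text \<open>
  The heart of the Nullstellensatz. Let \<open>u b\<close> be an inverse of \<open>A - b\<close> modulo \<open>I\<close>. There are
  uncountably many \<open>b\<close>, but the polynomial ring is a countable union of finite dimensional spaces. So
  infinitely many \<open>u b\<close> lie in one of these spaces and satisfy a linear relation. Clearing denominators
  turns the relation into a nonzero univariate polynomial \<open>p\<close> with \<open>p(A) \<in> I\<close>.
\<close>

lemma nilpotent_modulo_ideal:
  fixes A :: "'n::finite mpoly"
  assumes I: "ideal.subspace I"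
    and unit: "\<And>b. b \<noteq> 0 \<Longrightarrow> \<exists>u. u * (A - const_poly b) - 1 \<in> I"
  shows "\<exists>N. A ^ N \<in> I"
proof -
  obtain u where u: "\<And>b. b \<noteq> 0 \<Longrightarrow> u b * (A - const_poly b) - 1 \<in> I"
    using unit by metis
  define B where "B d = {m :: 'n \<Rightarrow>\<^sub>0 nat. \<forall>j. Poly_Mapping.lookup m j \<le> d}" for d
  have bounded: "\<exists>d. Poly_Mapping.keys q \<subseteq> B d" for q :: "'n mpoly"
  proof
    show "Poly_Mapping.keys q \<subseteq> B (\<Sum>m\<in>Poly_Mapping.keys q. \<Sum>j\<in>UNIV. Poly_Mapping.lookup m j)"
    proof
      fix m assume m: "m \<in> Poly_Mapping.keys q"
      have "Poly_Mapping.lookup m j \<le> (\<Sum>m\<in>Poly_Mapping.keys q. \<Sum>j\<in>UNIV. Poly_Mapping.lookup m j)" for j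
      proof -
        have "Poly_Mapping.lookup m j \<le> (\<Sum>j\<in>UNIV. Poly_Mapping.lookup m j)"
          by (rule member_le_sum) auto
        also have "\<dots> \<le> (\<Sum>m\<in>Poly_Mapping.keys q. \<Sum>j\<in>UNIV. Poly_Mapping.lookup m j)"
          using m by (rule member_le_sum) auto
        finally show ?thesis .
      qed
      then show "m \<in> B (\<Sum>m\<in>Poly_Mapping.keys q. \<Sum>j\<in>UNIV. Poly_Mapping.lookup m j)"
        by (simp add: B_def)
    qed
  qed
  define S where "S d = {b. b \<noteq> 0 \<and> Poly_Mapping.keys (u b) \<subseteq> B d}" for d
  have "\<exists>d. infinite (S d)"
  proof (rule ccontr)
    assume "\<not> ?thesis"
    then have "countable (S d)" for d by (simp add: countable_finite)
    then have "countable (\<Union>d. S d)" by simp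
    moreover have "(\<Union>d. S d) = - {0}" using bounded by (auto simp: S_def)
    ultimately have "countable (insert 0 (- {0 :: complex}))" by simp
    moreover have "insert 0 (- {0 :: complex}) = UNIV" by auto
    ultimately show False using uncountable_UNIV_complex by simp
  qed
  then obtain d where d: "infinite (S d)" ..
  obtain T where T: "finite T" "card T = Suc (card (B d))" "T \<subseteq> S d"
    using infinite_arbitrarily_large[OF d] by blast
  have finB: "finite (B d)" unfolding B_def by (rule finite_bounded_exponents)
  obtain c where c: "\<exists>b\<in>T. c b \<noteq> 0" "\<forall>m\<in>B d. (\<Sum>b\<in>T. c b * Poly_Mapping.lookup (u b) m) = 0"
    using underdetermined_system[OF finB T(1), of "\<lambda>b m. Poly_Mapping.lookup (u b) m"] T(2) by auto
  have rel: "(\<Sum>b\<in>T. const_poly (c b) * u b) = 0"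
  proof (rule poly_mapping_eqI)
    fix m
    have lc: "Poly_Mapping.lookup (const_poly a * q) m = a * Poly_Mapping.lookup q m" for a and q :: "'n mpoly"
      by (simp add: const_poly_def mult_map_scale_conv_mult[symmetric] map.rep_eq when_def)
    show "Poly_Mapping.lookup (\<Sum>b\<in>T. const_poly (c b) * u b) m = Poly_Mapping.lookup 0 m"
    proof (cases "m \<in> B d")
      case True then show ?thesis using c(2) by (simp add: lookup_sum lc)
    next
      case False
      then have "m \<notin> Poly_Mapping.keys (u b)" if "b \<in> T" for b
        using that T(3) by (auto simp: S_def)
      then have "Poly_Mapping.lookup (u b) m = 0" if "b \<in> T" for b
        using that by (simp add: in_keys_iff)
      then show ?thesis by (simp add: lookup_sum lc)
    qed
  qed
  \<comment> \<open>The numerator of the rational function \<open>\<Sum>b. c b / (X - b)\<close>.\<close>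
  define p where "p = (\<Sum>b\<in>T. smult (c b) (\<Prod>e\<in>T - {b}. [:- e, 1:]))"
  have "p \<noteq> 0"
  proof -
    obtain b where b: "b \<in> T" "c b \<noteq> 0" using c(1) by blast
    have "poly p b = (\<Sum>b'\<in>T. c b' * (\<Prod>e\<in>T - {b'}. b - e))"
      by (simp add: p_def poly_sum poly_prod)
    also have "\<dots> = c b * (\<Prod>e\<in>T - {b}. b - e) + (\<Sum>b'\<in>T - {b}. c b' * (\<Prod>e\<in>T - {b'}. b - e))"
      using b T(1) by (simp add: sum.remove)
    also have "(\<Sum>b'\<in>T - {b}. c b' * (\<Prod>e\<in>T - {b'}. b - e)) = 0"
      using b T(1) by (intro sum.neutral) auto
    also have "c b * (\<Prod>e\<in>T - {b}. b - e) + 0 \<noteq> 0"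
      using b T(1) by auto
    finally show ?thesis by auto
  qed
  moreover have "A ^ 0 * univ_subst A p \<in> I"
  proof -
    let ?P = "\<lambda>S. \<Prod>e\<in>S. A - const_poly e"
    have "univ_subst A p = (\<Sum>b\<in>T. const_poly (c b) * ?P (T - {b}))"
      by (simp add: p_def univ_subst_sum univ_subst_smult univ_subst_prod const_poly_uminus)
    also have "\<dots> = (\<Sum>b\<in>T. const_poly (c b) * u b) * ?P T 
        - (\<Sum>b\<in>T. (const_poly (c b) * ?P (T - {b})) * (u b * (A - const_poly b) - 1))"
      unfolding sum_distrib_right sum_subtractf[symmetric]
    proof (rule sum.cong)
      fix b assume "b \<in> T"
      then have *: "?P T = (A - const_poly b) * ?P (T - {b})" using T(1) by (simp add: prod.remove)
      show "const_poly (c b) * ?P (T - {b}) = const_poly (c b) * u b * ?P T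
         - const_poly (c b) * ?P (T - {b}) * (u b * (A - const_poly b) - 1)"
        unfolding * by (simp add: algebra_simps)
    qed simp
    also have "\<dots> \<in> I"
      unfolding rel mult_zero_left using T(3)
      by (intro ideal.subspace_diff[OF I ideal.subspace_0[OF I] ideal.subspace_sum[OF I]]
          ideal.subspace_scale[OF I u]) (auto simp: S_def)
    finally show ?thesis by simp
  qed
  ultimately show ?thesis using power_in_ideal_of_univ_subst[OF I unit] by blast
qed

text \<open>
  Let \<open>M\<close> be a maximal ideal above \<open>I\<close>. If no \<open>x\<^sub>j - a\<close> were in \<open>M\<close>, then all of them would be invertible
  modulo \<open>M\<close>; by the previous lemma \<open>x\<^sub>j\<close> would be both invertible and nilpotent. So \<open>M\<close> contains some
  \<open>x\<^sub>j - a\<^sub>j\<close> for every \<open>j\<close>, and \<open>a\<close> is a common zero of \<open>M\<close>.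
\<close>

theorem weak_nullstellensatz:
  fixes I :: "'n::finite mpoly set"
  assumes I: "ideal.subspace I" and "1 \<notin> I"
  shows "\<exists>x. \<forall>q\<in>I. eval_poly q x = 0"
proof -
  let ?F = "{J. ideal.subspace J \<and> I \<subseteq> J \<and> 1 \<notin> J}"
  have "\<exists>M\<in>?F. \<forall>X\<in>?F. M \<subseteq> X \<longrightarrow> X = M"
  proof (rule subset_Zorn_nonempty)
    show "?F \<noteq> {}" using assms by auto
    fix C assume C: "C \<noteq> {}" "subset.chain ?F C"
    then have sub: "J \<in> ?F" if "J \<in> C" for J using that by (auto simp: subset.chain_def)
    have "ideal.subspace (\<Union>C)"
      unfolding ideal.subspace_def
    proof (intro conjI ballI allI)
      show "0 \<in> \<Union>C" using C(1) sub by (auto simp: ideal.subspace_def)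
      show "x + y \<in> \<Union>C" if xy: "x \<in> \<Union>C" "y \<in> \<Union>C" for x y
      proof -
        obtain J K where JK: "J \<in> C" "x \<in> J" "K \<in> C" "y \<in> K" using xy by blast
        then have "J \<subseteq> K \<or> K \<subseteq> J" using C(2) by (auto simp: subset_chain_def)
        then show ?thesis using JK sub[of J] sub[of K] by (auto dest: ideal.subspace_add)
      qed
      show "c * x \<in> \<Union>C" if "x \<in> \<Union>C" for c x
        using that sub ideal.subspace_scale by fastforce
    qed
    then show "\<Union>C \<in> ?F" using C(1) sub by blast
  qed
  then obtain M where MF: "M \<in> ?F" and Mmax: "\<forall>X\<in>?F. M \<subseteq> X \<longrightarrow> X = M" ..
  have M: "ideal.subspace M" "I \<subseteq> M" "1 \<notin> M" using MF by simp_all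
  have max: "X = M" if "ideal.subspace X" "I \<subseteq> X" "1 \<notin> X" "M \<subseteq> X" for X
    using that Mmax by simp
  have unit: "\<exists>u. u * q - 1 \<in> M" if "q \<notin> M" for q
  proof -
    let ?J = "{i + u * q | i u. i \<in> M}"
    have sub: "M \<subseteq> ?J" by (rule adjoin_subset)
    have qJ: "q \<in> ?J" by (rule adjoin_generator[OF M(1)])
    have "1 \<in> ?J"
    proof (rule ccontr)
      assume "1 \<notin> ?J"
      from max[OF subspace_adjoin[OF M(1), of q] subset_trans[OF M(2) sub] this sub] qJ
      have "q \<in> M" by (rule subst)
      then show False using that by contradiction
    qed
    then obtain i u where iu: "i \<in> M" "1 = i + u * q" by blast
    have "- i = u * q - 1" using iu(2) by (simp add: algebra_simps)
    then show ?thesis using ideal.subspace_neg[OF M(1) iu(1)] by metis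
  qed
  have "\<exists>a. var_poly j - const_poly a \<in> M" for j
  proof (rule ccontr)
    assume *: "\<not> ?thesis"
    then have "\<exists>u. u * (var_poly j - const_poly b) - 1 \<in> M" for b using unit by blast
    then obtain N where N: "var_poly j ^ N \<in> M" using nilpotent_modulo_ideal[OF M(1)] by blast
    obtain u where u: "u * var_poly j - 1 \<in> M" using * unit[of "var_poly j"] by (metis const_poly_0 diff_zero)
    have "var_poly j ^ N \<notin> M" for N
    proof (induction N)
      case (Suc N)
      show ?case
      proof
        assume "var_poly j ^ Suc N \<in> M"
        then have "u * var_poly j ^ Suc N - var_poly j ^ N * (u * var_poly j - 1) \<in> M"
          by (rule ideal.subspace_diff[OF M(1) ideal.subspace_scale[OF M(1)] ideal.subspace_scale[OF M(1) u]])
        then show False using Suc by (simp add: algebra_simps)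
      qed
    qed (use M(3) in auto)
    then show False using N by blast
  qed
  then obtain a where a: "\<And>j. var_poly j - const_poly (a j) \<in> M" by metis
  define x where "x = (\<chi> j. a j)"
  have ev: "q - const_poly (eval_poly q x) \<in> M" for q
  proof (induction q rule: mpoly_induct)
    case (add q r)
    have "(q - const_poly (eval_poly q x)) + (r - const_poly (eval_poly r x)) \<in> M"
      by (intro ideal.subspace_add[OF M(1)] add)
    then show ?case by (simp add: const_poly_add algebra_simps)
  next
    case (mult q r)
    have "r * (q - const_poly (eval_poly q x)) + const_poly (eval_poly q x) * (r - const_poly (eval_poly r x)) \<in> M"
      by (rule ideal.subspace_add[OF M(1) ideal.subspace_scale[OF M(1) mult(1)] ideal.subspace_scale[OF M(1) mult(2)]])
    then show ?case by (simp add: const_poly_mult algebra_simps)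
  qed (use a ideal.subspace_0[OF M(1)] in \<open>auto simp: x_def\<close>)
  have "eval_poly q x = 0" if "q \<in> I" for q
  proof (rule ccontr)
    assume nz: "eval_poly q x \<noteq> 0"
    have "q - (q - const_poly (eval_poly q x)) \<in> M"
      using ideal.subspace_diff[OF M(1) subsetD[OF M(2) that] ev] .
    then have "const_poly (eval_poly q x) \<in> M" by (simp only: diff_diff_eq2 add_diff_cancel_left')
    then have "const_poly (inverse (eval_poly q x)) * const_poly (eval_poly q x) \<in> M"
      by (rule ideal.subspace_scale[OF M(1)])
    then show False using M(3) nz by (simp add: const_poly_mult[symmetric])
  qed
  then show ?thesis by blast
qed

text \<open>
  For \<open>b \<noteq> 0\<close> the polynomial \<open>A - b\<close> has no zero in common with \<open>I\<close>, so it is invertible modulo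
  \<open>I\<close> by the weak form, and \<open>A\<close> is nilpotent modulo \<open>I\<close>.
\<close>

theorem nullstellensatz:
  fixes I :: "'n::finite mpoly set"
  assumes I: "ideal.subspace I" and van: "\<And>x. (\<And>q. q \<in> I \<Longrightarrow> eval_poly q x = 0) \<Longrightarrow> eval_poly A x = 0"
  shows "\<exists>N. A ^ N \<in> I"
proof (rule nilpotent_modulo_ideal[OF I])
  fix b :: complex assume b: "b \<noteq> 0"
  let ?J = "{i + u * (A - const_poly b) | i u. i \<in> I}"
  have "1 \<in> ?J"
  proof (rule ccontr)
    assume "1 \<notin> ?J"
    then obtain x where x: "\<forall>q\<in>?J. eval_poly q x = 0"
      using weak_nullstellensatz[OF subspace_adjoin[OF I]] by blast
    have "eval_poly q x = 0" if "q \<in> I" for q using x subsetD[OF adjoin_subset that] by blast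
    then have "eval_poly A x = 0" by (rule van)
    moreover have "eval_poly (A - const_poly b) x = 0" using x adjoin_generator[OF I] by blast
    ultimately show False using b by simp
  qed
  then obtain i u where iu: "i \<in> I" "1 = i + u * (A - const_poly b)" by blast
  have "- i = u * (A - const_poly b) - 1" using iu(2) by (simp add: algebra_simps)
  then show "\<exists>u. u * (A - const_poly b) - 1 \<in> I" using ideal.subspace_neg[OF I iu(1)] by metis
qed

section \<open>Vectors of polynomials\<close>

definition dot3 :: "'a::comm_ring_1 ^ 3 \<Rightarrow> 'a ^ 3 \<Rightarrow> 'a" where
  "dot3 u v = u $ 1 * v $ 1 + u $ 2 * v $ 2 + u $ 3 * v $ 3"

definition vprod :: "'a::comm_ring_1 ^ 3 \<Rightarrow> 'a ^ 3 \<Rightarrow> 'a ^ 3" where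
  "vprod u v = vector [u $ 2 * v $ 3 - u $ 3 * v $ 2, u $ 3 * v $ 1 - u $ 1 * v $ 3, u $ 1 * v $ 2 - u $ 2 * v $ 1]"

lemma vprod_nth:
  "vprod u v $ 1 = u $ 2 * v $ 3 - u $ 3 * v $ 2"
  "vprod u v $ 2 = u $ 3 * v $ 1 - u $ 1 * v $ 3"
  "vprod u v $ 3 = u $ 1 * v $ 2 - u $ 2 * v $ 1"
  by (simp_all add: vprod_def)

lemma vec3_eqI:
  fixes u v :: "'a ^ 3"
  assumes "u $ 1 = v $ 1" "u $ 2 = v $ 2" "u $ 3 = v $ 3"
  shows "u = v"
  using assms by (simp add: vec_eq_iff forall_3)

lemma vprod_scale: "vprod (c *s u) v = c *s vprod u v" "vprod u (c *s v) = c *s vprod u v"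
  by (rule vec3_eqI; simp add: vprod_nth algebra_simps)+

lemma vprod_diff: "vprod (u - w) v = vprod u v - vprod w v" "vprod u (v - w) = vprod u v - vprod u w"
  by (rule vec3_eqI; simp add: vprod_nth algebra_simps)+

lemma vprod_self: "vprod u u = 0"
  by (rule vec3_eqI) (simp_all add: vprod_nth algebra_simps)

lemma dot3_scale: "dot3 (c *s u) v = c * dot3 u v" "dot3 u (c *s v) = c * dot3 u v"
  by (simp_all add: dot3_def algebra_simps)

lemma dot3_diff: "dot3 (u - w) v = dot3 u v - dot3 w v" "dot3 u (v - w) = dot3 u v - dot3 u w"
  by (simp_all add: dot3_def algebra_simps)

lemma dot3_add_right: "dot3 u (v + w) = dot3 u v + dot3 u w"
  by (simp add: dot3_def algebra_simps)

lemma dot3_sum_left: "dot3 (sum g A) v = (\<Sum>a\<in>A. dot3 (g a) v)"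
  by (simp add: dot3_def sum.distrib sum_distrib_right)

lemma dot3_vprod_right: "dot3 (vprod u v) v = 0"
  by (simp add: dot3_def vprod_nth algebra_simps)

lemma vprod_vprod: "vprod a (vprod b c) = dot3 a c *s b - dot3 a b *s c"
  by (rule vec3_eqI; simp add: vprod_nth dot3_def algebra_simps)

definition const_vec :: "complex ^ 'n::finite \<Rightarrow> ('n mpoly) ^ 'n" where
  "const_vec a = (\<chi> j. const_poly (a $ j))"

definition euler :: "('n::finite mpoly) ^ 'n" where
  "euler = (\<chi> j. var_poly j)"

lemma const_vec_nth [simp]: "const_vec a $ j = const_poly (a $ j)"
  by (simp add: const_vec_def)

lemma euler_nth [simp]: "euler $ j = var_poly j"
  by (simp add: euler_def)

lemma linear_form_eq_dot3: "linear_form a = dot3 (const_vec a) euler"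
  by (simp add: linear_form_def dot3_def sum_3)

section \<open>Vanishing on affine subspaces\<close>

text \<open>
  Restricted to the line from \<open>x\<close> to \<open>y\<close>, the product of the two polynomials is zero in the domain of
  univariate polynomials, and the first factor is not.
\<close>

lemma vanishing_product_on_affine:
  fixes Z :: "(complex ^ 'n::finite) set"
  assumes aff: "\<And>x y t. x \<in> Z \<Longrightarrow> y \<in> Z \<Longrightarrow> (\<chi> j. x $ j + t * (y $ j - x $ j)) \<in> Z"
    and prod: "\<And>x. x \<in> Z \<Longrightarrow> eval_poly p x * eval_poly q x = 0"
    and "x \<in> Z" "eval_poly p x \<noteq> 0" "y \<in> Z"
  shows "eval_poly q y = 0"
proof -
  let ?l = "line_poly x (y - x)"
  have "poly (?l p * ?l q) t = 0" for t
    using prod[OF aff[OF assms(3,5), of t]] by (simp add: poly_line_poly)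
  then have "?l p * ?l q = 0"
    using poly_all_0_iff_0 by blast
  moreover have "poly (?l p) 0 \<noteq> 0"
    using assms(4) by (simp add: poly_line_poly)
  ultimately have "?l q = 0" by auto
  then have "poly (?l q) 1 = 0" by simp
  then show ?thesis by (simp add: poly_line_poly)
qed

lemma mem_hyperplane: "x \<in> hyperplane a \<longleftrightarrow> (\<Sum>j\<in>UNIV. a $ j * x $ j) = 0"
  by (simp add: hyperplane_def vanishing_locus_def)

lemma hyperplane_affine:
  assumes "x \<in> hyperplane a" "y \<in> hyperplane a"
  shows "(\<chi> j. x $ j + t * (y $ j - x $ j)) \<in> hyperplane a"
proof -
  have "(\<Sum>j\<in>UNIV. a $ j * (x $ j + t * (y $ j - x $ j)))
    = (\<Sum>j\<in>UNIV. a $ j * x $ j) + t * ((\<Sum>j\<in>UNIV. a $ j * y $ j) - (\<Sum>j\<in>UNIV. a $ j * x $ j))"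
    by (simp add: algebra_simps sum.distrib sum_subtractf sum_distrib_left)
  then show ?thesis using assms by (simp add: mem_hyperplane)
qed

text \<open>
  Subtracting \<open>L / a\<^sub>k\<close> from the variable \<open>x\<^sub>k\<close>, where \<open>L\<close> is the linear form, changes nothing modulo
  \<open>L\<close> and moves every point into the hyperplane.
\<close>

lemma linear_form_dvd_iff:
  fixes q :: "3 mpoly"
  assumes "a \<noteq> 0"
  shows "linear_form a dvd q \<longleftrightarrow> (\<forall>x\<in>hyperplane a. eval_poly q x = 0)"
proof
  assume "linear_form a dvd q"
  then obtain k where k: "q = linear_form a * k" ..
  show "\<forall>x\<in>hyperplane a. eval_poly q x = 0"
    unfolding k by (simp add: mem_hyperplane)
next
  assume van: "\<forall>x\<in>hyperplane a. eval_poly q x = 0"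
  obtain k where k: "a $ k \<noteq> 0" using assms by (auto simp: vec_eq_iff)
  define s where "s j = (if j = k then var_poly k - const_poly (inverse (a $ k)) * linear_form a else var_poly j)" for j
  have "linear_form a dvd subst_poly s q - q"
    by (rule subst_congruent) (auto simp: s_def intro: dvdI[of _ _ "- const_poly (inverse (a $ k))"])
  moreover have "subst_poly s q = 0"
  proof (rule eval_poly_eqI)
    fix x :: "complex ^ 3"
    define L where "L = (\<Sum>j\<in>UNIV. a $ j * x $ j)"
    have s: "eval_poly (s j) x = x $ j - (if j = k then inverse (a $ k) * L else 0)" for j
      by (simp add: s_def L_def)
    have "(\<Sum>j\<in>UNIV. a $ j * (x $ j - (if j = k then inverse (a $ k) * L else 0))) =
        L - (\<Sum>j\<in>UNIV. if j = k then a $ k * (inverse (a $ k) * L) else 0)"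
      unfolding L_def sum_subtractf[symmetric]
      by (rule sum.cong) (auto simp: right_diff_distrib)
    also have "\<dots> = 0" using k by simp
    finally have "(\<chi> j. eval_poly (s j) x) \<in> hyperplane a"
      by (simp add: mem_hyperplane s)
    then show "eval_poly (subst_poly s q) x = eval_poly 0 x" using van by simp
  qed
  ultimately show "linear_form a dvd q" by simp
qed

lemma linear_form_eq_0_iff:
  fixes a :: "complex ^ 3"
  shows "linear_form a = 0 \<longleftrightarrow> a = 0"
proof
  assume *: "linear_form a = 0"
  have "a $ k = 0" for k
  proof -
    have "eval_poly (linear_form a) (axis k 1) = a $ k"
      by (simp add: axis_def if_distrib cong: if_cong)
    then show ?thesis using * by simp
  qed
  then show "a = 0" by (simp add: vec_eq_iff)
qed (simp add: linear_form_def)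

lemma zero_in_hyperplane: "0 \<in> hyperplane a"
  by (simp add: mem_hyperplane)

lemma prime_linear_form:
  fixes a :: "complex ^ 3"
  assumes a: "a \<noteq> 0"
  shows "prime_elem (linear_form a)"
  unfolding prime_elem_def
proof (intro conjI allI impI)
  show "linear_form a \<noteq> 0" using a by (simp add: linear_form_eq_0_iff)
  show "\<not> linear_form a dvd 1"
    unfolding linear_form_dvd_iff[OF a] using zero_in_hyperplane[of a] by auto
  fix p q assume "linear_form a dvd p * q"
  then have pq: "eval_poly p x * eval_poly q x = 0" if "x \<in> hyperplane a" for x
    using that unfolding linear_form_dvd_iff[OF a] by simp
  show "linear_form a dvd p \<or> linear_form a dvd q"
  proof (cases "linear_form a dvd p")
    case False
    then obtain x where x: "x \<in> hyperplane a" "eval_poly p x \<noteq> 0"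
      unfolding linear_form_dvd_iff[OF a] by blast
    then have "eval_poly q y = 0" if "y \<in> hyperplane a" for y
      using vanishing_product_on_affine[OF hyperplane_affine pq x that] by blast
    then show ?thesis unfolding linear_form_dvd_iff[OF a] by blast
  qed simp
qed

lemma var_poly_eq_linear_form: "var_poly k = linear_form (axis k 1 :: complex ^ 3)"
  by (rule eval_poly_eqI) (simp add: axis_def if_distrib if_distribR cong: if_cong)

lemma prime_var_poly: "prime_elem (var_poly k :: 3 mpoly)"
  unfolding var_poly_eq_linear_form by (rule prime_linear_form) (simp add: axis_eq_0_iff)

lemma var_poly_dvd_var_poly:
  assumes "i \<noteq> j"
  shows "\<not> (var_poly i :: 3 mpoly) dvd var_poly j"
proof
  assume "(var_poly i :: 3 mpoly) dvd var_poly j"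
  then obtain k where k: "(var_poly j :: 3 mpoly) = var_poly i * k" ..
  have "eval_poly (var_poly j) (axis j 1 :: complex ^ 3) = 0"
    unfolding k using assms by (simp add: axis_def)
  then show False by (simp add: axis_def)
qed

lemma prime_elem_factor:
  fixes p :: "'a::idom"
  assumes "prime_elem p" "p = a * b" "\<not> a dvd 1"
  shows "b dvd 1"
proof -
  have p0: "p \<noteq> 0" using assms(1) unfolding prime_elem_def by blast
  have "p dvd a * b" using assms(2) by simp
  then have dv: "p dvd a \<or> p dvd b" using assms(1) unfolding prime_elem_def by blast
  show ?thesis
  proof (cases "p dvd a")
    case True
    then obtain c where c: "a = p * c" ..
    have "p * 1 = p * (c * b)"
      unfolding mult_1_right mult.assoc[symmetric] c[symmetric] by (rule assms(2))
    then have "1 = c * b" using p0 unfolding mult_cancel_left by blast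
    then show ?thesis by (rule dvdI[of 1 b c, unfolded mult.commute[of b c]])
  next
    case False
    then obtain c where c: "b = p * c" using dv by (auto elim: dvdE)
    have "p * 1 = p * (a * c)"
      unfolding mult_1_right mult.left_commute[of p a c] c[symmetric] by (rule assms(2))
    then have "1 = a * c" using p0 unfolding mult_cancel_left by blast
    then show ?thesis using assms(3) dvdI[of 1 a c] by blast
  qed
qed

lemma prime_dvd_prime:
  fixes p q :: "'a::idom"
  assumes "prime_elem q" "\<not> p dvd 1" "p dvd q"
  shows "q dvd p"
proof -
  obtain c where c: "q = p * c" using assms(3) ..
  have "c dvd 1" by (rule prime_elem_factor[OF assms(1) c assms(2)])
  then obtain c' where c': "1 = c * c'" ..
  have "p = q * c'" unfolding c using c' by (simp add: mult.assoc)
  then show ?thesis ..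
qed

lemma nonunit_not_dvd_variables:
  fixes d :: "3 mpoly"
  assumes "\<not> d dvd 1"
  shows "\<exists>k. \<not> d dvd var_poly k"
proof (rule ccontr)
  assume "\<not> ?thesis"
  then have *: "d dvd var_poly k" for k by blast
  have "var_poly 1 dvd d" by (rule prime_dvd_prime[OF prime_var_poly assms *])
  then have "(var_poly 1 :: 3 mpoly) dvd var_poly 2" using *[of 2] by (rule dvd_trans)
  then show False using var_poly_dvd_var_poly[of 1 2] by simp
qed

lemma prime_elem_dvd_power_mult:
  fixes p :: "'a::idom"
  assumes "prime_elem p" "\<not> p dvd x" "p ^ N dvd q * x ^ M"
  shows "p ^ N dvd q"
  using assms(3)
proof (induction N arbitrary: q)
  case (Suc N)
  have p0: "p \<noteq> 0" using assms(1) by auto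
  have "p dvd q * x ^ M" using Suc.prems by (metis dvd_mult_left power_Suc)
  then have "p dvd q" using assms(1,2) prime_elem_dvd_mult_iff prime_elem_dvd_power by blast
  then obtain r where r: "q = p * r" ..
  have "p * p ^ N dvd p * (r * x ^ M)" using Suc.prems unfolding r by (simp only: power_Suc mult.assoc)
  then have "p ^ N dvd r * x ^ M" using p0 unfolding dvd_mult_cancel_left by blast
  then have "p ^ N dvd r" by (rule Suc.IH)
  then show ?case unfolding r power_Suc by (rule mult_dvd_mono[OF dvd_refl])
qed simp

text \<open>Two powers of distinct variables form a regular sequence.\<close>

lemma dvd_by_two_variables:
  fixes d q :: "3 mpoly"
  assumes "d \<noteq> 0" "d dvd q * var_poly 1 ^ N" "d dvd q * var_poly 2 ^ N"
  shows "d dvd q"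
proof -
  let ?x = "var_poly 1 :: 3 mpoly" and ?y = "var_poly 2 :: 3 mpoly"
  obtain A where A: "q * ?x ^ N = d * A" using assms(2) ..
  obtain B where B: "q * ?y ^ N = d * B" using assms(3) ..
  have "d * (A * ?y ^ N) = (q * ?x ^ N) * ?y ^ N" by (simp only: A mult.assoc)
  also have "\<dots> = (q * ?y ^ N) * ?x ^ N" by (simp only: mult_ac)
  also have "\<dots> = d * (B * ?x ^ N)" by (simp only: B mult.assoc)
  finally have "A * ?y ^ N = B * ?x ^ N" using assms(1) by simp
  then have "?x ^ N dvd A * ?y ^ N" by simp
  then have "?x ^ N dvd A"
    by (rule prime_elem_dvd_power_mult[OF prime_var_poly var_poly_dvd_var_poly, rotated]) simp
  then obtain C where C: "A = ?x ^ N * C" ..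
  have "?x ^ N * q = ?x ^ N * (d * C)" using A unfolding C by (simp add: mult_ac)
  moreover have "?x ^ N \<noteq> 0" using prime_var_poly[of 1] by auto
  ultimately have "q = d * C" unfolding mult_cancel_left by blast
  then show ?thesis ..
qed

lemma prime_elem_dvd_prodD:
  assumes "prime_elem p" "p dvd prod g A" "finite A"
  shows "\<exists>a\<in>A. p dvd g a"
  using assms(3,2)
proof (induction A rule: finite_induct)
  case empty then show ?case using assms(1) by (simp add: prime_elem_def)
next
  case (insert a A)
  then show ?case using assms(1) by (auto simp: prime_elem_dvd_mult_iff)
qed

lemma prod_primes_dvd:
  fixes g :: "'i \<Rightarrow> 'a::idom"
  assumes "finite A" "\<And>i. i \<in> A \<Longrightarrow> prime_elem (g i)" "\<And>i. i \<in> A \<Longrightarrow> g i dvd z"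
    and "\<And>i j. i \<in> A \<Longrightarrow> j \<in> A \<Longrightarrow> i \<noteq> j \<Longrightarrow> \<not> g i dvd g j"
  shows "prod g A dvd z"
  using assms
proof (induction A rule: finite_induct)
  case (insert a A)
  then have "prod g A dvd z" by blast
  then obtain k where k: "z = prod g A * k" ..
  have pa: "prime_elem (g a)" using insert.prems by blast
  have "\<not> g a dvd prod g A"
    using prime_elem_dvd_prodD[OF pa _ insert.hyps(1)] insert.prems(3) insert.hyps(2) by blast
  moreover have "g a dvd prod g A * k" using insert.prems(2) unfolding k by blast
  ultimately have "g a dvd k" using pa prime_elem_dvd_mult_iff by blast
  then have "prod g A * g a dvd z" unfolding k by (rule mult_dvd_mono[OF dvd_refl])
  then show ?case using insert.hyps by (simp add: mult.commute)
qed simp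

section \<open>Dilations\<close>

definition dilate :: "complex \<Rightarrow> 3 mpoly \<Rightarrow> 3 mpoly" where
  "dilate t = subst_poly (\<lambda>j. const_poly t * var_poly j)"

lemma eval_dilate [simp]: "eval_poly (dilate t q) x = eval_poly q (t *s x)"
  by (simp add: dilate_def vector_scalar_mult_def)

lemma dilate_linear_form: "dilate t (linear_form a) = const_poly t * linear_form a"
  by (rule eval_poly_eqI) (simp add: sum_distrib_left mult_ac)

lemma dilate_algebra [simp]:
  "dilate t (q * r) = dilate t q * dilate t r" "dilate t (const_poly c) = const_poly c" "dilate t 1 = 1"
  "dilate t (sum g A) = (\<Sum>a\<in>A. dilate t (g a))" "dilate t (prod g' B) = (\<Prod>b\<in>B. dilate t (g' b))"
  by (simp_all add: dilate_def)

text \<open>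
  On a line through the origin the polynomial is constant away from the origin, hence constant.
\<close>

lemma dilation_invariant_constant:
  assumes "\<And>t. t \<noteq> 0 \<Longrightarrow> dilate t h = h"
  shows "h = const_poly (eval_poly h 0)"
proof (rule eval_poly_eqI)
  fix x :: "complex ^ 3"
  have *: "eval_poly h (t *s x) = eval_poly h x" if "t \<noteq> 0" for t
    using arg_cong[OF assms[OF that], of "\<lambda>q. eval_poly q x"] by simp
  \<comment> \<open>The factor \<open>t\<close> makes the product vanish at \<open>t = 0\<close> as well.\<close>
  let ?p = "[:0, 1:] * (line_poly 0 x h - [:eval_poly h x:])"
  have "poly ?p t = 0" for t
    using *[of t] by (cases "t = 0") (simp_all add: poly_line_poly vector_scalar_mult_def)
  then have "?p = 0" using poly_all_0_iff_0 by blast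
  then have "poly (line_poly 0 x h - [:eval_poly h x:]) 0 = 0" by simp
  then show "eval_poly h x = eval_poly (const_poly (eval_poly h 0)) x"
    by (simp add: poly_line_poly zero_vec_def)
qed

section \<open>Koszul exactness\<close>

text \<open>
  The cross product with \<open>euler\<close> and the dot product with \<open>euler\<close> are consecutive differentials of the
  Koszul complex of the three variables. The same exactness statement serves for vector fields modulo
  \<open>euler\<close> and for the cocycle of multipliers in the socle argument.
\<close>

lemma koszul_exact_2:
  assumes "dot3 \<Phi> (euler :: (3 mpoly) ^ 3) = 0"
  obtains v where "\<Phi> = vprod v euler"
proof -
  let ?x = "var_poly 1 :: 3 mpoly" and ?y = "var_poly 2 :: 3 mpoly" and ?z = "var_poly 3 :: 3 mpoly"
  define p q r where pqr: "p = \<Phi> $ 1" "q = \<Phi> $ 2" "r = \<Phi> $ 3"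
  have rel: "p * ?x + q * ?y + r * ?z = 0" using assms by (simp add: dot3_def pqr)
  have x0: "?x \<noteq> 0" and z0: "?z \<noteq> 0" using prime_var_poly[of 1] prime_var_poly[of 3] by auto
  \<comment> \<open>Set the first variable to zero: what remains is a relation between the other two.\<close>
  define s where "s j = (if j = 1 then 0 else var_poly j :: 3 mpoly)" for j
  have cong: "?x dvd u - subst_poly s u" for u
  proof -
    have "?x dvd subst_poly s u - u" by (rule subst_congruent) (auto simp: s_def)
    then show ?thesis by (metis dvd_minus_iff minus_diff_eq)
  qed
  define q0 where "q0 = subst_poly s q"
  define r0 where "r0 = subst_poly s r"
  obtain q1 where q1: "q - q0 = ?x * q1" using cong[of q] unfolding q0_def ..
  obtain r1 where r1: "r - r0 = ?x * r1" using cong[of r] unfolding r0_def ..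
  have "subst_poly s (p * ?x + q * ?y + r * ?z) = 0" unfolding rel by simp
  then have rel0: "q0 * ?y + r0 * ?z = 0" by (simp add: s_def q0_def r0_def)
  then have "q0 * ?y = ?z * (- r0)" by (simp add: algebra_simps add_eq_0_iff2)
  then have "?z dvd q0 * ?y" ..
  then have "?z dvd q0"
    using prime_var_poly[of 3] var_poly_dvd_var_poly[of 3 2] prime_elem_dvd_mult_iff by force
  then obtain w where w: "q0 = ?z * w" ..
  have "?z * (w * ?y + r0) = 0" using rel0 unfolding w by (simp add: algebra_simps)
  then have r0: "r0 = - (w * ?y)" using z0 by (simp add: add_eq_0_iff)
  have q: "q = ?z * w + ?x * q1" using q1 unfolding w by (simp add: algebra_simps)
  have r: "r = ?x * r1 - w * ?y" using r1 unfolding r0 by (simp add: algebra_simps)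
  have "?x * (p + q1 * ?y + r1 * ?z) = 0" using rel unfolding q r by (simp add: algebra_simps)
  then have sum0: "p + q1 * ?y + r1 * ?z = 0" using x0 mult_eq_0_iff by blast
  have "p = (p + q1 * ?y + r1 * ?z) - q1 * ?y - r1 * ?z" by simp
  then have p: "p = - (q1 * ?y) - r1 * ?z" unfolding sum0 by simp
  have "\<Phi> = vprod (vector [- w, - r1, q1]) euler"
    by (rule vec3_eqI) (simp_all add: vprod_nth pqr[symmetric] p q r algebra_simps)
  then show ?thesis by (rule that)
qed

section \<open>The critical ideal\<close>

locale arrangement =
  fixes n :: nat and f :: "nat \<Rightarrow> complex ^ 3"
  assumes arr: "central_essential_arrangement n f"
begin

abbreviation L :: "nat \<Rightarrow> 3 mpoly" where "L i \<equiv> linear_form (f i)"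

definition cofactor :: "nat \<Rightarrow> 3 mpoly" where
  "cofactor i = (\<Prod>j\<in>{..<n} - {i}. L j)"

abbreviation Q :: "3 mpoly" where "Q \<equiv> defining_poly n f"

lemma f_nonzero: "i < n \<Longrightarrow> f i \<noteq> 0"
  using arr by (simp add: central_essential_arrangement_def)

lemma prime_L: "i < n \<Longrightarrow> prime_elem (L i)"
  using f_nonzero prime_linear_form by blast

lemma L_nonzero: "i < n \<Longrightarrow> L i \<noteq> 0"
  using prime_L[of i] unfolding prime_elem_def by blast

lemma L_not_dvd_L:
  assumes "i < n" "j < n" "i \<noteq> j"
  shows "\<not> L i dvd L j"
proof
  assume dvd: "L i dvd L j"
  have "\<not> L i dvd 1" using prime_L[OF assms(1)] unfolding prime_elem_def by blast
  then have "L j dvd L i" using prime_dvd_prime[OF prime_L[OF assms(2)] _ dvd] by blast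
  then obtain k' where "L i = L j * k'" ..
  then have "eval_poly (L i) x = eval_poly (L j) x * eval_poly k' x" for x by (simp only: eval_simps)
  moreover obtain k where "L j = L i * k" using dvd ..
  then have "eval_poly (L j) x = eval_poly (L i) x * eval_poly k x" for x by (simp only: eval_simps)
  ultimately have "eval_poly (L i) x = 0 \<longleftrightarrow> eval_poly (L j) x = 0" for x by (metis mult_zero_left)
  then have "hyperplane (f i) = hyperplane (f j)"
    by (simp add: hyperplane_def vanishing_locus_def del: eval_linear_form)
  then show False
    using arr assms by (auto simp: central_essential_arrangement_def inj_on_def)
qed

lemma Q_eq: "i < n \<Longrightarrow> Q = L i * cofactor i"
  by (simp add: defining_poly_def cofactor_def prod.remove)

lemma Q_nonzero: "Q \<noteq> 0"
  by (simp add: defining_poly_def L_nonzero)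

lemma L_dvd_cofactor: "i < n \<Longrightarrow> j < n \<Longrightarrow> i \<noteq> j \<Longrightarrow> L i dvd cofactor j"
  unfolding cofactor_def by (rule dvd_prodI) auto

lemma L_not_dvd_cofactor:
  assumes "i < n"
  shows "\<not> L i dvd cofactor i"
proof
  assume "L i dvd cofactor i"
  then obtain j where "j \<in> {..<n} - {i}" "L i dvd L j"
    unfolding cofactor_def using prime_elem_dvd_prodD[OF prime_L[OF assms]] by blast
  then show False using L_not_dvd_L assms by auto
qed

lemma Q_dvd: "(\<And>i. i < n \<Longrightarrow> L i dvd z) \<Longrightarrow> Q dvd z"
  unfolding defining_poly_def by (rule prod_primes_dvd) (auto simp: prime_L L_not_dvd_L)

lemma L_not_dvd_var:
  assumes "i < n"
  shows "\<exists>k. \<not> L i dvd var_poly k"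
  using nonunit_not_dvd_variables prime_L[OF assms] unfolding prime_elem_def by blast

text \<open>
  The vector \<open>v\<close> holds the coefficients of a derivation in \<open>Der_arr\<close>, and \<open>c i\<close> is its logarithmic
  derivative \<open>\<theta>(L i) / L i\<close>.
\<close>

definition log_field :: "(3 mpoly) ^ 3 \<Rightarrow> (nat \<Rightarrow> 3 mpoly) \<Rightarrow> bool" where
  "log_field v c \<longleftrightarrow> (\<forall>i<n. dot3 (const_vec (f i)) v = c i * L i)"

definition crit :: "(nat \<Rightarrow> complex) \<Rightarrow> 3 mpoly set" where
  "crit lam = {\<Sum>i<n. const_poly (lam i) * c i | v c. log_field v c}"

lemma critI: "log_field v c \<Longrightarrow> (\<Sum>i<n. const_poly (lam i) * c i) \<in> crit lam"
  unfolding crit_def by (rule CollectI, rule exI[of _ v], rule exI[of _ c]) simp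

lemma critE:
  assumes "u \<in> crit lam"
  obtains v c where "log_field v c" "u = (\<Sum>i<n. const_poly (lam i) * c i)"
  using assms unfolding crit_def by auto

lemma derivation_prod:
  assumes "derivation \<theta>" "finite A"
  shows "\<theta> (prod g A) = (\<Sum>a\<in>A. \<theta> (g a) * prod g (A - {a}))"
  using assms(2)
proof (induction A rule: finite_induct)
  case empty
  have "\<theta> 1 = \<theta> (1 * 1)" by simp
  also have "\<dots> = \<theta> 1 * 1 + 1 * \<theta> 1" using assms(1) unfolding derivation_def by blast
  finally show ?case by simp
next
  case (insert a A)
  have "\<theta> (prod g (insert a A)) = \<theta> (g a * prod g A)" using insert by simp
  also have "\<dots> = \<theta> (g a) * prod g A + g a * \<theta> (prod g A)"
    using assms(1) unfolding derivation_def by blast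
  also have "g a * \<theta> (prod g A) = (\<Sum>b\<in>A. \<theta> (g b) * prod g (insert a A - {b}))"
    unfolding insert.IH sum_distrib_left
  proof (rule sum.cong)
    fix b assume b: "b \<in> A"
    then have "insert a A - {b} = insert a (A - {b})" using insert by auto
    then have "prod g (insert a A - {b}) = g a * prod g (A - {b})" using insert by simp
    then show "g a * (\<theta> (g b) * prod g (A - {b})) = \<theta> (g b) * prod g (insert a A - {b})"
      by (simp only: mult_ac)
  qed simp
  also have "\<theta> (g a) * prod g A = \<theta> (g a) * prod g (insert a A - {a})" using insert by simp
  finally show ?case using insert by simp
qed

lemma derivation_Q:
  assumes "derivation \<theta>"
  shows "\<theta> Q = (\<Sum>i<n. \<theta> (L i) * cofactor i)"
  unfolding defining_poly_def cofactor_def by (rule derivation_prod[OF assms]) simp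

text \<open>
  In the product rule for \<open>\<theta> Q\<close>, all summands but the one in which \<open>L i\<close> is differentiated are divisible
  by \<open>L i\<close>, and \<open>L i\<close> does not divide the cofactor of that one.
\<close>

lemma Der_arr_iff:
  assumes der: "derivation \<theta>"
  shows "\<theta> \<in> Der_arr n f \<longleftrightarrow> (\<forall>i<n. L i dvd \<theta> (L i))"
proof -
  have "ideal_generated {Q} = {x. Q dvd x}"
    unfolding ideal_generated_eq_span ideal.span_singleton by (auto simp: dvd_def mult.commute)
  then have "\<theta> \<in> Der_arr n f \<longleftrightarrow> Q dvd \<theta> Q" using der by (simp add: Der_arr_def)
  also have "\<dots> \<longleftrightarrow> (\<forall>i<n. L i dvd \<theta> (L i))"
  proof (intro iffI allI impI)
    fix i assume dv: "Q dvd \<theta> Q" and i: "i < n"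
    have "L i dvd \<theta> Q" using dv Q_eq[OF i] by (metis dvd_mult_left)
    moreover have "\<theta> Q = \<theta> (L i) * cofactor i + (\<Sum>j\<in>{..<n} - {i}. \<theta> (L j) * cofactor j)"
      unfolding derivation_Q[OF der] using i by (simp add: sum.remove)
    moreover have "L i dvd (\<Sum>j\<in>{..<n} - {i}. \<theta> (L j) * cofactor j)"
      using L_dvd_cofactor[OF i] by (intro dvd_sum dvd_mult) auto
    ultimately have "L i dvd \<theta> (L i) * cofactor i" by (simp add: dvd_add_left_iff)
    then show "L i dvd \<theta> (L i)"
      using prime_L[OF i] L_not_dvd_cofactor[OF i] prime_elem_dvd_mult_iff by blast
  next
    assume dv: "\<forall>i<n. L i dvd \<theta> (L i)"
    have "Q dvd \<theta> (L i) * cofactor i" if "i < n" for i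
      unfolding Q_eq[OF that] using dv that by (intro mult_dvd_mono) auto
    then show "Q dvd \<theta> Q" unfolding derivation_Q[OF der] by (intro dvd_sum) auto
  qed
  finally show ?thesis .
qed

lemma pairing_eq:
  assumes "\<And>i. i < n \<Longrightarrow> \<theta> (L i) = c i * L i"
  shows "pairing_omega n f lam \<theta> = to_fract (\<Sum>i<n. const_poly (lam i) * c i)"
  unfolding pairing_omega_def to_fract_sum
  by (rule sum.cong) (auto simp: assms L_nonzero)

lemma subspace_crit: "ideal.subspace (crit lam)"
  unfolding ideal.subspace_def
proof (intro conjI ballI allI)
  have "log_field 0 (\<lambda>_. 0)" by (simp add: log_field_def dot3_def)
  then have "(\<Sum>i<n. const_poly (lam i) * 0) \<in> crit lam"
    by (rule critI)
  then show "0 \<in> crit lam" by simp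
next
  fix x y assume "x \<in> crit lam" "y \<in> crit lam"
  then obtain v c w d where *: "log_field v c" "x = (\<Sum>i<n. const_poly (lam i) * c i)"
      "log_field w d" "y = (\<Sum>i<n. const_poly (lam i) * d i)"
    by (elim critE)
  have "log_field (v + w) (\<lambda>i. c i + d i)"
    using * by (simp add: log_field_def dot3_add_right distrib_right)
  then have "(\<Sum>i<n. const_poly (lam i) * (c i + d i)) \<in> crit lam" by (rule critI)
  then show "x + y \<in> crit lam" unfolding * by (simp add: distrib_left sum.distrib)
next
  fix r x assume "x \<in> crit lam"
  then obtain v c where *: "log_field v c" "x = (\<Sum>i<n. const_poly (lam i) * c i)"
    by (elim critE)
  have "log_field (r *s v) (\<lambda>i. r * c i)"
    using * by (simp add: log_field_def dot3_scale mult.assoc)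
  then have "(\<Sum>i<n. const_poly (lam i) * (r * c i)) \<in> crit lam" by (rule critI)
  then show "r * x \<in> crit lam" unfolding * by (simp add: sum_distrib_left mult_ac)
qed

text \<open>
  The generators of the critical ideal are already closed under the ideal operations, because
  logarithmic fields form a module.
\<close>

lemma critical_ideal_eq_crit: "critical_ideal n f lam = crit lam"
proof -
  have "{g. \<exists>\<theta>\<in>Der_arr n f. to_fract g = pairing_omega n f lam \<theta>} = crit lam"
  proof (intro equalityI subsetI)
    fix g assume "g \<in> {g. \<exists>\<theta>\<in>Der_arr n f. to_fract g = pairing_omega n f lam \<theta>}"
    then obtain \<theta> where th: "\<theta> \<in> Der_arr n f" "to_fract g = pairing_omega n f lam \<theta>" by blast
    then have der: "derivation \<theta>" by (simp add: Der_arr_def)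
    have "\<forall>i<n. L i dvd \<theta> (L i)" using th(1) Der_arr_iff[OF der] by simp
    then have "\<forall>i. \<exists>d. i < n \<longrightarrow> \<theta> (L i) = d * L i" by (metis dvdE mult.commute)
    then obtain c where c: "\<And>i. i < n \<Longrightarrow> \<theta> (L i) = c i * L i" by metis
    have "dot3 (const_vec a) (\<chi> j. \<theta> (var_poly j)) = \<theta> (linear_form a)" for a
      unfolding derivation_linear_form[OF der] by (simp add: dot3_def sum_3)
    then have "log_field (\<chi> j. \<theta> (var_poly j)) c" using c by (simp add: log_field_def)
    then have "(\<Sum>i<n. const_poly (lam i) * c i) \<in> crit lam" by (rule critI)
    moreover have "to_fract g = to_fract (\<Sum>i<n. const_poly (lam i) * c i)"
      using th(2) pairing_eq[of \<theta> c lam] c by simp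
    ultimately show "g \<in> crit lam" by (simp only: to_fract_eq_iff)
  next
    fix g assume "g \<in> crit lam"
    then obtain v c where *: "log_field v c" "g = (\<Sum>i<n. const_poly (lam i) * c i)"
      by (elim critE)
    have der: "derivation (vector_derivation v)" by (rule derivation_vector_derivation)
    have c: "vector_derivation v (L i) = c i * L i" if "i < n" for i
      using *(1) that unfolding derivation_linear_form[OF der]
      by (simp add: log_field_def dot3_def sum_3 vector_derivation_var)
    have "vector_derivation v \<in> Der_arr n f" unfolding Der_arr_iff[OF der] using c by simp
    moreover have "to_fract g = pairing_omega n f lam (vector_derivation v)"
      using pairing_eq[of "vector_derivation v" c, OF c] * by simp
    ultimately show "g \<in> {g. \<exists>\<theta>\<in>Der_arr n f. to_fract g = pairing_omega n f lam \<theta>}" by blast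
  qed
  then show ?thesis
    unfolding critical_ideal_def ideal_generated_eq_span
    using subspace_crit by (metis ideal.span_eq_iff)
qed

lemma Sigma_bar_eq: "Sigma_bar n f lam = {x. \<forall>q\<in>crit lam. eval_poly q x = 0}"
  by (simp add: Sigma_bar_def vanishing_locus_def critical_ideal_eq_crit)

text \<open>
  The arrangement is invariant under dilations, so conjugating a logarithmic field by a dilation gives a
  logarithmic field. On coefficient vectors conjugation is dilation followed by division by \<open>t\<close>.
\<close>

lemma crit_dilate:
  assumes "u \<in> crit lam" "t \<noteq> 0"
  shows "dilate t u \<in> crit lam"
proof -
  obtain v c where *: "log_field v c" "u = (\<Sum>i<n. const_poly (lam i) * c i)"
    using assms(1) by (elim critE)
  have "log_field (const_poly (inverse t) *s (\<chi> j. dilate t (v $ j))) (\<lambda>i. dilate t (c i))"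
    unfolding log_field_def
  proof (intro allI impI)
    fix i assume "i < n"
    then have "dilate t (dot3 (const_vec (f i)) v) = dilate t (c i * L i)"
      using * by (simp add: log_field_def)
    then have eq: "dot3 (const_vec (f i)) (\<chi> j. dilate t (v $ j)) = dilate t (c i) * (const_poly t * L i)"
      unfolding dilate_linear_form[symmetric] by (simp add: dot3_def dilate_def)
    have "dot3 (const_vec (f i)) (const_poly (inverse t) *s (\<chi> j. dilate t (v $ j)))
      = const_poly (inverse t * t) * (dilate t (c i) * L i)"
      unfolding dot3_scale eq const_poly_mult by (simp only: mult_ac)
    then show "dot3 (const_vec (f i)) (const_poly (inverse t) *s (\<chi> j. dilate t (v $ j))) = dilate t (c i) * L i"
      using assms(2) by simp
  qed
  then have "(\<Sum>i<n. const_poly (lam i) * dilate t (c i)) \<in> crit lam" by (rule critI)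
  then show ?thesis unfolding * by (simp add: dilate_def)
qed

lemma Sigma_bar_cone:
  assumes x: "x \<in> Sigma_bar n f lam"
  shows "t *s x \<in> Sigma_bar n f lam"
proof -
  have "eval_poly q (t *s x) = 0" if q: "q \<in> crit lam" for q t
  proof -
    have *: "eval_poly q (t *s x) = 0" if "t \<noteq> 0" for t
    proof -
      have "eval_poly (dilate t q) x = 0" using x crit_dilate[OF q that] unfolding Sigma_bar_eq by blast
      then show ?thesis by simp
    qed
    \<comment> \<open>The factor \<open>t\<close> makes the product vanish at \<open>t = 0\<close> as well.\<close>
    let ?p = "[:0, 1:] * line_poly 0 x q"
    have "poly ?p t = 0" for t
      using *[of t] by (cases "t = 0") (simp_all add: poly_line_poly vector_scalar_mult_def)
    then have "?p = 0" using poly_all_0_iff_0 by blast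
    then have "poly (line_poly 0 x q) t = 0" by simp
    then show ?thesis by (simp add: poly_line_poly vector_scalar_mult_def)
  qed
  then show ?thesis by (simp add: Sigma_bar_eq)
qed

end

section \<open>The critical locus is never the origin alone\<close>

lemma const_poly_mult_cancel:
  assumes "c \<noteq> 0" "d dvd const_poly c * q"
  shows "d dvd q"
proof -
  have "d dvd const_poly (inverse c) * (const_poly c * q)" using assms(2) by (rule dvd_mult)
  also have "const_poly (inverse c) * (const_poly c * q) = const_poly (inverse c * c) * q"
    by (simp only: const_poly_mult mult.assoc)
  also have "\<dots> = q" using assms(1) by simp
  finally show ?thesis .
qed

lemma minimal_power_outside_ideal:
  fixes q :: "'a::comm_ring_1"
  assumes "q \<notin> I" "q * x ^ N \<in> I"
  shows "\<exists>a. q * x ^ a \<notin> I \<and> q * x ^ Suc a \<in> I"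
  using assms(2)
proof (induction N)
  case 0 then show ?case using assms(1) by simp
next
  case (Suc N)
  then show ?case by blast
qed

text \<open>
  Take a monomial outside \<open>I\<close> with maximal exponents, found greedily for one variable after the other.
\<close>

lemma socle_element:
  fixes I :: "3 mpoly set"
  assumes I: "ideal.subspace I" and one: "1 \<notin> I" and pow: "\<And>k. var_poly k ^ N \<in> I"
  obtains g where "g \<notin> I" "\<And>k. var_poly k * g \<in> I"
proof -
  let ?x = "var_poly 1 :: 3 mpoly" and ?y = "var_poly 2 :: 3 mpoly" and ?z = "var_poly 3 :: 3 mpoly"
  have sc: "q * r \<in> I" if "r \<in> I" for q r using ideal.subspace_scale[OF I that] .
  obtain a where a: "1 * ?x ^ a \<notin> I" "1 * ?x ^ Suc a \<in> I"
    using minimal_power_outside_ideal[OF one sc[OF pow]] by blast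
  obtain b where b: "1 * ?x ^ a * ?y ^ b \<notin> I" "1 * ?x ^ a * ?y ^ Suc b \<in> I"
    using minimal_power_outside_ideal[OF a(1) sc[OF pow]] by blast
  obtain c where c: "1 * ?x ^ a * ?y ^ b * ?z ^ c \<notin> I" "1 * ?x ^ a * ?y ^ b * ?z ^ Suc c \<in> I"
    using minimal_power_outside_ideal[OF b(1) sc[OF pow]] by blast
  have "var_poly k * (1 * ?x ^ a * ?y ^ b * ?z ^ c) \<in> I" for k
  proof -
    have "?x * (1 * ?x ^ a * ?y ^ b * ?z ^ c) = (?y ^ b * ?z ^ c) * (1 * ?x ^ Suc a)"
      "?y * (1 * ?x ^ a * ?y ^ b * ?z ^ c) = ?z ^ c * (1 * ?x ^ a * ?y ^ Suc b)"
      "?z * (1 * ?x ^ a * ?y ^ b * ?z ^ c) = 1 * ?x ^ a * ?y ^ b * ?z ^ Suc c"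
      by (simp_all only: power_Suc mult_ac)
    then have "?x * (1 * ?x ^ a * ?y ^ b * ?z ^ c) \<in> I" "?y * (1 * ?x ^ a * ?y ^ b * ?z ^ c) \<in> I"
       "?z * (1 * ?x ^ a * ?y ^ b * ?z ^ c) \<in> I"
      using sc[OF a(2)] sc[OF b(2)] c(2) by (simp_all only:)
    then show ?thesis using exhaust_3[of k] by blast
  qed
  then show ?thesis using c(1) that by blast
qed

context arrangement
begin

text \<open>
  The coefficient vector of \<open>Q\<close> times the logarithmic form of the weights.
\<close>

definition omega_poly :: "(nat \<Rightarrow> complex) \<Rightarrow> (3 mpoly) ^ 3" where
  "omega_poly lam = (\<Sum>i<n. (const_poly (lam i) * cofactor i) *s const_vec (f i))"

lemma omega_poly_nth: "omega_poly lam $ k = (\<Sum>i<n. const_poly (lam i) * cofactor i * const_poly (f i $ k))"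
  by (simp add: omega_poly_def)

lemma dot3_omega_poly:
  assumes "log_field v c"
  shows "dot3 (omega_poly lam) v = Q * (\<Sum>i<n. const_poly (lam i) * c i)"
  unfolding omega_poly_def dot3_sum_left dot3_scale sum_distrib_left
proof (rule sum.cong)
  fix i assume "i \<in> {..<n}"
  then have "i < n" by simp
  then have "dot3 (const_vec (f i)) v = c i * L i" "Q = L i * cofactor i"
    using assms Q_eq by (simp_all add: log_field_def)
  then show "const_poly (lam i) * cofactor i * dot3 (const_vec (f i)) v = Q * (const_poly (lam i) * c i)"
    by (simp only: mult_ac)
qed simp

lemma log_field_euler: "log_field euler (\<lambda>_. 1)"
  by (simp add: log_field_def linear_form_eq_dot3)

lemma dot3_omega_poly_euler: "dot3 (omega_poly lam) euler = Q * const_poly (\<Sum>i<n. lam i)"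
  using dot3_omega_poly[OF log_field_euler, of lam] by (simp add: const_poly_sum)

text \<open>
  Along each hyperplane, \<open>\<Phi>\<close> is proportional to the normal vector of the hyperplane. Equivalently, the
  1-form with coefficient vector \<open>\<Phi> / Q\<close> has logarithmic poles.
\<close>

definition tangent :: "(3 mpoly) ^ 3 \<Rightarrow> bool" where
  "tangent \<Phi> \<longleftrightarrow> (\<forall>i<n. \<forall>r s. L i dvd const_poly (f i $ r) * \<Phi> $ s - const_poly (f i $ s) * \<Phi> $ r)"

lemma tangentD: "tangent \<Phi> \<Longrightarrow> i < n \<Longrightarrow> L i dvd const_poly (f i $ r) * \<Phi> $ s - const_poly (f i $ s) * \<Phi> $ r"
  by (simp add: tangent_def)

lemma tangent_scale:
  assumes "tangent \<Phi>"
  shows "tangent (q *s \<Phi>)"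
  unfolding tangent_def
proof (intro allI impI)
  fix i r s assume "i < n"
  have "L i dvd q * (const_poly (f i $ r) * \<Phi> $ s - const_poly (f i $ s) * \<Phi> $ r)"
    by (rule dvd_mult[OF tangentD[OF assms \<open>i < n\<close>]])
  then show "L i dvd const_poly (f i $ r) * (q *s \<Phi>) $ s - const_poly (f i $ s) * (q *s \<Phi>) $ r"
    by (simp add: algebra_simps)
qed

lemma tangent_diff:
  assumes "tangent \<Phi>" "tangent \<Psi>"
  shows "tangent (\<Phi> - \<Psi>)"
  unfolding tangent_def
proof (intro allI impI)
  fix i r s assume "i < n"
  have "L i dvd (const_poly (f i $ r) * \<Phi> $ s - const_poly (f i $ s) * \<Phi> $ r)
      - (const_poly (f i $ r) * \<Psi> $ s - const_poly (f i $ s) * \<Psi> $ r)"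
    using assms \<open>i < n\<close> by (intro dvd_diff tangentD)
  then show "L i dvd const_poly (f i $ r) * (\<Phi> - \<Psi>) $ s - const_poly (f i $ s) * (\<Phi> - \<Psi>) $ r"
    by (simp add: algebra_simps)
qed

lemma tangent_omega_poly: "tangent (omega_poly lam)"
  unfolding tangent_def
proof (intro allI impI)
  fix i r s assume i: "i < n"
  have "const_poly (f i $ r) * omega_poly lam $ s - const_poly (f i $ s) * omega_poly lam $ r
    = (\<Sum>j<n. const_poly (lam j) * cofactor j *
        (const_poly (f i $ r) * const_poly (f j $ s) - const_poly (f i $ s) * const_poly (f j $ r)))"
    unfolding omega_poly_nth sum_distrib_left sum_subtractf[symmetric]
    by (rule sum.cong) (simp_all add: algebra_simps)
  also have "L i dvd \<dots>"
  proof (rule dvd_sum)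
    fix j assume j: "j \<in> {..<n}"
    show "L i dvd const_poly (lam j) * cofactor j *
        (const_poly (f i $ r) * const_poly (f j $ s) - const_poly (f i $ s) * const_poly (f j $ r))"
    proof (cases "i = j")
      case True then show ?thesis by (simp add: mult.commute)
    next
      case False
      then show ?thesis using L_dvd_cofactor[of i j] i j by (intro dvd_mult2 dvd_mult) auto
    qed
  qed
  finally show "L i dvd const_poly (f i $ r) * omega_poly lam $ s - const_poly (f i $ s) * omega_poly lam $ r" .
qed

text \<open>
  By the triple product expansion, \<open>f i \<times> (v \<times> E) = L i * (v - c i * E)\<close>.
\<close>

lemma tangent_vprod_euler:
  assumes v: "log_field v c"
  shows "tangent (vprod v euler)"
  unfolding tangent_def
proof (intro allI impI)
  fix i r s assume i: "i < n"
  have "L i dvd vprod (const_vec (f i)) (vprod v euler) $ k" for k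
  proof -
    have "vprod (const_vec (f i)) (vprod v euler) $ k = L i * (v $ k - c i * var_poly k)"
      using v i unfolding vprod_vprod by (simp add: log_field_def linear_form_eq_dot3[symmetric] algebra_simps)
    then show ?thesis by simp
  qed
  then have "L i dvd vprod (const_vec (f i)) (vprod v euler) $ 1"
    "L i dvd vprod (const_vec (f i)) (vprod v euler) $ 2" "L i dvd vprod (const_vec (f i)) (vprod v euler) $ 3"
    by blast+
  then have *: "L i dvd const_poly (f i $ 2) * vprod v euler $ 3 - const_poly (f i $ 3) * vprod v euler $ 2"
    "L i dvd const_poly (f i $ 3) * vprod v euler $ 1 - const_poly (f i $ 1) * vprod v euler $ 3"
    "L i dvd const_poly (f i $ 1) * vprod v euler $ 2 - const_poly (f i $ 2) * vprod v euler $ 1"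
    unfolding vprod_nth[of "const_vec (f i)"] const_vec_nth by this+
  then have "L i dvd const_poly (f i $ 3) * vprod v euler $ 2 - const_poly (f i $ 2) * vprod v euler $ 3"
    "L i dvd const_poly (f i $ 1) * vprod v euler $ 3 - const_poly (f i $ 3) * vprod v euler $ 1"
    "L i dvd const_poly (f i $ 2) * vprod v euler $ 1 - const_poly (f i $ 1) * vprod v euler $ 2"
    by (metis dvd_minus_iff minus_diff_eq)+
  then show "L i dvd const_poly (f i $ r) * vprod v euler $ s - const_poly (f i $ s) * vprod v euler $ r"
    using * exhaust_3[of r] exhaust_3[of s] by (elim disjE) (simp_all only: diff_self dvd_0_right)
qed

text \<open>
  Modulo \<open>euler\<close>, logarithmic fields correspond to tangent vectors orthogonal to \<open>euler\<close>. For surjectivity,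
  a field \<open>v\<close> exists by Koszul exactness, and the same triple product \<open>L i * v - (f i \<bullet> v) * E\<close> shows that
  \<open>L i\<close> divides \<open>f i \<bullet> v\<close>.
\<close>

lemma log_field_if_tangent:
  assumes "tangent \<Phi>" "dot3 \<Phi> euler = 0"
  obtains v c where "log_field v c" "\<Phi> = vprod v euler"
proof -
  obtain v where v: "\<Phi> = vprod v euler" using koszul_exact_2[OF assms(2)] .
  have "L i dvd dot3 (const_vec (f i)) v" if i: "i < n" for i
  proof -
    obtain k where k: "\<not> L i dvd var_poly k" using L_not_dvd_var[OF i] ..
    have "L i dvd vprod (const_vec (f i)) \<Phi> $ k"
      using exhaust_3[of k] tangentD[OF assms(1) i] by (elim disjE) (simp_all only: vprod_nth const_vec_nth)
    moreover have "vprod (const_vec (f i)) \<Phi> $ k = L i * v $ k - dot3 (const_vec (f i)) v * var_poly k"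
      unfolding v vprod_vprod by (simp add: linear_form_eq_dot3)
    ultimately have "L i dvd L i * v $ k - dot3 (const_vec (f i)) v * var_poly k" by simp
    from dvd_diff[OF dvd_triv_left[of "L i" "v $ k"] this]
    have "L i dvd dot3 (const_vec (f i)) v * var_poly k" by (simp only: diff_diff_eq2 add_diff_cancel_left')
    then show ?thesis using k prime_L[OF i] prime_elem_dvd_mult_iff by blast
  qed
  then have "\<forall>i. \<exists>d. i < n \<longrightarrow> dot3 (const_vec (f i)) v = d * L i" by (metis dvdE mult.commute)
  then obtain c where "\<And>i. i < n \<Longrightarrow> dot3 (const_vec (f i)) v = c i * L i" by metis
  then have "log_field v c" by (simp add: log_field_def)
  then show ?thesis using v that by blast
qed

text \<open>
  Along each hyperplane two tangent vectors are both proportional to the normal, hence to each other.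
  It corresponds to Saito's divisibility by \<open>Q\<close> of the determinant of three logarithmic fields.
\<close>

lemma Q_dvd_minor:
  assumes "tangent \<Psi>" "tangent \<Phi>"
  shows "Q dvd \<Psi> $ r * \<Phi> $ s - \<Psi> $ s * \<Phi> $ r"
proof (rule Q_dvd)
  fix i assume i: "i < n"
  obtain m where m: "f i $ m \<noteq> 0" using f_nonzero[OF i] by (auto simp: vec_eq_iff)
  let ?a = "\<lambda>k. const_poly (f i $ k)"
  note T = tangentD[OF assms(1) i] and T' = tangentD[OF assms(2) i]
  \<comment> \<open>A combination of tangency relations equal to the minor times the square of the unit \<open>?a m\<close>.\<close>
  have "L i dvd (?a m * \<Psi> $ r - ?a r * \<Psi> $ m) * (?a m * \<Phi> $ s) + ?a r * \<Psi> $ m * (?a m * \<Phi> $ s - ?a s * \<Phi> $ m)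
      - (?a m * \<Psi> $ s - ?a s * \<Psi> $ m) * (?a m * \<Phi> $ r) - ?a s * \<Psi> $ m * (?a m * \<Phi> $ r - ?a r * \<Phi> $ m)"
    by (intro dvd_diff dvd_add dvd_mult2[OF T] dvd_mult[OF T'])
  also have "\<dots> = const_poly (f i $ m) * (const_poly (f i $ m) * (\<Psi> $ r * \<Phi> $ s - \<Psi> $ s * \<Phi> $ r))"
    by (simp add: algebra_simps)
  finally show "L i dvd \<Psi> $ r * \<Phi> $ s - \<Psi> $ s * \<Phi> $ r"
    using const_poly_mult_cancel[OF m] by blast
qed

lemma vprod_omega_poly:
  assumes "log_field v c" "(\<Sum>i<n. lam i) = 0"
  shows "vprod (omega_poly lam) (vprod v euler) = - (Q * (\<Sum>i<n. const_poly (lam i) * c i)) *s euler"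
  unfolding vprod_vprod dot3_omega_poly_euler dot3_omega_poly[OF assms(1)] assms(2)
  by (simp add: vec_eq_iff)

text \<open>
  A priori \<open>\<Psi> = h W\<close> with a rational function \<open>h\<close>, where \<open>W = omega_poly lam\<close>. For every \<open>u \<in> I\<close> with
  associated \<open>\<Phi>\<close>, the minors of \<open>\<Psi>\<close> and \<open>\<Phi>\<close> are divisible by \<open>Q\<close>, while they equal
  \<open>h * (W \<times> \<Phi>) = - h * Q * u * E\<close>. So \<open>h u x\<^sub>k\<close> is a polynomial. Taking for \<open>u\<close> powers of two
  variables shows that \<open>h\<close> has no denominator.
\<close>

lemma proportional_if_parallel:
  assumes lam: "(\<Sum>i<n. lam i) = 0" and W0: "omega_poly lam \<noteq> 0"
    and pow: "\<And>k. var_poly k ^ N \<in> crit lam"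
    and T: "tangent \<Psi>" and par: "vprod (omega_poly lam) \<Psi> = 0"
  obtains h where "\<Psi> = h *s omega_poly lam"
proof -
  let ?W = "omega_poly lam"
  obtain m where m: "?W $ m \<noteq> 0" using W0 by (auto simp: vec_eq_iff)
  have p: "?W $ 2 * \<Psi> $ 3 = ?W $ 3 * \<Psi> $ 2" "?W $ 3 * \<Psi> $ 1 = ?W $ 1 * \<Psi> $ 3"
     "?W $ 1 * \<Psi> $ 2 = ?W $ 2 * \<Psi> $ 1"
    using arg_cong[OF par, of "\<lambda>v. v $ 1"] arg_cong[OF par, of "\<lambda>v. v $ 2"] arg_cong[OF par, of "\<lambda>v. v $ 3"]
    unfolding vprod_nth zero_index right_minus_eq by this+
  have par': "?W $ r * \<Psi> $ s = ?W $ s * \<Psi> $ r" for r s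
    using p exhaust_3[of r] exhaust_3[of s] by (elim disjE) (simp_all only:)
  have dv: "?W $ m dvd \<Psi> $ m * var_poly k ^ Suc N" for k
  proof -
    obtain v c where v: "log_field v c" "var_poly k ^ N = (\<Sum>i<n. const_poly (lam i) * c i)"
      using pow critE by blast
    define \<Phi> where "\<Phi> = vprod v euler"
    have WP: "vprod ?W \<Phi> = - (Q * var_poly k ^ N) *s euler"
      unfolding \<Phi>_def v(2) by (rule vprod_omega_poly[OF v(1) lam])
    have T': "tangent \<Phi>" unfolding \<Phi>_def by (rule tangent_vprod_euler[OF v(1)])
    have "\<exists>\<xi>. vprod \<Psi> \<Phi> $ k = Q * \<xi>"
      using Q_dvd_minor[OF T T'] exhaust_3[of k] unfolding dvd_def by (elim disjE) (simp_all only: vprod_nth)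
    then obtain \<xi> where xi: "vprod \<Psi> \<Phi> $ k = Q * \<xi>" ..
    have minor: "?W $ m * (\<Psi> $ r * \<Phi> $ s - \<Psi> $ s * \<Phi> $ r) = \<Psi> $ m * (?W $ r * \<Phi> $ s - ?W $ s * \<Phi> $ r)" for r s
    proof -
      have "?W $ m * (\<Psi> $ r * \<Phi> $ s - \<Psi> $ s * \<Phi> $ r) = (?W $ m * \<Psi> $ r) * \<Phi> $ s - (?W $ m * \<Psi> $ s) * \<Phi> $ r"
        by (simp add: algebra_simps)
      also have "\<dots> = (?W $ r * \<Psi> $ m) * \<Phi> $ s - (?W $ s * \<Psi> $ m) * \<Phi> $ r"
        unfolding par'[of m r] par'[of m s] ..
      finally show ?thesis by (simp add: algebra_simps)
    qed
    have "?W $ m * vprod \<Psi> \<Phi> $ k = \<Psi> $ m * vprod ?W \<Phi> $ k"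
      using exhaust_3[of k] by (elim disjE) (simp_all only: vprod_nth minor)
    then have "Q * (?W $ m * \<xi>) = Q * (- (\<Psi> $ m * var_poly k ^ Suc N))"
      unfolding xi WP by (simp add: algebra_simps)
    then have "?W $ m * \<xi> = - (\<Psi> $ m * var_poly k ^ Suc N)"
      using Q_nonzero unfolding mult_cancel_left by blast
    then have "\<Psi> $ m * var_poly k ^ Suc N = ?W $ m * (- \<xi>)" by simp
    then show ?thesis ..
  qed
  have "?W $ m dvd \<Psi> $ m" by (rule dvd_by_two_variables[OF m dv dv])
  then obtain h where h: "\<Psi> $ m = ?W $ m * h" ..
  have "\<Psi> $ r = h * ?W $ r" for r
  proof -
    have "?W $ m * \<Psi> $ r = ?W $ m * (h * ?W $ r)" unfolding par'[of m r] h by (simp only: mult_ac)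
    then show ?thesis using m unfolding mult_cancel_left by blast
  qed
  then have "\<Psi> = h *s ?W" by (simp add: vec_eq_iff)
  then show ?thesis by (rule that)
qed

text \<open>
  With \<open>W = omega_poly lam\<close>, let \<open>\<Phi> k\<close> belong to \<open>x\<^sub>k g\<close>. The vectors \<open>x\<^sub>l \<Phi>\<^sub>k - x\<^sub>k \<Phi>\<^sub>l\<close> are
  multiples \<open>h k l\<close> of \<open>W\<close>. The multipliers satisfy the cocycle relation, so by Koszul exactness they are
  removed by subtracting multiples \<open>l\<^sub>k W\<close> from \<open>\<Phi>\<^sub>k\<close>. The corrected vectors are \<open>x\<^sub>k F\<close> for a common \<open>F\<close>, and
  \<open>F\<close> belongs to \<open>g\<close>.
\<close>

lemma socle_in_crit:
  assumes lam: "(\<Sum>i<n. lam i) = 0" and W0: "omega_poly lam \<noteq> 0"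
    and pow: "\<And>k. var_poly k ^ N \<in> crit lam"
    and g: "\<And>k. var_poly k * g \<in> crit lam"
  shows "g \<in> crit lam"
proof -
  let ?W = "omega_poly lam"
  let ?x = "var_poly :: 3 \<Rightarrow> 3 mpoly"
  have x0: "?x k \<noteq> 0" for k using prime_var_poly[of k] by auto
  have "\<exists>\<Phi>. tangent \<Phi> \<and> dot3 \<Phi> euler = 0 \<and> vprod ?W \<Phi> = - (Q * (?x k * g)) *s euler" for k
  proof -
    obtain v c where v: "log_field v c" "?x k * g = (\<Sum>i<n. const_poly (lam i) * c i)"
      using g critE by blast
    show ?thesis unfolding v(2)
      by (rule exI[of _ "vprod v euler"]) 
        (intro conjI tangent_vprod_euler[OF v(1)] dot3_vprod_right vprod_omega_poly[OF v(1) lam])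
  qed
  then obtain \<Phi> where T: "\<And>k. tangent (\<Phi> k)" and E: "\<And>k. dot3 (\<Phi> k) euler = 0"
     and WP: "\<And>k. vprod ?W (\<Phi> k) = - (Q * (?x k * g)) *s euler" by metis
  have "\<exists>h. ?x l *s \<Phi> k - ?x k *s \<Phi> l = h *s ?W" for k l
  proof (rule proportional_if_parallel[OF lam W0 pow])
    show "tangent (?x l *s \<Phi> k - ?x k *s \<Phi> l)" by (intro tangent_diff tangent_scale T)
    show "vprod ?W (?x l *s \<Phi> k - ?x k *s \<Phi> l) = 0"
      unfolding vprod_diff vprod_scale WP by (simp add: vec_eq_iff mult_ac)
  qed blast
  then have ex: "\<exists>h. ?x l *s \<Phi> k - ?x k *s \<Phi> l = h *s ?W" for k l .
  define h where "h k l = (SOME h. ?x l *s \<Phi> k - ?x k *s \<Phi> l = h *s ?W)" for k l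
  have h: "?x l *s \<Phi> k - ?x k *s \<Phi> l = h k l *s ?W" for k l
    unfolding h_def by (rule someI_ex[OF ex])
  have hn: "?x l * \<Phi> k $ r - ?x k * \<Phi> l $ r = h k l * ?W $ r" for k l r
    using arg_cong[OF h[where k = k and l = l], of "\<lambda>v. v $ r"] by simp
  obtain m where m: "?W $ m \<noteq> 0" using W0 by (auto simp: vec_eq_iff)
  \<comment> \<open>The multipliers, indexed such that the cocycle relation reads \<open>dot3 H euler = 0\<close>.\<close>
  define H where "H = (vector [h 2 3, h 3 1, h 1 2] :: (3 mpoly) ^ 3)"
  have "?W $ m * dot3 H euler = ?x 1 * (h 2 3 * ?W $ m) + ?x 2 * (h 3 1 * ?W $ m) + ?x 3 * (h 1 2 * ?W $ m)"
    by (simp add: dot3_def H_def algebra_simps)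
  also have "\<dots> = 0" unfolding hn[symmetric] by (simp add: algebra_simps)
  finally have "dot3 H euler = 0" using m by simp
  then obtain l where l: "H = vprod l euler" using koszul_exact_2 by blast
  have hl: "h 2 3 = l $ 2 * ?x 3 - l $ 3 * ?x 2" "h 3 1 = l $ 3 * ?x 1 - l $ 1 * ?x 3"
    "h 1 2 = l $ 1 * ?x 2 - l $ 2 * ?x 1"
    using arg_cong[OF l, of "\<lambda>v. v $ 1"] arg_cong[OF l, of "\<lambda>v. v $ 2"] arg_cong[OF l, of "\<lambda>v. v $ 3"]
    by (simp_all add: H_def vprod_nth)
  define \<Phi>' where "\<Phi>' k = \<Phi> k - l $ k *s ?W" for k
  have sym: "?x 2 * \<Phi>' 1 $ r = ?x 1 * \<Phi>' 2 $ r" "?x 3 * \<Phi>' 1 $ r = ?x 1 * \<Phi>' 3 $ r" for r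
    using hn[where k = 1 and l = 2 and r = r] hn[where k = 3 and l = 1 and r = r] unfolding hl \<Phi>'_def by (simp_all add: algebra_simps)
  have "?x 1 dvd \<Phi>' 1 $ r" for r
  proof -
    have "?x 1 dvd ?x 2 * \<Phi>' 1 $ r" unfolding sym by (rule dvd_triv_left)
    then show ?thesis
      using prime_var_poly[of 1] var_poly_dvd_var_poly[of 1 2] prime_elem_dvd_mult_iff by force
  qed
  then have "\<forall>r. \<exists>q. \<Phi>' 1 $ r = ?x 1 * q" unfolding dvd_def by blast
  then obtain \<phi> where phi: "\<And>r. \<Phi>' 1 $ r = ?x 1 * \<phi> r" by metis
  define F where "F = (\<chi> r. \<phi> r)"
  have F: "\<Phi>' k = ?x k *s F" for k
  proof -
    have "?x 1 * \<Phi>' 2 $ r = ?x 1 * (?x 2 * \<phi> r)" "?x 1 * \<Phi>' 3 $ r = ?x 1 * (?x 3 * \<phi> r)" for r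
      unfolding sym[symmetric] phi by (simp_all only: mult_ac)
    then have "\<Phi>' 2 $ r = ?x 2 * \<phi> r" "\<Phi>' 3 $ r = ?x 3 * \<phi> r" for r
      using x0[of 1] unfolding mult_cancel_left by blast+
    then show ?thesis using exhaust_3[of k] phi by (elim disjE) (simp_all add: vec_eq_iff F_def)
  qed
  have "?x 1 * dot3 F euler = dot3 (\<Phi>' 1) euler" by (simp add: F dot3_scale)
  also have "\<dots> = 0" by (simp add: \<Phi>'_def dot3_diff dot3_scale E dot3_omega_poly_euler lam)
  finally have FE: "dot3 F euler = 0" using x0[of 1] by simp
  have TF: "tangent F"
    unfolding tangent_def
  proof (intro allI impI)
    fix i r s assume i: "i < n"
    obtain k where k: "\<not> L i dvd ?x k" using L_not_dvd_var[OF i] ..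
    have "tangent (\<Phi>' k)" unfolding \<Phi>'_def by (intro tangent_diff tangent_scale T tangent_omega_poly)
    then have "L i dvd const_poly (f i $ r) * \<Phi>' k $ s - const_poly (f i $ s) * \<Phi>' k $ r"
      by (rule tangentD[OF _ i])
    also have "\<dots> = ?x k * (const_poly (f i $ r) * F $ s - const_poly (f i $ s) * F $ r)"
      unfolding F by (simp add: algebra_simps)
    finally show "L i dvd const_poly (f i $ r) * F $ s - const_poly (f i $ s) * F $ r"
      using k prime_L[OF i] prime_elem_dvd_mult_iff by blast
  qed
  obtain v c where v: "log_field v c" "F = vprod v euler" using log_field_if_tangent[OF TF FE] .
  define u where "u = (\<Sum>i<n. const_poly (lam i) * c i)"
  have "?x 1 *s vprod ?W F = vprod ?W (\<Phi>' 1)" unfolding F vprod_scale ..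
  also have "\<dots> = - (Q * (?x 1 * g)) *s euler"
    unfolding \<Phi>'_def vprod_diff vprod_scale vprod_self WP by (simp add: vec_eq_iff)
  finally have "?x 1 *s (- (Q * u) *s euler) = - (Q * (?x 1 * g)) *s euler"
    unfolding v(2) vprod_omega_poly[OF v(1) lam] u_def .
  from arg_cong[OF this, of "\<lambda>v. v $ 1"]
  have "(Q * ?x 1 * ?x 1) * u = (Q * ?x 1 * ?x 1) * g" by (simp add: algebra_simps)
  then have "u = g" using Q_nonzero x0[of 1] by simp
  then show ?thesis using critI[OF v(1), of lam] unfolding u_def by simp
qed

text \<open>
  The Euler field pairs with the logarithmic form to the constant \<open>\<Sum>i. lam i\<close>.
\<close>

lemma sum_weights_zero:
  assumes "0 \<in> Sigma_bar n f lam"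
  shows "(\<Sum>i<n. lam i) = 0"
proof -
  have "(\<Sum>i<n. const_poly (lam i) * 1) \<in> crit lam" by (rule critI[OF log_field_euler])
  then have "eval_poly (\<Sum>i<n. const_poly (lam i) * 1) (0 :: complex ^ 3) = 0" using assms unfolding Sigma_bar_eq by blast
  then show ?thesis by simp
qed

lemma crit_trivial:
  assumes "omega_poly lam = 0" "u \<in> crit lam"
  shows "u = 0"
proof -
  obtain v c where v: "log_field v c" "u = (\<Sum>i<n. const_poly (lam i) * c i)"
    using assms(2) by (rule critE)
  have "Q * u = 0" using dot3_omega_poly[OF v(1), of lam] unfolding v(2) assms(1) by (simp add: dot3_def)
  then show ?thesis using Q_nonzero by simp
qed

text \<open>
  Otherwise the Nullstellensatz puts a power of every variable into the critical ideal. This provides a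
  polynomial outside the ideal that every variable multiplies into it, contradicting \<open>socle_in_crit\<close>.
\<close>

theorem Sigma_bar_not_origin:
  assumes zero: "0 \<in> Sigma_bar n f lam"
  shows "\<exists>x\<in>Sigma_bar n f lam. x \<noteq> 0"
proof (rule ccontr)
  assume "\<not> ?thesis"
  then have only: "x = 0" if "x \<in> Sigma_bar n f lam" for x using that by blast
  have I: "ideal.subspace (crit lam)" by (rule subspace_crit)
  have "\<exists>N. var_poly k ^ N \<in> crit lam" for k
  proof (rule nullstellensatz[OF I])
    fix x assume "\<And>q. q \<in> crit lam \<Longrightarrow> eval_poly q x = 0"
    then have "x = 0" by (intro only) (simp add: Sigma_bar_eq)
    then show "eval_poly (var_poly k) x = 0" by simp
  qed
  then obtain M where M: "\<And>k. var_poly k ^ M k \<in> crit lam" by metis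
  define N where "N = M 1 + M 2 + M 3"
  have pow: "var_poly k ^ N \<in> crit lam" for k
  proof -
    have "M k \<le> N" using exhaust_3[of k] by (auto simp: N_def)
    then have "var_poly k ^ N = var_poly k ^ (N - M k) * (var_poly k ^ M k :: 3 mpoly)"
      by (simp add: power_add[symmetric])
    then show ?thesis using ideal.subspace_scale[OF I M] by simp
  qed
  have one: "1 \<notin> crit lam"
  proof
    assume "1 \<in> crit lam"
    then have "eval_poly 1 (0 :: complex ^ 3) = 0" using zero unfolding Sigma_bar_eq by blast
    then show False by simp
  qed
  have W0: "omega_poly lam \<noteq> 0"
  proof
    assume "omega_poly lam = 0"
    then have "var_poly 1 ^ N = (0 :: 3 mpoly)" using crit_trivial pow by blast
    then show False using prime_var_poly[of 1] by auto
  qed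
  obtain g where "g \<notin> crit lam" "\<And>k. var_poly k * g \<in> crit lam"
    using socle_element[OF I one pow] by blast
  then show False using socle_in_crit[OF sum_weights_zero[OF zero] W0 pow] by blast
qed

end

section \<open>Forms in three variables\<close>

text \<open>
  In the numeral type \<open>3\<close> the element \<open>3\<close> equals \<open>0\<close> and is therefore the smallest.
\<close>

lemma order_3 [simp]: "(1::3) < 2" "(3::3) < 1" "(3::3) < 2" "\<not> (2::3) < 1" "\<not> (1::3) < 3" "\<not> (2::3) < 3"
  by (simp_all add: less_bit1_def bit1.Rep_numeral bit1.Rep_1 bit1.Rep_0)

lemma sign_eq_prod:
  assumes "finite S" "finite T"
  shows "(- 1 :: 'a::comm_ring_1) ^ card {(s, t). s \<in> S \<and> t \<in> T \<and> t < s} = (\<Prod>s\<in>S. \<Prod>t\<in>T. if t < s then - 1 else 1)"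
proof -
  have "(\<Prod>s\<in>S. \<Prod>t\<in>T. if t < s then - 1 else (1 :: 'a)) = (\<Prod>(s, t)\<in>S \<times> T. if t < s then - 1 else 1)"
    by (rule prod.cartesian_product)
  also have "\<dots> = (\<Prod>x\<in>S \<times> T. if snd x < fst x then - 1 else 1)"
    by (simp add: case_prod_unfold)
  also have "\<dots> = (\<Prod>x\<in>{x \<in> S \<times> T. snd x < fst x}. - 1)"
    using assms by (intro prod.inter_filter[symmetric]) simp
  also have "{x \<in> S \<times> T. snd x < fst x} = {(s, t). s \<in> S \<and> t \<in> T \<and> t < s}" by auto
  finally show ?thesis by simp
qed

text \<open>
  A form on three dimensional space is a scalar, two vectors and a scalar. The components of \<open>part2\<close> refer
  to \<open>dx\<^sub>2 \<and> dx\<^sub>3\<close>, \<open>dx\<^sub>3 \<and> dx\<^sub>1\<close> and \<open>dx\<^sub>1 \<and> dx\<^sub>2\<close>, so that the exterior product is given by \<open>vprod\<close> and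
  \<open>dot3\<close>. As \<open>3 < 1 < 2\<close>, the component at \<open>{2, 3}\<close> refers to \<open>dx\<^sub>3 \<and> dx\<^sub>2\<close>, which explains the sign in
  \<open>part2\<close>; \<open>dx\<^sub>3 \<and> dx\<^sub>1 \<and> dx\<^sub>2\<close> is an even rearrangement, so \<open>part3\<close> has none.
\<close>

definition part0 :: "3 form \<Rightarrow> 3 ratfun" where "part0 \<alpha> = \<alpha> $ {}"
definition part1 :: "3 form \<Rightarrow> (3 ratfun) ^ 3" where "part1 \<alpha> = (\<chi> k. \<alpha> $ {k})"
definition part2 :: "3 form \<Rightarrow> (3 ratfun) ^ 3" where
  "part2 \<alpha> = vector [- (\<alpha> $ {2, 3}), \<alpha> $ {1, 3}, \<alpha> $ {1, 2}]"
definition part3 :: "3 form \<Rightarrow> 3 ratfun" where "part3 \<alpha> = \<alpha> $ {1, 2, 3}"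

lemma subsets_3: 
  fixes S :: "3 set"
  shows "S = {} \<or> S = {1} \<or> S = {2} \<or> S = {3} \<or> S = {2, 3} \<or> S = {1, 3} \<or> S = {1, 2} \<or> S = {1, 2, 3}"
proof -
  have "S \<in> Pow {1, 2, 3}" using UNIV_3 by auto
  then show ?thesis by (auto simp: Pow_insert)
qed

lemma form_eqI:
  assumes "part0 \<alpha> = part0 \<beta>" "part1 \<alpha> = part1 \<beta>" "part2 \<alpha> = part2 \<beta>" "part3 \<alpha> = part3 \<beta>"
  shows "\<alpha> = \<beta>"
proof -
  have 1: "\<alpha> $ {k} = \<beta> $ {k}" for k
    using arg_cong[OF assms(2), of "\<lambda>v. v $ k"] by (simp add: part1_def)
  have 2: "\<alpha> $ {2, 3} = \<beta> $ {2, 3}" "\<alpha> $ {1, 3} = \<beta> $ {1, 3}" "\<alpha> $ {1, 2} = \<beta> $ {1, 2}"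
    using arg_cong[OF assms(3), of "\<lambda>v. v $ 1"] arg_cong[OF assms(3), of "\<lambda>v. v $ 2"]
      arg_cong[OF assms(3), of "\<lambda>v. v $ 3"]
    by (simp_all add: part2_def)
  have "\<alpha> $ S = \<beta> $ S" for S
    using subsets_3[of S] 1 2 assms(1,4) unfolding part0_def part3_def by (elim disjE) simp_all
  then show ?thesis by (simp add: vec_eq_iff)
qed

lemma sum_Pow_insert:
  assumes "finite A" "a \<notin> A"
  shows "sum g (Pow (insert a A)) = sum g (Pow A) + (\<Sum>S\<in>Pow A. g (insert a S))"
proof -
  have "sum g (Pow (insert a A)) = sum g (Pow A \<union> insert a ` Pow A)" by (simp add: Pow_insert)
  also have "\<dots> = sum g (Pow A) + sum g (insert a ` Pow A)"
    using assms by (intro sum.union_disjoint) auto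
  also have "sum g (insert a ` Pow A) = (\<Sum>S\<in>Pow A. g (insert a S))"
    using assms by (subst sum.reindex) (auto simp: inj_on_def)
  finally show ?thesis .
qed

lemma wedge_nth:
  "(\<alpha> \<and>\<^sub>f \<beta>) $ U = (\<Sum>S\<in>Pow U. (\<Prod>s\<in>S. \<Prod>t\<in>U - S. if t < s then - 1 else 1) * \<alpha> $ S * \<beta> $ (U - S))"
  by (simp only: wedge_def vec_lambda_beta sign_eq_prod[OF finite finite])

lemma part0_wedge: "part0 (\<alpha> \<and>\<^sub>f \<beta>) = part0 \<alpha> * part0 \<beta>"
  by (simp add: part0_def wedge_nth)

lemma part1_wedge: "part1 (\<alpha> \<and>\<^sub>f \<beta>) = part0 \<alpha> *s part1 \<beta> + part0 \<beta> *s part1 \<alpha>"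
  by (simp add: part0_def part1_def wedge_nth vec_eq_iff sum_Pow_insert mult.commute)

lemma part2_wedge:
  "part2 (\<alpha> \<and>\<^sub>f \<beta>) = part0 \<alpha> *s part2 \<beta> + part0 \<beta> *s part2 \<alpha> + vprod (part1 \<alpha>) (part1 \<beta>)"
  by (rule vec3_eqI)
    (simp_all add: part0_def part1_def part2_def wedge_nth sum_Pow_insert vprod_nth insert_Diff_if algebra_simps)

lemma part3_wedge:
  "part3 (\<alpha> \<and>\<^sub>f \<beta>) = part0 \<alpha> * part3 \<beta> + part0 \<beta> * part3 \<alpha>
    + dot3 (part1 \<alpha>) (part2 \<beta>) + dot3 (part2 \<alpha>) (part1 \<beta>)"
  by (simp add: part0_def part1_def part2_def part3_def wedge_nth sum_Pow_insert dot3_def insert_Diff_if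
      insert_commute algebra_simps)

lemmas parts_wedge = part0_wedge part1_wedge part2_wedge part3_wedge

lemma parts_add:
  "part0 (\<alpha> + \<beta>) = part0 \<alpha> + part0 \<beta>" "part1 (\<alpha> + \<beta>) = part1 \<alpha> + part1 \<beta>"
  "part2 (\<alpha> + \<beta>) = part2 \<alpha> + part2 \<beta>" "part3 (\<alpha> + \<beta>) = part3 \<alpha> + part3 \<beta>"
  by (auto simp: part0_def part1_def part2_def part3_def vec_eq_iff forall_3)

lemma parts_scale:
  "part0 (c *s \<alpha>) = c * part0 \<alpha>" "part1 (c *s \<alpha>) = c *s part1 \<alpha>"
  "part2 (c *s \<alpha>) = c *s part2 \<alpha>" "part3 (c *s \<alpha>) = c * part3 \<alpha>"
  by (auto simp: part0_def part1_def part2_def part3_def vec_eq_iff forall_3)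

lemma parts_zero: "part0 0 = 0" "part1 0 = 0" "part2 0 = 0" "part3 0 = 0"
  by (auto simp: part0_def part1_def part2_def part3_def vec_eq_iff forall_3)

lemma parts_sum:
  "part0 (sum g A) = (\<Sum>a\<in>A. part0 (g a))" "part1 (sum g A) = (\<Sum>a\<in>A. part1 (g a))"
  "part2 (sum g A) = (\<Sum>a\<in>A. part2 (g a))" "part3 (sum g A) = (\<Sum>a\<in>A. part3 (g a))"
  by (induction A rule: infinite_finite_induct; simp add: parts_zero parts_add)+

definition form_of_parts :: "3 ratfun \<Rightarrow> (3 ratfun) ^ 3 \<Rightarrow> (3 ratfun) ^ 3 \<Rightarrow> 3 ratfun \<Rightarrow> 3 form" where
  "form_of_parts a v w b = (\<chi> S. if S = {} then a else if S = {1} then v $ 1 else if S = {2} then v $ 2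
    else if S = {3} then v $ 3 else if S = {2, 3} then - (w $ 1) else if S = {1, 3} then w $ 2
    else if S = {1, 2} then w $ 3 else b)"

lemma parts_form_of_parts:
  "part0 (form_of_parts a v w b) = a" "part1 (form_of_parts a v w b) = v"
  "part2 (form_of_parts a v w b) = w" "part3 (form_of_parts a v w b) = b"
proof -
  have ne: "({2, 3} :: 3 set) \<noteq> {1}" "({1, 3} :: 3 set) \<noteq> {1}" "({1, 2} :: 3 set) \<noteq> {1}"
    "({2, 3} :: 3 set) \<noteq> {2}" "({1, 3} :: 3 set) \<noteq> {2}" "({1, 2} :: 3 set) \<noteq> {2}"
    "({2, 3} :: 3 set) \<noteq> {3}" "({1, 3} :: 3 set) \<noteq> {3}" "({1, 2} :: 3 set) \<noteq> {3}"
    "({1, 3} :: 3 set) \<noteq> {2, 3}" "({1, 2} :: 3 set) \<noteq> {2, 3}" "({1, 2} :: 3 set) \<noteq> {1, 3}"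
    "({1, 2, 3} :: 3 set) \<noteq> {1}" "({1, 2, 3} :: 3 set) \<noteq> {2}" "({1, 2, 3} :: 3 set) \<noteq> {3}"
    "({1, 2, 3} :: 3 set) \<noteq> {2, 3}" "({1, 2, 3} :: 3 set) \<noteq> {1, 3}" "({1, 2, 3} :: 3 set) \<noteq> {1, 2}"
    by (simp_all add: set_eq_iff forall_3)
  show "part0 (form_of_parts a v w b) = a" "part1 (form_of_parts a v w b) = v"
    "part2 (form_of_parts a v w b) = w" "part3 (form_of_parts a v w b) = b"
    by (simp_all add: part0_def part1_def part2_def part3_def form_of_parts_def ne vec_eq_iff forall_3)
qed

lemma homogeneous_form_iff:
  "homogeneous_form p \<alpha> \<longleftrightarrow> (p \<noteq> 0 \<longrightarrow> part0 \<alpha> = 0) \<and> (p \<noteq> 1 \<longrightarrow> part1 \<alpha> = 0)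
    \<and> (p \<noteq> 2 \<longrightarrow> part2 \<alpha> = 0) \<and> (p \<noteq> 3 \<longrightarrow> part3 \<alpha> = 0)"
proof -
  have all: "(\<forall>S :: 3 set. P S) \<longleftrightarrow> P {} \<and> P {1} \<and> P {2} \<and> P {3} \<and> P {2, 3} \<and> P {1, 3} \<and> P {1, 2} \<and> P {1, 2, 3}" for P
    using subsets_3 by metis
  have card: "card ({2, 3} :: 3 set) = 2" "card ({1, 3} :: 3 set) = 2" "card ({1, 2} :: 3 set) = 2"
    "card ({1, 2, 3} :: 3 set) = 3"
    by simp_all
  show ?thesis
    unfolding homogeneous_form_def all card
    by (auto simp: part0_def part1_def part2_def part3_def vec_eq_iff forall_3)
qed

section \<open>Contraction\<close>

text \<open>
  The interior product with the vector field \<open>\<theta>\<close>. It is an antiderivation with respect to the grade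
  involution.
\<close>

definition contract :: "(3 ratfun) ^ 3 \<Rightarrow> 3 form \<Rightarrow> 3 form" where
  "contract \<theta> \<alpha> = form_of_parts (dot3 (part1 \<alpha>) \<theta>) (vprod (part2 \<alpha>) \<theta>) (part3 \<alpha> *s \<theta>) 0"

definition grade_involution :: "3 form \<Rightarrow> 3 form" where
  "grade_involution \<alpha> = form_of_parts (part0 \<alpha>) (- part1 \<alpha>) (part2 \<alpha>) (- part3 \<alpha>)"

lemma parts_contract:
  "part0 (contract \<theta> \<alpha>) = dot3 (part1 \<alpha>) \<theta>" "part1 (contract \<theta> \<alpha>) = vprod (part2 \<alpha>) \<theta>"
  "part2 (contract \<theta> \<alpha>) = part3 \<alpha> *s \<theta>" "part3 (contract \<theta> \<alpha>) = 0"
  by (simp_all add: contract_def parts_form_of_parts)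

lemma parts_grade_involution:
  "part0 (grade_involution \<alpha>) = part0 \<alpha>" "part1 (grade_involution \<alpha>) = - part1 \<alpha>"
  "part2 (grade_involution \<alpha>) = part2 \<alpha>" "part3 (grade_involution \<alpha>) = - part3 \<alpha>"
  by (simp_all add: grade_involution_def parts_form_of_parts)

lemma contract_wedge:
  "contract \<theta> (\<alpha> \<and>\<^sub>f \<beta>) = contract \<theta> \<alpha> \<and>\<^sub>f \<beta> + grade_involution \<alpha> \<and>\<^sub>f contract \<theta> \<beta>"
  by (rule form_eqI)
    (simp_all add: parts_add parts_contract parts_wedge parts_grade_involution dot3_def vec_eq_iff forall_3
      vprod_nth algebra_simps)

lemma contract_linear:
  "contract \<theta> (\<alpha> + \<beta>) = contract \<theta> \<alpha> + contract \<theta> \<beta>" "contract \<theta> (c *s \<alpha>) = c *s contract \<theta> \<alpha>"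
  by (rule form_eqI; simp add: parts_add parts_scale parts_contract dot3_def vec_eq_iff forall_3
      vprod_nth algebra_simps)+

lemma grade_involution_algebra:
  "grade_involution (\<alpha> + \<beta>) = grade_involution \<alpha> + grade_involution \<beta>"
  "grade_involution (c *s \<alpha>) = c *s grade_involution \<alpha>"
  "grade_involution (\<alpha> \<and>\<^sub>f \<beta>) = grade_involution \<alpha> \<and>\<^sub>f grade_involution \<beta>"
  by (rule form_eqI; simp add: parts_add parts_scale parts_wedge parts_grade_involution dot3_def vec_eq_iff
      forall_3 vprod_nth algebra_simps)+

lemma parts_one_form: "part0 one_form = 1" "part1 one_form = 0" "part2 one_form = 0" "part3 one_form = 0"
  by (auto simp: one_form_def axis_def part0_def part1_def part2_def part3_def vec_eq_iff forall_3)

lemma wedge_one_form: "(\<alpha> :: 3 form) \<and>\<^sub>f (c *s one_form) = c *s \<alpha>"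
  by (rule form_eqI) (simp_all add: parts_wedge parts_scale parts_one_form vec_eq_iff forall_3 dot3_def vprod_nth)

lemma dlog_linear_nth:
  "dlog_linear a $ S = (\<Sum>j\<in>UNIV. if S = {j} then to_fract (const_poly (a $ j)) else 0) / to_fract (linear_form a)"
  by (simp add: dlog_linear_def d_linear_def dvar_def axis_def sum_divide_distrib if_distrib cong: if_cong)

lemma parts_dlog_linear:
  "part0 (dlog_linear a) = 0"
  "part1 (dlog_linear a) = (\<chi> k. to_fract (const_poly (a $ k)) / to_fract (linear_form a))"
  "part2 (dlog_linear a) = 0" "part3 (dlog_linear a) = 0"
proof -
  show "part0 (dlog_linear a) = 0"
    by (simp add: part0_def dlog_linear_nth)
  show "part1 (dlog_linear a) = (\<chi> k. to_fract (const_poly (a $ k)) / to_fract (linear_form a))"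
    by (simp add: part1_def dlog_linear_nth vec_eq_iff)
  have ne: "(j = 2 \<and> j = 3) = False" "(j = 1 \<and> j = 3) = False" "(j = 1 \<and> j = 2) = False"
    "(j = 1 \<and> j = 2 \<and> j = 3) = False" for j :: 3
    by auto
  show "part2 (dlog_linear a) = 0" "part3 (dlog_linear a) = 0"
    by (simp_all add: part2_def part3_def dlog_linear_nth ne vec_eq_iff forall_3)
qed

lemma parts_omega:
  "part0 (omega n f lam) = 0" "part2 (omega n f lam) = 0" "part3 (omega n f lam) = 0"
  "part1 (omega n f lam) = (\<Sum>i<n. to_fract (const_poly (lam i)) *s part1 (dlog_linear (f i)))"
  by (simp_all add: omega_def parts_sum parts_scale parts_dlog_linear)

section \<open>Cohomology classes\<close>

lemma wedge_bilinear:
  fixes \<alpha> \<beta> \<gamma> :: "3 form"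
  shows "\<alpha> \<and>\<^sub>f (\<beta> + \<gamma>) = \<alpha> \<and>\<^sub>f \<beta> + \<alpha> \<and>\<^sub>f \<gamma>" "\<alpha> \<and>\<^sub>f (c *s \<beta>) = c *s (\<alpha> \<and>\<^sub>f \<beta>)" "(c *s \<alpha>) \<and>\<^sub>f \<beta> = c *s (\<alpha> \<and>\<^sub>f \<beta>)"
  by (rule form_eqI; simp add: parts_add parts_scale parts_wedge dot3_def vec_eq_iff forall_3 vprod_nth algebra_simps)+

lemma one_form_wedge: "one_form \<and>\<^sub>f (\<alpha> :: 3 form) = \<alpha>"
  by (rule form_eqI) (simp_all add: parts_wedge parts_one_form vec_eq_iff forall_3 dot3_def vprod_nth)

lemma OS_zero: "(0 :: 3 form) \<in> OS_algebra n f"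
  using OS_scale[OF OS_one, of 0 n f] by simp

lemma OS_graded_add: "\<alpha> \<in> OS_graded n f p \<Longrightarrow> \<beta> \<in> OS_graded n f p \<Longrightarrow> (\<alpha> + \<beta> :: 3 form) \<in> OS_graded n f p"
  by (auto simp: OS_graded_def OS_add homogeneous_form_iff parts_add)

lemma OS_graded_scale: "\<alpha> \<in> OS_graded n f p \<Longrightarrow> to_fract (const_poly c) *s (\<alpha> :: 3 form) \<in> OS_graded n f p"
  by (auto simp: OS_graded_def OS_scale homogeneous_form_iff parts_scale)

lemma OS_graded_zero: "(0 :: 3 form) \<in> OS_graded n f p"
  by (simp add: OS_graded_def OS_zero homogeneous_form_iff parts_zero)

lemma parts_uminus:
  "part0 (- \<alpha>) = - part0 \<alpha>" "part1 (- \<alpha>) = - part1 \<alpha>"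
  "part2 (- \<alpha>) = - part2 \<alpha>" "part3 (- \<alpha>) = - part3 \<alpha>"
  by (auto simp: part0_def part1_def part2_def part3_def vec_eq_iff forall_3)

lemma neg_eq_scale: "- \<alpha> = to_fract (const_poly (- 1)) *s (\<alpha> :: 3 form)"
  by (simp add: vec_eq_iff const_poly_uminus)

lemma coboundaries_diff:
  fixes f :: "nat \<Rightarrow> complex ^ 3"
  assumes "\<alpha> \<in> OS_coboundaries n f lam p" "\<beta> \<in> OS_coboundaries n f lam p"
  shows "\<alpha> - \<beta> \<in> OS_coboundaries n f lam p"
proof (cases p)
  case 0 then show ?thesis using assms by (simp add: OS_coboundaries_def)
next
  case (Suc q)
  obtain a b where ab: "\<alpha> = omega n f lam \<and>\<^sub>f a" "a \<in> OS_graded n f q" "\<beta> = omega n f lam \<and>\<^sub>f b" "b \<in> OS_graded n f q"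
    using assms by (auto simp: OS_coboundaries_def Suc)
  have "\<alpha> - \<beta> = \<alpha> + to_fract (const_poly (- 1)) *s \<beta>"
    unfolding neg_eq_scale[symmetric] by simp
  also have "\<dots> = omega n f lam \<and>\<^sub>f (a + to_fract (const_poly (- 1)) *s b)"
    unfolding ab wedge_bilinear ..
  finally show ?thesis
    using OS_graded_add[OF ab(2) OS_graded_scale[OF ab(4)]] unfolding OS_coboundaries_def Suc by auto
qed

lemma coboundaries_zero: 
  fixes f :: "nat \<Rightarrow> complex ^ 3"
  shows "0 \<in> OS_coboundaries n f lam p"
proof (cases p)
  case 0 then show ?thesis by (simp add: OS_coboundaries_def)
next
  case (Suc q)
  have "omega n f lam \<and>\<^sub>f 0 = 0"
    by (rule form_eqI) (simp_all add: parts_wedge parts_zero dot3_def vec_eq_iff forall_3 vprod_nth)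
  then show ?thesis using OS_graded_zero[of n f q] unfolding OS_coboundaries_def Suc
    by (auto intro: image_eqI[of _ _ 0])
qed

lemma coboundaries_add:
  fixes f :: "nat \<Rightarrow> complex ^ 3"
  assumes "\<alpha> \<in> OS_coboundaries n f lam p" "\<beta> \<in> OS_coboundaries n f lam p"
  shows "\<alpha> + \<beta> \<in> OS_coboundaries n f lam p"
  using coboundaries_diff[OF assms(1) coboundaries_diff[OF coboundaries_zero assms(2)]] by simp

lemma nontrivial_class:
  fixes f :: "nat \<Rightarrow> complex ^ 3"
  assumes "carrier (OS_cohomology n f lam p) \<noteq> {\<one>\<^bsub>OS_cohomology n f lam p\<^esub>}"
  obtains \<alpha> where "\<alpha> \<in> OS_cocycles n f lam p" "\<alpha> \<notin> OS_coboundaries n f lam p"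
proof (rule ccontr)
  let ?Z = "OS_cocycles n f lam p" and ?B = "OS_coboundaries n f lam p"
  assume "\<not> thesis"
  then have sub: "?Z \<subseteq> ?B" using that by blast
  have coset: "(\<Union>h\<in>?B. {h + a}) = ?B" if "a \<in> ?Z" for a
  proof (intro equalityI subsetI)
    fix x assume "x \<in> (\<Union>h\<in>?B. {h + a})"
    then show "x \<in> ?B" using coboundaries_add that sub by blast
  next
    fix x assume "x \<in> ?B"
    then have "x - a \<in> ?B" using coboundaries_diff that sub by blast
    moreover have "x = (x - a) + a" by simp
    ultimately show "x \<in> (\<Union>h\<in>?B. {h + a})" by blast
  qed
  have "omega n f lam \<and>\<^sub>f 0 = 0"
    by (rule form_eqI) (simp_all add: parts_wedge parts_zero dot3_def vec_eq_iff forall_3 vprod_nth)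
  then have "0 \<in> ?Z" by (simp add: OS_cocycles_def OS_graded_zero)
  then have "(\<Union>a\<in>?Z. {\<Union>h\<in>?B. {h + a}}) = {?B}" using coset by auto
  then show False
    using assms by (simp add: OS_cohomology_def FactGroup_def RCOSETS_def r_coset_def)
qed

context arrangement
begin

lemma part1_omega:
  "to_fract Q *s part1 (omega n f lam) = (\<chi> k. to_fract (omega_poly lam $ k))"
proof -
  have "to_fract Q * (to_fract (const_poly (lam i)) * (to_fract (const_poly (f i $ k)) / to_fract (L i)))
    = to_fract (const_poly (lam i) * cofactor i * const_poly (f i $ k))" if "i < n" for i k
    using L_nonzero[OF that] unfolding Q_eq[OF that] by (simp add: field_simps)
  then have "(\<Sum>i<n. to_fract Q * (to_fract (const_poly (lam i)) * (to_fract (const_poly (f i $ k)) / to_fract (L i))))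
    = (\<Sum>i<n. to_fract (const_poly (lam i) * cofactor i * const_poly (f i $ k)))" for k
    by (intro sum.cong) (simp_all only: lessThan_iff)
  then show ?thesis
    unfolding vec_eq_iff parts_omega(4) parts_dlog_linear(2)
    by (simp only: omega_poly_nth to_fract_sum vector_smult_component sum_component vec_lambda_beta sum_distrib_left) simp
qed

section \<open>Contraction as a homotopy\<close>

text \<open>
  A linear vector field \<open>\<theta>\<close> with \<open>\<theta>(f i) = \<gamma> i * f i\<close> contracts every \<open>dlog\<close> to a constant, so it
  maps the Orlik--Solomon algebra into itself.
\<close>

lemma contract_OS:
  assumes dl: "\<And>i. i < n \<Longrightarrow> contract \<theta> (dlog_linear (f i)) = to_fract (const_poly (\<gamma> i)) *s one_form"
    and "\<alpha> \<in> OS_algebra n f"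
  shows "contract \<theta> \<alpha> \<in> OS_algebra n f \<and> grade_involution \<alpha> \<in> OS_algebra n f"
  using assms(2)
proof (induction rule: OS_algebra.induct)
  case OS_one
  have "contract \<theta> one_form = 0" "grade_involution one_form = one_form"
    by (rule form_eqI; simp add: parts_contract parts_grade_involution parts_one_form parts_zero dot3_def
        vec_eq_iff forall_3 vprod_nth)+
  then show ?case by (simp add: OS_zero OS_algebra.OS_one)
next
  case (OS_gen i)
  have "grade_involution (dlog_linear (f i)) = to_fract (const_poly (- 1)) *s dlog_linear (f i)"
    by (rule form_eqI; simp add: parts_grade_involution parts_uminus parts_dlog_linear const_poly_uminus vec_eq_iff)
  then show ?case
    unfolding dl[OF OS_gen] using OS_gen by (auto intro: OS_algebra.intros)
next
  case (OS_add \<alpha> \<beta>)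
  then show ?case unfolding contract_linear grade_involution_algebra by (blast intro: OS_algebra.OS_add)
next
  case (OS_scale \<alpha> c)
  then show ?case unfolding contract_linear grade_involution_algebra by (blast intro: OS_algebra.OS_scale)
next
  case (OS_wedge \<alpha> \<beta>)
  then show ?case unfolding contract_wedge grade_involution_algebra
    by (blast intro: OS_algebra.OS_wedge OS_algebra.OS_add)
qed

lemma contract_omega:
  assumes dl: "\<And>i. i < n \<Longrightarrow> contract \<theta> (dlog_linear (f i)) = to_fract (const_poly (\<gamma> i)) *s one_form"
  shows "contract \<theta> (omega n f lam) = to_fract (const_poly (\<Sum>i<n. lam i * \<gamma> i)) *s one_form"
proof (rule form_eqI)
  have "dot3 (part1 (dlog_linear (f i))) \<theta> = to_fract (const_poly (\<gamma> i))" if "i < n" for i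
    using arg_cong[OF dl[OF that], of part0] by (simp add: parts_contract parts_scale parts_one_form)
  then have "(\<Sum>i<n. to_fract (const_poly (lam i)) * dot3 (part1 (dlog_linear (f i))) \<theta>)
      = (\<Sum>i<n. to_fract (const_poly (lam i * \<gamma> i)))"
    by (intro sum.cong) (simp_all add: const_poly_mult)
  then show "part0 (contract \<theta> (omega n f lam)) = part0 (to_fract (const_poly (\<Sum>i<n. lam i * \<gamma> i)) *s one_form)"
    by (simp add: parts_contract parts_omega(4) parts_scale parts_one_form dot3_sum_left dot3_scale const_poly_sum)
qed (simp_all add: parts_contract parts_omega(1-3) parts_scale parts_one_form vec_eq_iff forall_3 vprod_nth)

text \<open>
  Contraction by \<open>\<theta>\<close> is a homotopy between zero and multiplication by the constant
  \<open>\<langle>\<theta>, \<omega>\<rangle> = \<Sum>i. lam i * \<gamma> i\<close>, so a cocycle is the coboundary of its contraction divided by this constant.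
\<close>

lemma exact_if_contraction:
  assumes dl: "\<And>i. i < n \<Longrightarrow> contract \<theta> (dlog_linear (f i)) = to_fract (const_poly (\<gamma> i)) *s one_form"
    and nz: "(\<Sum>i<n. lam i * \<gamma> i) \<noteq> 0" and z: "\<alpha> \<in> OS_cocycles n f lam p"
  shows "\<alpha> \<in> OS_coboundaries n f lam p"
proof -
  let ?\<omega> = "omega n f lam"
  define \<Gamma> where "\<Gamma> = (\<Sum>i<n. lam i * \<gamma> i)"
  define c where "c = to_fract (const_poly (inverse \<Gamma>) :: 3 mpoly)"
  have c: "c * to_fract (const_poly \<Gamma>) = 1"
    using nz unfolding c_def to_fract_mult[symmetric] const_poly_mult[symmetric] \<Gamma>_def by simp
  have \<alpha>: "\<alpha> \<in> OS_algebra n f" "homogeneous_form p \<alpha>" "?\<omega> \<and>\<^sub>f \<alpha> = 0"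
    using z by (simp_all add: OS_cocycles_def OS_graded_def)
  have c\<omega>: "contract \<theta> ?\<omega> = to_fract (const_poly \<Gamma>) *s one_form"
    unfolding \<Gamma>_def by (rule contract_omega) (rule dl)
  have inv: "grade_involution ?\<omega> = (- 1) *s ?\<omega>"
    by (rule form_eqI) (simp_all add: parts_grade_involution parts_uminus parts_omega(1-3) vec_eq_iff)
  have "contract \<theta> 0 = 0"
    by (rule form_eqI) (simp_all add: parts_contract parts_zero dot3_def vec_eq_iff forall_3 vprod_nth)
  then have "0 = contract \<theta> (?\<omega> \<and>\<^sub>f \<alpha>)" unfolding \<alpha>(3) by simp
  also have "\<dots> = to_fract (const_poly \<Gamma>) *s \<alpha> - ?\<omega> \<and>\<^sub>f contract \<theta> \<alpha>"
    unfolding contract_wedge c\<omega> inv wedge_bilinear one_form_wedge by simp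
  finally have main: "?\<omega> \<and>\<^sub>f contract \<theta> \<alpha> = to_fract (const_poly \<Gamma>) *s \<alpha>" by simp
  have "?\<omega> \<and>\<^sub>f (c *s contract \<theta> \<alpha>) = \<alpha>"
    unfolding wedge_bilinear main vector_smult_assoc c by simp
  moreover have OS: "c *s contract \<theta> \<alpha> \<in> OS_algebra n f"
    unfolding c_def using contract_OS[OF dl \<alpha>(1)] by (blast intro: OS_algebra.OS_scale)
  moreover have "homogeneous_form (p - 1) (c *s contract \<theta> \<alpha>)" if "p \<noteq> 0"
    using \<alpha>(2) that unfolding homogeneous_form_iff parts_scale parts_contract
    by (auto simp: dot3_def vec_eq_iff forall_3 vprod_nth)
  ultimately show ?thesis
  proof (cases p)
    case 0
    have "contract \<theta> \<alpha> = 0"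
      using \<alpha>(2) unfolding 0 homogeneous_form_iff
      by (intro form_eqI) (simp_all add: parts_contract parts_zero dot3_def vec_eq_iff forall_3 vprod_nth)
    then have "to_fract (const_poly \<Gamma>) *s \<alpha> = ?\<omega> \<and>\<^sub>f 0" using main by simp
    also have "\<dots> = 0"
      by (rule form_eqI) (simp_all add: parts_wedge parts_zero dot3_def vec_eq_iff forall_3 vprod_nth)
    finally have "c *s (to_fract (const_poly \<Gamma>) *s \<alpha>) = 0" by simp
    then have "\<alpha> = 0" unfolding vector_smult_assoc c by simp
    then show ?thesis by (simp add: 0 OS_coboundaries_def)
  next
    case (Suc q)
    have "c *s contract \<theta> \<alpha> \<in> OS_graded n f q"
      using OS \<open>p \<noteq> 0 \<Longrightarrow> homogeneous_form (p - 1) (c *s contract \<theta> \<alpha>)\<close> Suc by (simp add: OS_graded_def)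
    then show ?thesis
      unfolding OS_coboundaries_def Suc using \<open>?\<omega> \<and>\<^sub>f (c *s contract \<theta> \<alpha>) = \<alpha>\<close> by (auto intro: image_eqI[OF sym])
  qed
qed

text \<open>
  The field \<open>w\<close> is the linear part of \<open>v\<close> at the origin. Differentiating \<open>f i \<bullet> v = c i * L i\<close> at the
  origin gives \<open>f i \<bullet> w = c i(0) * L i\<close>, because \<open>L i\<close> vanishes there.
\<close>

lemma linear_part:
  assumes v: "log_field v c"
  obtains w where "log_field w (\<lambda>i. const_poly (eval_poly (c i) 0))"
proof -
  define D where "D k = vector_derivation (axis k 1 :: (3 mpoly) ^ 3)" for k
  have der: "derivation (D k)" for k unfolding D_def by (rule derivation_vector_derivation)
  define m where "m j k = eval_poly (D k (v $ j)) 0" for j k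
  have rel: "(\<Sum>j\<in>UNIV. f i $ j * m j k) = eval_poly (c i) 0 * f i $ k" if i: "i < n" for i k
  proof -
    have Dl: "D k (a + b) = D k a + D k b" "D k (const_poly e * a) = const_poly e * D k a"
       "D k (a * b) = D k a * b + a * D k b" for a b e
      using der[of k] unfolding derivation_def by blast+
    have DL: "D k (L i) = const_poly (f i $ k)"
      unfolding derivation_linear_form[OF der] by (simp add: D_def vector_derivation_var axis_def if_distrib cong: if_cong)
    have "D k (dot3 (const_vec (f i)) v) = D k (c i * L i)" using v i by (simp add: log_field_def)
    then have "dot3 (const_vec (f i)) (\<chi> j. D k (v $ j)) = D k (c i) * L i + c i * const_poly (f i $ k)"
      unfolding Dl(3)[of "c i"] DL unfolding dot3_def const_vec_nth Dl(1,2) by simp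
    from arg_cong[OF this, of "\<lambda>q. eval_poly q 0"]
    show ?thesis by (simp add: dot3_def m_def sum_3)
  qed
  define w where "w = (\<chi> j. linear_form (\<chi> k. m j k))"
  have "log_field w (\<lambda>i. const_poly (eval_poly (c i) 0))"
    unfolding log_field_def
  proof (intro allI impI eval_poly_eqI)
    fix i and x :: "complex ^ 3" assume i: "i < n"
    have "eval_poly (dot3 (const_vec (f i)) w) x = (\<Sum>j\<in>UNIV. f i $ j * (\<Sum>k\<in>UNIV. m j k * x $ k))"
      by (simp add: dot3_def w_def sum_3)
    also have "\<dots> = (\<Sum>j\<in>UNIV. \<Sum>k\<in>UNIV. f i $ j * m j k * x $ k)"
      by (simp add: sum_distrib_left mult.assoc)
    also have "\<dots> = (\<Sum>k\<in>UNIV. \<Sum>j\<in>UNIV. f i $ j * m j k * x $ k)" by (rule sum.swap)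
    also have "\<dots> = (\<Sum>k\<in>UNIV. (eval_poly (c i) 0 * f i $ k) * x $ k)"
      by (simp add: sum_distrib_right[symmetric] rel[OF i])
    finally show "eval_poly (dot3 (const_vec (f i)) w) x = eval_poly (const_poly (eval_poly (c i) 0) * L i) x"
      by (simp add: sum_distrib_left mult.assoc)
  qed
  then show ?thesis by (rule that)
qed

theorem origin_in_Sigma_bar:
  assumes z: "\<alpha> \<in> OS_cocycles n f lam p" and nb: "\<alpha> \<notin> OS_coboundaries n f lam p"
  shows "0 \<in> Sigma_bar n f lam"
proof (rule ccontr)
  assume "0 \<notin> Sigma_bar n f lam"
  then obtain u where u: "u \<in> crit lam" "eval_poly u 0 \<noteq> 0" by (auto simp: Sigma_bar_eq)
  obtain v c where v: "log_field v c" "u = (\<Sum>i<n. const_poly (lam i) * c i)" using u(1) by (rule critE)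
  define \<gamma> where "\<gamma> i = eval_poly (c i) 0" for i
  obtain w where w: "log_field w (\<lambda>i. const_poly (\<gamma> i))" unfolding \<gamma>_def using linear_part[OF v(1)] .
  define \<theta> where "\<theta> = (\<chi> k. to_fract (w $ k))"
  have "contract \<theta> (dlog_linear (f i)) = to_fract (const_poly (\<gamma> i)) *s one_form" if i: "i < n" for i
  proof (rule form_eqI)
    have "dot3 (part1 (dlog_linear (f i))) \<theta> = to_fract (dot3 (const_vec (f i)) w) / to_fract (L i)"
      by (simp add: parts_dlog_linear dot3_def \<theta>_def add_divide_distrib)
    also have "dot3 (const_vec (f i)) w = const_poly (\<gamma> i) * L i" using w i by (simp add: log_field_def)
    also have "to_fract (const_poly (\<gamma> i) * L i) / to_fract (L i) = to_fract (const_poly (\<gamma> i))"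
      using L_nonzero[OF i] by simp
    finally show "part0 (contract \<theta> (dlog_linear (f i))) = part0 (to_fract (const_poly (\<gamma> i)) *s one_form)"
      by (simp add: parts_contract parts_scale parts_one_form)
  qed (simp_all add: parts_contract parts_dlog_linear(3,4) parts_scale parts_one_form vec_eq_iff forall_3 vprod_nth)
  moreover have "(\<Sum>i<n. lam i * \<gamma> i) \<noteq> 0" using u(2) unfolding v(2) by (simp add: \<gamma>_def)
  ultimately show False using exact_if_contraction z nb by blast
qed

section \<open>Classes in degrees zero and one\<close>

text \<open>
  Elements of degree at most one are constants plus combinations of the generators: the parts of degree
  zero and one of a product only involve parts of degree zero and one of the factors.
\<close>

lemma OS_low_parts:
  assumes "\<alpha> \<in> OS_algebra n f"
  shows "\<exists>c \<mu>. part0 \<alpha> = to_fract (const_poly c) \<and> part1 \<alpha> = part1 (omega n f \<mu>)"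
  using assms
proof (induction rule: OS_algebra.induct)
  case OS_one
  have "part0 one_form = to_fract (const_poly 1) \<and> part1 one_form = part1 (omega n f (\<lambda>_. 0))"
    by (simp add: parts_one_form parts_omega(4))
  then show ?case by blast
next
  case (OS_gen i)
  have "part1 (omega n f (\<lambda>j. if j = i then 1 else 0)) = (\<Sum>j<n. if j = i then part1 (dlog_linear (f j)) else 0)"
    unfolding parts_omega(4) by (rule sum.cong) auto
  also have "\<dots> = part1 (dlog_linear (f i))" using OS_gen by simp
  finally have "part0 (dlog_linear (f i)) = to_fract (const_poly 0) \<and>
     part1 (dlog_linear (f i)) = part1 (omega n f (\<lambda>j. if j = i then 1 else 0))"
    by (simp add: parts_dlog_linear(1))
  then show ?case by blast
next
  case (OS_add \<alpha> \<beta>)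
  then obtain c \<mu> d \<nu> where "part0 \<alpha> = to_fract (const_poly c)" "part1 \<alpha> = part1 (omega n f \<mu>)"
    "part0 \<beta> = to_fract (const_poly d)" "part1 \<beta> = part1 (omega n f \<nu>)" by blast
  then have "part0 (\<alpha> + \<beta>) = to_fract (const_poly (c + d)) \<and> part1 (\<alpha> + \<beta>) = part1 (omega n f (\<lambda>i. \<mu> i + \<nu> i))"
    by (simp add: parts_add const_poly_add parts_omega(4) vector_sadd_rdistrib sum.distrib)
  then show ?case by blast
next
  case (OS_scale \<alpha> e)
  then obtain c \<mu> where "part0 \<alpha> = to_fract (const_poly c)" "part1 \<alpha> = part1 (omega n f \<mu>)" by blast
  then have "part0 (to_fract (const_poly e) *s \<alpha>) = to_fract (const_poly (e * c)) \<and>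
      part1 (to_fract (const_poly e) *s \<alpha>) = part1 (omega n f (\<lambda>i. e * \<mu> i))"
    by (simp add: parts_scale const_poly_mult parts_omega(4) vec.scale_sum_right vector_smult_assoc)
  then show ?case by blast
next
  case (OS_wedge \<alpha> \<beta>)
  then obtain c \<mu> d \<nu> where "part0 \<alpha> = to_fract (const_poly c)" "part1 \<alpha> = part1 (omega n f \<mu>)"
    "part0 \<beta> = to_fract (const_poly d)" "part1 \<beta> = part1 (omega n f \<nu>)" by blast
  then have "part0 (\<alpha> \<and>\<^sub>f \<beta>) = to_fract (const_poly (c * d)) \<and>
      part1 (\<alpha> \<and>\<^sub>f \<beta>) = part1 (omega n f (\<lambda>i. c * \<nu> i + d * \<mu> i))"
    by (simp add: parts_wedge const_poly_mult const_poly_add parts_omega(4) vec.scale_sum_right vector_smult_assoc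
        vector_sadd_rdistrib sum.distrib)
  then show ?case by blast
qed

lemma omega_poly_zero_if_cohomology_0:
  assumes z: "\<alpha> \<in> OS_cocycles n f lam 0" and nb: "\<alpha> \<notin> OS_coboundaries n f lam 0"
  shows "omega_poly lam = 0"
proof -
  have h: "homogeneous_form 0 \<alpha>" "omega n f lam \<and>\<^sub>f \<alpha> = 0" and nz: "\<alpha> \<noteq> 0"
    using z nb by (simp_all add: OS_cocycles_def OS_graded_def OS_coboundaries_def)
  have p0: "part0 \<alpha> \<noteq> 0"
  proof
    assume "part0 \<alpha> = 0"
    then have "\<alpha> = 0" using h(1) unfolding homogeneous_form_iff
      by (intro form_eqI) (simp_all add: parts_zero)
    then show False using nz by simp
  qed
  have "part0 \<alpha> *s part1 (omega n f lam) = 0"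
    using arg_cong[OF h(2), of part1] by (simp add: parts_wedge parts_omega(1) parts_zero)
  then have "part1 (omega n f lam) = 0" using p0 by (simp add: vector_mul_eq_0)
  then have "to_fract (omega_poly lam $ k) = 0" for k
    using arg_cong[OF part1_omega[of lam], of "\<lambda>v. v $ k"] by simp
  then show ?thesis by (simp add: vec_eq_iff)
qed

text \<open>
  A cocycle of degree one is the logarithmic form of some weights \<open>\<mu>\<close>. The coboundaries are the constant
  multiples of the form of \<open>lam\<close>.
\<close>

lemma parallel_if_cohomology_1:
  assumes z: "\<alpha> \<in> OS_cocycles n f lam 1" and nb: "\<alpha> \<notin> OS_coboundaries n f lam 1"
  obtains \<mu> where "vprod (omega_poly lam) (omega_poly \<mu>) = 0" "\<And>c. omega_poly \<mu> \<noteq> const_poly c *s omega_poly lam"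
proof -
  have h: "\<alpha> \<in> OS_algebra n f" "homogeneous_form 1 \<alpha>" "omega n f lam \<and>\<^sub>f \<alpha> = 0"
    using z by (simp_all add: OS_cocycles_def OS_graded_def)
  obtain \<mu> where mu: "part1 \<alpha> = part1 (omega n f \<mu>)" using OS_low_parts[OF h(1)] by blast
  let ?q = "to_fract Q"
  have q0: "?q \<noteq> 0" using Q_nonzero by simp
  have "vprod (part1 (omega n f lam)) (part1 (omega n f \<mu>)) = 0"
    using arg_cong[OF h(3), of part2] h(2) mu unfolding homogeneous_form_iff
    by (simp add: parts_wedge parts_omega(1-3) parts_zero)
  then have "vprod (?q *s part1 (omega n f lam)) (?q *s part1 (omega n f \<mu>)) = 0"
    unfolding vprod_scale by simp
  then have eq: "vprod (?q *s part1 (omega n f lam)) (?q *s part1 (omega n f \<mu>)) $ k = 0" for k by simp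
  have par: "vprod (omega_poly lam) (omega_poly \<mu>) = 0"
    using eq[of 1] eq[of 2] eq[of 3]
    unfolding part1_omega vprod_nth vec_lambda_beta to_fract_mult[symmetric] to_fract_diff[symmetric] to_fract_eq_0_iff
    by (intro vec3_eqI) (simp_all only: vprod_nth zero_index)
  have "omega_poly \<mu> \<noteq> const_poly c *s omega_poly lam" for c
  proof
    assume eq: "omega_poly \<mu> = const_poly c *s omega_poly lam"
    have "?q *s part1 (omega n f \<mu>) = ?q *s (to_fract (const_poly c) *s part1 (omega n f lam))"
    proof -
      have "?q *s part1 (omega n f \<mu>) = to_fract (const_poly c) *s (?q *s part1 (omega n f lam))"
        unfolding part1_omega eq by (simp add: vec_eq_iff)
      then show ?thesis by (simp add: vector_smult_assoc mult.commute)
    qed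
    then have "part1 (omega n f \<mu>) = to_fract (const_poly c) *s part1 (omega n f lam)"
      using q0 vector_mul_lcancel by blast
    then have "\<alpha> = omega n f lam \<and>\<^sub>f (to_fract (const_poly c) *s one_form)"
      unfolding wedge_one_form using h(2) mu unfolding homogeneous_form_iff
      by (intro form_eqI) (simp_all add: parts_scale parts_omega(1-3))
    moreover have "to_fract (const_poly c) *s one_form \<in> OS_graded n f 0"
      unfolding OS_graded_def homogeneous_form_iff
      by (simp add: OS_algebra.intros parts_scale parts_one_form)
    ultimately show False using nb by (auto simp: OS_coboundaries_def)
  qed
  then show ?thesis using par that by blast
qed

end

section \<open>A divisorial component\<close>

context arrangement
begin

lemma dilate_omega_poly: "dilate t (omega_poly lam $ k) = const_poly (t ^ (n - 1)) * omega_poly lam $ k"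
proof -
  have pw: "const_poly c ^ m = (const_poly (c ^ m) :: 3 mpoly)" for c m
    by (induction m) (simp_all add: const_poly_mult)
  have "dilate t (cofactor i) = const_poly (t ^ (n - 1)) * cofactor i" if "i < n" for i
    using that by (simp add: cofactor_def dilate_linear_form prod.distrib pw)
  then have "(\<Sum>i<n. const_poly (lam i) * dilate t (cofactor i) * const_poly (f i $ k))
      = (\<Sum>i<n. const_poly (t ^ (n - 1)) * (const_poly (lam i) * cofactor i * const_poly (f i $ k)))"
    by (intro sum.cong) (simp_all add: mult_ac)
  then show ?thesis unfolding omega_poly_nth by (simp add: sum_distrib_left)
qed

text \<open>
  Write the vectors of the two parallel forms as \<open>V = (p / r) W\<close> in lowest terms. Pairing with a logarithmic
  field gives \<open>r u' = p u\<close> for the two values, so \<open>r\<close> divides \<open>u\<close>. Both vectors are homogeneous of degree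
  \<open>n - 1\<close>, so dilating \<open>p / r\<close> does not change it and \<open>r\<close> divides its dilations. If \<open>r\<close> were a unit,
  \<open>p / r\<close> would be a dilation invariant polynomial, hence a constant.
\<close>

lemma common_factor:
  assumes par: "vprod (omega_poly lam) (omega_poly \<mu>) = 0"
    and ne: "\<And>c. omega_poly \<mu> \<noteq> const_poly c *s omega_poly lam"
    and W0: "omega_poly lam \<noteq> 0"
  obtains r where "r \<noteq> 0" "\<not> r dvd 1" "\<And>u. u \<in> crit lam \<Longrightarrow> r dvd u" "\<And>t. t \<noteq> 0 \<Longrightarrow> r dvd dilate t r"
proof -
  let ?W = "omega_poly lam" and ?V = "omega_poly \<mu>"
  obtain m where m: "?W $ m \<noteq> 0" using W0 by (auto simp: vec_eq_iff)
  obtain g p r where g: "g \<noteq> 0" "?V $ m = g * p" "?W $ m = g * r" and cop: "\<And>u. r dvd p * u \<Longrightarrow> r dvd u"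
    using coprime_fraction[OF m, of "?V $ m"] by blast
  have r0: "r \<noteq> 0" using m g(3) by auto
  have q: "?W $ 2 * ?V $ 3 = ?W $ 3 * ?V $ 2" "?W $ 3 * ?V $ 1 = ?W $ 1 * ?V $ 3"
     "?W $ 1 * ?V $ 2 = ?W $ 2 * ?V $ 1"
    using arg_cong[OF par, of "\<lambda>v. v $ 1"] arg_cong[OF par, of "\<lambda>v. v $ 2"] arg_cong[OF par, of "\<lambda>v. v $ 3"]
    unfolding vprod_nth zero_index right_minus_eq by this+
  have par': "?W $ k * ?V $ l = ?W $ l * ?V $ k" for k l
    using q exhaust_3[of k] exhaust_3[of l] by (elim disjE) (simp_all only:)
  have ratio: "p * ?W $ k = r * ?V $ k" for k
  proof -
    have "g * (p * ?W $ k) = g * (r * ?V $ k)" using par'[of k m] unfolding g by (simp only: mult_ac)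
    then show ?thesis using g(1) unfolding mult_cancel_left by blast
  qed
  have dvd_crit: "r dvd u" if "u \<in> crit lam" for u
  proof -
    obtain v c where v: "log_field v c" "u = (\<Sum>i<n. const_poly (lam i) * c i)" using \<open>u \<in> crit lam\<close> by (rule critE)
    define u' where "u' = (\<Sum>i<n. const_poly (\<mu> i) * c i)"
    have "p * dot3 ?W v = (p * ?W $ 1) * v $ 1 + (p * ?W $ 2) * v $ 2 + (p * ?W $ 3) * v $ 3"
      by (simp add: dot3_def algebra_simps)
    also have "\<dots> = r * dot3 ?V v" unfolding ratio by (simp add: dot3_def algebra_simps)
    finally have "p * (Q * u) = r * (Q * u')" unfolding dot3_omega_poly[OF v(1)] v(2) u'_def .
    then have "Q * (p * u) = Q * (r * u')" by (simp only: mult_ac)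
    then have "p * u = r * u'" using Q_nonzero unfolding mult_cancel_left by blast
    then have "r dvd p * u" ..
    then show "r dvd u" by (rule cop)
  qed
  have e0: "const_poly (t ^ (n - 1)) \<noteq> (0 :: 3 mpoly)" if "t \<noteq> 0" for t
  proof
    assume "const_poly (t ^ (n - 1)) = (0 :: 3 mpoly)"
    then have "eval_poly (const_poly (t ^ (n - 1)) :: 3 mpoly) 0 = 0" by simp
    then show False using that by simp
  qed
  have scaled: "dilate t p * ?W $ k = dilate t r * ?V $ k" if "t \<noteq> 0" for t k
  proof -
    have "dilate t (p * ?W $ k) = dilate t (r * ?V $ k)" unfolding ratio ..
    then have "const_poly (t ^ (n - 1)) * (dilate t p * ?W $ k) = const_poly (t ^ (n - 1)) * (dilate t r * ?V $ k)"
      unfolding dilate_algebra dilate_omega_poly by (simp only: mult_ac)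
    then show ?thesis using e0[OF that] unfolding mult_cancel_left by blast
  qed
  have homog: "r dvd dilate t r" if "t \<noteq> 0" for t
  proof (rule cop)
    have "g * (dilate t p * r) = g * (p * dilate t r)"
      using scaled[OF that, of m] unfolding g by (simp only: mult_ac)
    then have "dilate t p * r = p * dilate t r" using g(1) unfolding mult_cancel_left by blast
    then have "p * dilate t r = r * dilate t p" by (simp only: mult_ac)
    then show "r dvd p * dilate t r" ..
  qed
  have nonunit: "\<not> r dvd 1"
  proof
    assume "r dvd 1"
    then obtain r' where r': "1 = r * r'" ..
    define h where "h = r' * p"
    have V: "?V $ k = h * ?W $ k" for k
    proof -
      have "h * ?W $ k = r' * (r * ?V $ k)" unfolding h_def mult.assoc ratio ..
      also have "\<dots> = (r * r') * ?V $ k" by (simp only: mult_ac)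
      finally show ?thesis unfolding r'[symmetric] by simp
    qed
    have "dilate t h = h" if "t \<noteq> 0" for t
    proof -
      have "const_poly (t ^ (n - 1)) * (h * ?W $ m) = dilate t (?V $ m)"
        by (simp only: V[symmetric] dilate_omega_poly)
      also have "\<dots> = dilate t (h * ?W $ m)" by (simp only: V)
      also have "\<dots> = dilate t h * (const_poly (t ^ (n - 1)) * ?W $ m)"
        by (simp only: dilate_algebra dilate_omega_poly)
      finally have "(const_poly (t ^ (n - 1)) * ?W $ m) * dilate t h = (const_poly (t ^ (n - 1)) * ?W $ m) * h"
        by (simp only: mult_ac)
      moreover have "const_poly (t ^ (n - 1)) * ?W $ m \<noteq> 0" using e0[OF that] m mult_eq_0_iff by blast
      ultimately show ?thesis unfolding mult_cancel_left by blast
    qed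
    then have "h = const_poly (eval_poly h 0)" by (rule dilation_invariant_constant)
    then have "?V = const_poly (eval_poly h 0) *s ?W" using V by (simp add: vec_eq_iff)
    then show False using ne by blast
  qed
  show ?thesis by (rule that[OF r0 nonunit dvd_crit homog])
qed

end

section \<open>Irreducible closed sets and codimension\<close>

lemma zariski_irreducibleI:
  assumes "Z \<noteq> {}"
    and prod: "\<And>p q. (\<And>x. x \<in> Z \<Longrightarrow> eval_poly p x * eval_poly q x = 0) \<Longrightarrow>
      (\<forall>x\<in>Z. eval_poly p x = 0) \<or> (\<forall>x\<in>Z. eval_poly q x = 0)"
  shows "zariski_irreducible Z"
  unfolding zariski_irreducible_def
proof (intro conjI allI impI)
  fix A B assume AB: "zariski_closed A \<and> zariski_closed B \<and> Z \<subseteq> A \<union> B"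
  then obtain S T where ST: "A = vanishing_locus S" "B = vanishing_locus T"
    unfolding zariski_closed_def by blast
  show "Z \<subseteq> A \<or> Z \<subseteq> B"
  proof (cases "Z \<subseteq> A")
    case False
    then obtain x p where x: "x \<in> Z" "p \<in> S" "eval_poly p x \<noteq> 0" unfolding ST vanishing_locus_def by blast
    have "eval_poly q y = 0" if "q \<in> T" "y \<in> Z" for q y
    proof -
      have "eval_poly p z * eval_poly q z = 0" if "z \<in> Z" for z
        using AB that x(2) \<open>q \<in> T\<close> unfolding ST vanishing_locus_def by auto
      then have "(\<forall>x\<in>Z. eval_poly p x = 0) \<or> (\<forall>x\<in>Z. eval_poly q x = 0)" by (rule prod)
      then show ?thesis using x that by blast
    qed
    then have "Z \<subseteq> B" unfolding ST vanishing_locus_def by blast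
    then show ?thesis ..
  qed simp
qed (rule assms(1))

lemma zariski_irreducible_affine:
  assumes "Z \<noteq> {}" and aff: "\<And>x y t. x \<in> Z \<Longrightarrow> y \<in> Z \<Longrightarrow> (\<chi> j. x $ j + t * (y $ j - x $ j)) \<in> Z"
  shows "zariski_irreducible Z"
proof (rule zariski_irreducibleI[OF assms(1)])
  fix p q assume pq: "\<And>x. x \<in> Z \<Longrightarrow> eval_poly p x * eval_poly q x = 0"
  show "(\<forall>x\<in>Z. eval_poly p x = 0) \<or> (\<forall>x\<in>Z. eval_poly q x = 0)"
  proof (rule disjCI)
    assume "\<not> (\<forall>x\<in>Z. eval_poly q x = 0)"
    then obtain x where x: "x \<in> Z" "eval_poly q x \<noteq> 0" by blast
    have qp: "eval_poly q x * eval_poly p x = 0" if "x \<in> Z" for x using pq[OF that] by (simp only: mult.commute)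
    show "\<forall>x\<in>Z. eval_poly p x = 0"
      using vanishing_product_on_affine[OF aff qp x] by blast
  qed
qed

text \<open>
  By the Nullstellensatz a polynomial vanishing on the zero set of \<open>p\<close> has a power divisible by \<open>p\<close>.
\<close>

lemma prime_dvd_iff_vanishing:
  fixes p q :: "3 mpoly"
  assumes p: "prime_elem p"
  shows "p dvd q \<longleftrightarrow> (\<forall>x. eval_poly p x = 0 \<longrightarrow> eval_poly q x = 0)"
proof
  assume "p dvd q"
  then obtain k where "q = p * k" ..
  then show "\<forall>x. eval_poly p x = 0 \<longrightarrow> eval_poly q x = 0" by simp
next
  assume van: "\<forall>x. eval_poly p x = 0 \<longrightarrow> eval_poly q x = 0"
  have "\<exists>N. q ^ N \<in> {r. p dvd r}"
  proof (rule nullstellensatz[OF subspace_dvd])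
    fix x assume "\<And>r. r \<in> {r. p dvd r} \<Longrightarrow> eval_poly r x = 0"
    then have "eval_poly p x = 0" by simp
    then show "eval_poly q x = 0" using van by blast
  qed
  then show "p dvd q" using prime_elem_dvd_power[OF p] by blast
qed

lemma zariski_irreducible_prime:
  fixes p :: "3 mpoly"
  assumes p: "prime_elem p"
  shows "zariski_irreducible {x. eval_poly p x = 0}"
proof (rule zariski_irreducibleI)
  have "1 \<notin> {r. p dvd r}" using p unfolding prime_elem_def by blast
  then obtain x where "\<forall>q\<in>{r. p dvd r}. eval_poly q x = 0" using weak_nullstellensatz[OF subspace_dvd] by blast
  then have "eval_poly p x = 0" by simp
  then show "{x. eval_poly p x = 0} \<noteq> {}" by blast
next
  fix q r assume "\<And>x. x \<in> {x. eval_poly p x = 0} \<Longrightarrow> eval_poly q x * eval_poly r x = 0"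
  then have "p dvd q * r" unfolding prime_dvd_iff_vanishing[OF p] by simp
  then have "p dvd q \<or> p dvd r" using p prime_elem_dvd_mult_iff by blast
  then show "(\<forall>x\<in>{x. eval_poly p x = 0}. eval_poly q x = 0) \<or> (\<forall>x\<in>{x. eval_poly p x = 0}. eval_poly r x = 0)"
    unfolding prime_dvd_iff_vanishing[OF p] by blast
qed

text \<open>
  A chain of length \<open>k\<close> bounds the dimension from below. The set is nonempty because an irreducible set
  is, so its codimension is finite.
\<close>

lemma zariski_codim_le:
  fixes Y :: "(complex ^ 3) set"
  assumes Z: "\<And>i. i \<le> k \<Longrightarrow> zariski_closed (Z i) \<and> zariski_irreducible (Z i) \<and> Z i \<subseteq> Y"
    and strict: "\<And>i. i < k \<Longrightarrow> Z i \<subset> Z (Suc i)"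
  shows "zariski_codim Y \<le> enat (3 - k)"
proof -
  have "enat k \<le> zariski_dim Y"
    unfolding zariski_dim_def using assms by (intro Sup_upper) blast
  moreover have "Y \<noteq> {}" using Z[of 0] unfolding zariski_irreducible_def by blast
  ultimately show ?thesis
    unfolding zariski_codim_def by (cases "zariski_dim Y") (auto simp: zero_enat_def[symmetric])
qed

definition line_through_origin :: "complex ^ 3 \<Rightarrow> (complex ^ 3) set" where
  "line_through_origin y = range (\<lambda>t. t *s y)"

lemma line_closed_irreducible:
  assumes "y \<noteq> 0"
  shows "zariski_closed (line_through_origin y)" "zariski_irreducible (line_through_origin y)"
proof -
  obtain a where a: "y $ a \<noteq> 0" using assms by (auto simp: vec_eq_iff)
  let ?q = "\<lambda>k. const_poly (y $ a) * var_poly k - const_poly (y $ k) * var_poly a :: 3 mpoly"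
  have "line_through_origin y = vanishing_locus (range ?q)"
  proof (intro equalityI subsetI)
    fix x assume "x \<in> line_through_origin y"
    then show "x \<in> vanishing_locus (range ?q)" by (auto simp: line_through_origin_def vanishing_locus_def)
  next
    fix x assume "x \<in> vanishing_locus (range ?q)"
    then have "y $ a * x $ k = y $ k * x $ a" for k by (simp add: vanishing_locus_def)
    then have "x $ k = (x $ a / y $ a) * y $ k" for k using a by (simp add: field_simps)
    then have "x = (x $ a / y $ a) *s y" unfolding vec_eq_iff vector_smult_component by blast
    then show "x \<in> line_through_origin y" unfolding line_through_origin_def by (rule range_eqI)
  qed
  then show "zariski_closed (line_through_origin y)" unfolding zariski_closed_def by blast
  show "zariski_irreducible (line_through_origin y)"
  proof (rule zariski_irreducible_affine)
    fix x z t assume "x \<in> line_through_origin y" "z \<in> line_through_origin y"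
    then obtain b c where bc: "x = b *s y" "z = c *s y" unfolding line_through_origin_def by blast
    have "(\<chi> j. x $ j + t * (z $ j - x $ j)) = (b + t * (c - b)) *s y"
      unfolding bc by (simp add: vec_eq_iff algebra_simps)
    then show "(\<chi> j. x $ j + t * (z $ j - x $ j)) \<in> line_through_origin y"
      unfolding line_through_origin_def by (rule range_eqI)
  qed (simp add: line_through_origin_def)
qed

lemma origin_closed_irreducible:
  "zariski_closed {0 :: complex ^ 3}" "zariski_irreducible {0 :: complex ^ 3}"
proof -
  have "{0 :: complex ^ 3} = vanishing_locus (range var_poly)"
    by (auto simp: vanishing_locus_def vec_eq_iff)
  then show "zariski_closed {0 :: complex ^ 3}" unfolding zariski_closed_def by blast
  show "zariski_irreducible {0 :: complex ^ 3}"
    by (rule zariski_irreducible_affine) (auto simp: vec_eq_iff)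
qed

lemma origin_psubset_line: "y \<noteq> 0 \<Longrightarrow> {0} \<subset> line_through_origin y"
proof -
  assume y: "y \<noteq> 0"
  have "0 *s y \<in> line_through_origin y" "1 *s y \<in> line_through_origin y"
    unfolding line_through_origin_def by blast+
  then have "0 \<in> line_through_origin y" "y \<in> line_through_origin y" by simp_all
  then show "{0} \<subset> line_through_origin y" using y by blast
qed

lemma codim_space: "zariski_codim (UNIV :: (complex ^ 3) set) \<le> 0"
proof -
  define Z where "Z i = {x :: complex ^ 3. (i \<le> 2 \<longrightarrow> x $ 1 = 0) \<and> (i \<le> 1 \<longrightarrow> x $ 2 = 0) \<and> (i = 0 \<longrightarrow> x $ 3 = 0)}" for i :: nat
  have "zariski_codim (UNIV :: (complex ^ 3) set) \<le> enat (3 - 3)"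
  proof (rule zariski_codim_le)
    fix i :: nat assume "i \<le> 3"
    have "Z i = vanishing_locus ({q. i \<le> 2 \<and> q = var_poly 1} \<union> {q. i \<le> 1 \<and> q = var_poly 2} \<union> {q. i = 0 \<and> q = var_poly 3})"
      by (auto simp: Z_def vanishing_locus_def)
    then have "zariski_closed (Z i)" unfolding zariski_closed_def by blast
    moreover have "0 \<in> Z i" by (simp add: Z_def)
    then have ne: "Z i \<noteq> {}" by blast
    have "zariski_irreducible (Z i)"
      by (rule zariski_irreducible_affine[OF ne]) (auto simp: Z_def)
    ultimately show "zariski_closed (Z i) \<and> zariski_irreducible (Z i) \<and> Z i \<subseteq> UNIV" by simp
  next
    fix i :: nat assume i: "i < 3"
    define e :: "complex ^ 3" where "e = axis (if i = 0 then 3 else if i = 1 then 2 else 1) 1"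
    have "e \<in> Z (Suc i)" "e \<notin> Z i" using i by (auto simp: Z_def e_def axis_def)
    moreover have "Z i \<subseteq> Z (Suc i)" by (auto simp: Z_def)
    ultimately show "Z i \<subset> Z (Suc i)" by blast
  qed
  then show ?thesis by (simp add: zero_enat_def)
qed

text \<open>
  Two independent linear forms vanish on a line. If the zero set of \<open>p\<close> were inside, \<open>p\<close> would divide
  both; since they are prime, they would be associated.
\<close>

lemma prime_locus_not_in_line:
  fixes p :: "3 mpoly"
  assumes p: "prime_elem p" and y: "y \<noteq> 0"
  shows "\<not> {x. eval_poly p x = 0} \<subseteq> line_through_origin y"
proof
  assume sub: "{x. eval_poly p x = 0} \<subseteq> line_through_origin y"
  obtain a where a: "y $ a \<noteq> 0" using y by (auto simp: vec_eq_iff)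
  obtain k l where kl: "k \<noteq> a" "l \<noteq> a" "k \<noteq> (l :: 3)"
    using exhaust_3[of a] three_neq by metis
  define c where "c j = (\<chi> i. if i = j then y $ a else if i = a then - (y $ j) else 0)" for j
  have ev: "eval_poly (linear_form (c j)) x = y $ a * x $ j - y $ j * x $ a" if "j \<noteq> a" for j x
  proof -
    have "(\<Sum>i\<in>UNIV. c j $ i * x $ i) = (\<Sum>i\<in>UNIV. (if i = j then y $ a * x $ j else 0) + (if i = a then - (y $ j * x $ a) else 0))"
      by (rule sum.cong) (use that in \<open>auto simp: c_def\<close>)
    then show ?thesis by (simp add: sum.distrib)
  qed
  have c0: "c j \<noteq> 0" for j using a by (auto simp: c_def vec_eq_iff)
  have dvd: "p dvd linear_form (c j)" if "j \<noteq> a" for j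
    unfolding prime_dvd_iff_vanishing[OF p]
  proof (intro allI impI)
    fix x assume "eval_poly p x = 0"
    then obtain t where "x = t *s y" using sub unfolding line_through_origin_def by blast
    then show "eval_poly (linear_form (c j)) x = 0" unfolding ev[OF that] by simp
  qed
  have "\<not> p dvd 1" using p unfolding prime_elem_def by blast
  then have "linear_form (c k) dvd p"
    using prime_dvd_prime[OF prime_linear_form[OF c0] _ dvd[OF kl(1)]] by blast
  then have "linear_form (c k) dvd linear_form (c l)" using dvd[OF kl(2)] by (rule dvd_trans)
  then obtain q where q: "linear_form (c l) = linear_form (c k) * q" ..
  have "eval_poly (linear_form (c l)) (axis l 1) = eval_poly (linear_form (c k)) (axis l 1) * eval_poly q (axis l 1)"
    unfolding q by (simp only: eval_simps)
  then show False unfolding ev[OF kl(1)] ev[OF kl(2)] using kl a by (simp add: axis_def)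
qed

context arrangement
begin

lemma codim_le_0:
  assumes "omega_poly lam = 0"
  shows "zariski_codim (Sigma_bar n f lam) \<le> 0"
proof -
  have "eval_poly q x = 0" if "q \<in> crit lam" for q x using crit_trivial[OF assms that] by simp
  then have "Sigma_bar n f lam = UNIV" unfolding Sigma_bar_eq by blast
  then show ?thesis using codim_space by simp
qed

text \<open>
  The surface is the zero set of a prime factor \<open>p\<close> of \<open>r = p ^ k * s\<close>. It is a cone: on a line through
  the origin and a point with \<open>p = 0\<close>, \<open>s \<noteq> 0\<close>, the product \<open>p s\<close> vanishes, hence \<open>p\<close> does. So
  \<open>s\<close> times any dilation of \<open>p\<close> vanishes on the surface, and \<open>p\<close> divides its dilations. As a cone the
  surface contains the chain of the origin and a line.
\<close>

lemma codim_le_1: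
  assumes r: "r \<noteq> 0" "\<not> r dvd 1" "\<And>u. u \<in> crit lam \<Longrightarrow> r dvd u" "\<And>t. t \<noteq> 0 \<Longrightarrow> r dvd dilate t r"
  shows "zariski_codim (Sigma_bar n f lam) \<le> 1"
proof -
  obtain p k s where p: "prime_elem p" "k > 0" "r = p ^ k * s" "\<not> p dvd s"
    using prime_power_decomposition[OF r(1,2)] .
  define S where "S = {x. eval_poly p x = 0}"
  have S_r: "eval_poly r x = 0" if "x \<in> S" for x using that p(2) by (simp add: p(3) S_def)
  have "S \<subseteq> Sigma_bar n f lam"
  proof
    fix x assume x: "x \<in> S"
    have "eval_poly u x = 0" if u: "u \<in> crit lam" for u
    proof -
      obtain q where "u = r * q" using r(3)[OF u] ..
      then show ?thesis using S_r[OF x] by simp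
    qed
    then show "x \<in> Sigma_bar n f lam" by (simp add: Sigma_bar_eq)
  qed
  have cone: "t *s x \<in> S" if x: "x \<in> S" for t x
  proof -
    have gen: "eval_poly p (t *s y) = 0" if y: "y \<in> S" "eval_poly s y \<noteq> 0" for y t
    proof -
      have "eval_poly r (t *s y) = 0" if "t \<noteq> 0" for t
      proof -
        obtain q where q: "dilate t r = r * q" using r(4)[OF \<open>t \<noteq> 0\<close>] ..
        have "eval_poly (dilate t r) y = 0" unfolding q using S_r[OF y(1)] by simp
        then show ?thesis by simp
      qed
      then have zero: "eval_poly p (t *s y) * eval_poly s (t *s y) = 0" if "t \<noteq> 0" for t
        using that p(2) by (simp add: p(3))
      \<comment> \<open>The factor \<open>t\<close> makes the product vanish at \<open>t = 0\<close> as well.\<close>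
      let ?P = "[:0, 1:] * (line_poly 0 y p * line_poly 0 y s)"
      have "poly ?P t = 0" for t
        using zero[of t] by (cases "t = 0") (simp_all add: poly_line_poly vector_scalar_mult_def)
      then have "?P = 0" using poly_all_0_iff_0 by blast
      moreover have "poly (line_poly 0 y s) 1 \<noteq> 0" using y(2) by (simp add: poly_line_poly)
      then have "line_poly 0 y s \<noteq> 0" by auto
      ultimately have "line_poly 0 y p = 0" by simp
      then have "poly (line_poly 0 y p) t = 0" by simp
      then show ?thesis by (simp add: poly_line_poly vector_scalar_mult_def)
    qed
    have "p dvd dilate t p * s"
      unfolding prime_dvd_iff_vanishing[OF p(1)] using gen by (auto simp: S_def)
    then have "p dvd dilate t p" using p(1,4) prime_elem_dvd_mult_iff by blast
    then have "eval_poly (dilate t p) x = 0" using x unfolding prime_dvd_iff_vanishing[OF p(1)] S_def by blast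
    then show ?thesis by (simp add: S_def)
  qed
  have irr: "zariski_irreducible S" unfolding S_def by (rule zariski_irreducible_prime[OF p(1)])
  have closed: "zariski_closed S"
    unfolding zariski_closed_def S_def by (rule exI[of _ "{p}"]) (simp add: vanishing_locus_def)
  have "\<exists>y\<in>S. y \<noteq> 0"
  proof (rule ccontr)
    assume "\<not> ?thesis"
    then have "\<forall>x. eval_poly p x = 0 \<longrightarrow> eval_poly (var_poly k) x = 0" for k by (auto simp: S_def)
    then have "p dvd var_poly k" for k unfolding prime_dvd_iff_vanishing[OF p(1)] .
    moreover have "\<not> p dvd 1" using p(1) unfolding prime_elem_def by blast
    ultimately show False using nonunit_not_dvd_variables by blast
  qed
  then obtain y where y: "y \<in> S" "y \<noteq> 0" by blast
  have line: "line_through_origin y \<subset> S"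
    using cone[OF y(1)] prime_locus_not_in_line[OF p(1) y(2)] unfolding line_through_origin_def S_def by blast
  define Z where "Z i = (if i = 0 then {0} else if i = 1 then line_through_origin y else S)" for i :: nat
  have "zariski_codim (Sigma_bar n f lam) \<le> enat (3 - 2)"
  proof (rule zariski_codim_le[of 2 Z])
    fix i :: nat assume "i \<le> 2"
    have "Z i \<subseteq> S" using line origin_psubset_line[OF y(2)] by (auto simp: Z_def)
    then have "Z i \<subseteq> Sigma_bar n f lam" using \<open>S \<subseteq> Sigma_bar n f lam\<close> by blast
    moreover have "zariski_closed (Z i) \<and> zariski_irreducible (Z i)"
      using irr closed line_closed_irreducible[OF y(2)] origin_closed_irreducible by (simp add: Z_def)
    ultimately show "zariski_closed (Z i) \<and> zariski_irreducible (Z i) \<and> Z i \<subseteq> Sigma_bar n f lam"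
      by blast
  next
    fix i :: nat assume "i < 2"
    then have "i = 0 \<or> i = 1" by auto
    then show "Z i \<subset> Z (Suc i)" using line origin_psubset_line[OF y(2)] by (elim disjE) (simp_all add: Z_def)
  qed
  then show ?thesis by (simp add: one_enat_def)
qed

text \<open>
  Being a cone, \<open>\<Sigma>\<close> contains the line through any of its nonzero points.
\<close>

lemma codim_le_2:
  assumes "0 \<in> Sigma_bar n f lam"
  shows "zariski_codim (Sigma_bar n f lam) \<le> enat 2"
proof -
  obtain y where y: "y \<in> Sigma_bar n f lam" "y \<noteq> 0" using Sigma_bar_not_origin[OF assms] by blast
  define Z where "Z i = (if i = 0 then {0} else line_through_origin y)" for i :: nat
  have "line_through_origin y \<subseteq> Sigma_bar n f lam"
    using Sigma_bar_cone[OF y(1)] unfolding line_through_origin_def by blast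
  then have "zariski_codim (Sigma_bar n f lam) \<le> enat (3 - 1)"
    using assms line_closed_irreducible[OF y(2)] origin_closed_irreducible origin_psubset_line[OF y(2)]
    by (intro zariski_codim_le[of 1 Z]) (auto simp: Z_def)
  then show ?thesis by simp
qed

end

theorem corollary4p2:
  fixes n p :: nat
    and f :: "nat \<Rightarrow> complex ^ 3"
    and lam :: "nat \<Rightarrow> complex"
  assumes "central_essential_arrangement n f"
    and "carrier (OS_cohomology n f lam p) \<noteq> {\<one>\<^bsub>OS_cohomology n f lam p\<^esub>}"
  shows "zariski_codim (Sigma_bar n f lam) \<le> enat p"
proof -
  interpret arrangement n f by unfold_locales (rule assms(1))
  obtain \<alpha> where \<alpha>: "\<alpha> \<in> OS_cocycles n f lam p" "\<alpha> \<notin> OS_coboundaries n f lam p"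
    using nontrivial_class[OF assms(2)] .
  consider "p = 0" | "p = 1" | "p \<ge> 2" by linarith
  then show ?thesis
  proof cases
    case 1
    have "omega_poly lam = 0" using omega_poly_zero_if_cohomology_0 \<alpha> unfolding 1 by blast
    then show ?thesis unfolding 1 by (metis codim_le_0 zero_enat_def)
  next
    case 2
    have "zariski_codim (Sigma_bar n f lam) \<le> 1"
    proof (cases "omega_poly lam = 0")
      case True
      have "zariski_codim (Sigma_bar n f lam) \<le> 0" by (rule codim_le_0[OF True])
      then show ?thesis using order_trans[of _ 0 "1 :: enat"] by simp
    next
      case False
      obtain \<mu> where "vprod (omega_poly lam) (omega_poly \<mu>) = 0" "\<And>c. omega_poly \<mu> \<noteq> const_poly c *s omega_poly lam"
        using parallel_if_cohomology_1 \<alpha> unfolding 2 by blast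
      then obtain r where "r \<noteq> 0" "\<not> r dvd 1" "\<And>u. u \<in> crit lam \<Longrightarrow> r dvd u"
        "\<And>t. t \<noteq> 0 \<Longrightarrow> r dvd dilate t r"
        using common_factor[OF _ _ False] by metis
      then show ?thesis by (rule codim_le_1)
    qed
    then show ?thesis unfolding 2 by (simp add: one_enat_def)
  next
    case 3
    have "zariski_codim (Sigma_bar n f lam) \<le> enat 2" by (rule codim_le_2[OF origin_in_Sigma_bar[OF \<alpha>]])
    also have "enat 2 \<le> enat p" using 3 by simp
    finally show ?thesis .
  qed
qed

end
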